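(* Let $\alpha:G\curvearrowright X$ be an expansive, minimal, essentially free action of a discrete countable group $G$ on the Cantor set $X$. Then $G$ is finitely generated if and only if $\mathsf{A}(G\ltimes X)$ is finitely generated.
   Context: The action (by homeomorphisms) is expansive if, for a metric $d$ on $X$ inducing its topology, there is $\epsilon>0$ such that for all $x\ne y$ in $X$ there is $g\in G$ with $d(gx,gy)>\epsilon$. It is minimal if every orbit is dense, and essentially free if the set of points with trivial stabiliser is dense in $X$. $G\ltimes X$ is the transformation groupoid: elements $(g,x)$, source $x$, range $g(x)$, product $(g,h(x))(h,x)=(gh,x)$, with the product topology. For an effective étale groupoid $\mathcal{G}$ with Cantor unit space and infinite orbits, the topological full group $\mathsf{F}(\mathcal{G})$ is the group of compact open bisections $B$ with $s(B)=r(B)=\mathcal{G}^{(0)}$. For compact open bisections $B_1,B_2$ with $r(B_1)=s(B_2)$ and with $s(B_1)$, $r(B_1)=s(B_2)$, $r(B_2)$ pairwise disjoint, put $$\gamma_{B_1,B_2}=B_1\sqcup B_2\sqcup(B_2B_1)^{-1}\sqcup\big(\mathcal{G}^{(0)}\setminus(s(B_1)\sqcup s(B_2)\sqcup r(B_2))\big)\in\mathsf{F}(\mathcal{G}),$$ where a product $\gamma_2\gamma_1$ is defined when $s(\gamma_2)=r(\gamma_1)$. $\mathsf{A}(\mathcal{G})$ is the subgroup of $\mathsf{F}(\mathcal{G})$ generated by all such $\gamma_{B_1,B_2}$. *)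

theory Defs
  imports
    "HOL-Analysis.Analysis"
    "HOL-Algebra.Generated_Groups"
    "HOL-Algebra.Group_Action"
    "HOL-Library.Countable_Set"
begin

definition finitely_generated :: "('a, 'b) monoid_scheme \<Rightarrow> bool" where
  "finitely_generated G \<longleftrightarrow>
     (\<exists>S. finite S \<and> S \<subseteq> carrier G \<and> generate G S = carrier G)"

definition cantor_space :: "'x topology \<Rightarrow> bool" where
  "cantor_space X \<longleftrightarrow>
     X homeomorphic_space product_topology (\<lambda>_::nat. discrete_topology (UNIV :: bool set)) UNIV"

definition action_by_homeomorphisms ::
    "('g, 'b) monoid_scheme \<Rightarrow> 'x topology \<Rightarrow> ('g \<Rightarrow> 'x \<Rightarrow> 'x) \<Rightarrow> bool" where
  "action_by_homeomorphisms G X \<alpha> \<longleftrightarrow>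
     group_action G (topspace X) \<alpha> \<and> (\<forall>g \<in> carrier G. homeomorphic_map X X (\<alpha> g))"

definition expansive_action ::
    "('g, 'b) monoid_scheme \<Rightarrow> 'x topology \<Rightarrow> ('g \<Rightarrow> 'x \<Rightarrow> 'x) \<Rightarrow> bool" where
  "expansive_action G X \<alpha> \<longleftrightarrow>
     (\<exists>d. Metric_space (topspace X) d \<and> Metric_space.mtopology (topspace X) d = X \<and>
        (\<exists>\<epsilon>>0. \<forall>x \<in> topspace X. \<forall>y \<in> topspace X. x \<noteq> y \<longrightarrow>
           (\<exists>g \<in> carrier G. d (\<alpha> g x) (\<alpha> g y) > \<epsilon>)))"

definition minimal_action ::
    "('g, 'b) monoid_scheme \<Rightarrow> 'x topology \<Rightarrow> ('g \<Rightarrow> 'x \<Rightarrow> 'x) \<Rightarrow> bool" where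
  "minimal_action G X \<alpha> \<longleftrightarrow>
     (\<forall>x \<in> topspace X. X closure_of (orbit G \<alpha> x) = topspace X)"

definition essentially_free_action ::
    "('g, 'b) monoid_scheme \<Rightarrow> 'x topology \<Rightarrow> ('g \<Rightarrow> 'x \<Rightarrow> 'x) \<Rightarrow> bool" where
  "essentially_free_action G X \<alpha> \<longleftrightarrow>
     X closure_of {x \<in> topspace X. stabilizer G \<alpha> x = {\<one>\<^bsub>G\<^esub>}} = topspace X"

text \<open>
  The set of arrows is the topspace of \<open>Arr\<close>.  Units are regarded as arrows, so \<open>src\<close> and
  \<open>rng\<close> take values in arrows.  The total function \<open>cmp\<close> carries the partial product: only
  the values \<open>cmp \<G> a b\<close> with \<open>src \<G> a = rng \<G> b\<close> are meaningful.
\<close>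

record 'a groupoid_data =
  Arr :: "'a topology"
  src :: "'a \<Rightarrow> 'a"
  rng :: "'a \<Rightarrow> 'a"
  cmp :: "'a \<Rightarrow> 'a \<Rightarrow> 'a"
  ginv :: "'a \<Rightarrow> 'a"

definition unit_space :: "('a, 'b) groupoid_data_scheme \<Rightarrow> 'a set" where
  "unit_space \<G> = src \<G> ` topspace (Arr \<G>)"

definition set_cmp :: "('a, 'b) groupoid_data_scheme \<Rightarrow> 'a set \<Rightarrow> 'a set \<Rightarrow> 'a set" where
  "set_cmp \<G> B C = {cmp \<G> b c | b c. b \<in> B \<and> c \<in> C \<and> src \<G> b = rng \<G> c}"

text \<open>
  Injectivity is all that is required of \<open>src\<close> and \<open>rng\<close>: in an etale groupoid these are
  local homeomorphisms, so on an open set where they are injective they are automatically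
  homeomorphisms onto open sets of units.
\<close>

definition compact_open_bisection :: "('a, 'b) groupoid_data_scheme \<Rightarrow> 'a set \<Rightarrow> bool" where
  "compact_open_bisection \<G> B \<longleftrightarrow>
     openin (Arr \<G>) B \<and> compactin (Arr \<G>) B \<and> inj_on (src \<G>) B \<and> inj_on (rng \<G>) B"

definition topological_full_group :: "('a, 'b) groupoid_data_scheme \<Rightarrow> 'a set monoid" where
  "topological_full_group \<G> =
     \<lparr>carrier = {B. compact_open_bisection \<G> B \<and>
                    src \<G> ` B = unit_space \<G> \<and> rng \<G> ` B = unit_space \<G>},
      mult = set_cmp \<G>,
      one = unit_space \<G>\<rparr>"

definition gamma_admissible ::
    "('a, 'b) groupoid_data_scheme \<Rightarrow> 'a set \<Rightarrow> 'a set \<Rightarrow> bool" where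
  "gamma_admissible \<G> B1 B2 \<longleftrightarrow>
     compact_open_bisection \<G> B1 \<and> compact_open_bisection \<G> B2 \<and>
     rng \<G> ` B1 = src \<G> ` B2 \<and>
     src \<G> ` B1 \<inter> rng \<G> ` B1 = {} \<and>
     src \<G> ` B1 \<inter> rng \<G> ` B2 = {} \<and>
     rng \<G> ` B1 \<inter> rng \<G> ` B2 = {}"

definition gamma :: "('a, 'b) groupoid_data_scheme \<Rightarrow> 'a set \<Rightarrow> 'a set \<Rightarrow> 'a set" where
  "gamma \<G> B1 B2 =
     B1 \<union> B2 \<union> ginv \<G> ` set_cmp \<G> B2 B1 \<union>
     (unit_space \<G> - (src \<G> ` B1 \<union> src \<G> ` B2 \<union> rng \<G> ` B2))"

definition alternating_full_group :: "('a, 'b) groupoid_data_scheme \<Rightarrow> 'a set monoid" where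
  "alternating_full_group \<G> =
     (topological_full_group \<G>)
       \<lparr>carrier := generate (topological_full_group \<G>)
                     {gamma \<G> B1 B2 | B1 B2. gamma_admissible \<G> B1 B2}\<rparr>"

text \<open>The point \<open>x\<close> of the space is identified with the unit \<open>(\<one>, x)\<close>.\<close>

definition transformation_groupoid ::
    "('g, 'b) monoid_scheme \<Rightarrow> 'x topology \<Rightarrow> ('g \<Rightarrow> 'x \<Rightarrow> 'x) \<Rightarrow> ('g \<times> 'x) groupoid_data" where
  "transformation_groupoid G X \<alpha> =
     \<lparr>Arr = prod_topology (discrete_topology (carrier G)) X,
      src = (\<lambda>(g, x). (\<one>\<^bsub>G\<^esub>, x)),
      rng = (\<lambda>(g, x). (\<one>\<^bsub>G\<^esub>, \<alpha> g x)),
      cmp = (\<lambda>(g, y) (h, x). (g \<otimes>\<^bsub>G\<^esub> h, x)),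
      ginv = (\<lambda>(g, x). (inv\<^bsub>G\<^esub> g, \<alpha> g x))\<rparr>"

end

theory Submission
  imports Defs
begin

text \<open>
  By effectiveness an element of the full group is determined by the homeomorphism it induces,
  so one may compute with functions on the space, and the alternating group is generated by
  the elements \<open>rot V a b c\<close> permuting three disjoint translates \<open>a V\<close>, \<open>b V\<close>, \<open>c V\<close> of a
  clopen set cyclically.

  If finitely many elements generate the alternating group, the finitely many group elements
  occurring in them generate a subgroup \<open>H\<close> such that all arrows of all elements of the
  alternating group have labels in \<open>H\<close>; every element of \<open>G\<close> is a label of some \<open>rot\<close>.

  Conversely, fix a finite clopen partition whose pieces \<open>P\<close> carry several labels with disjoint
  translates.  Commutators of 3-cycles over \<open>W\<close> and \<open>W'\<close> give 3-cycles over \<open>W \<inter> W'\<close>, and adding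
  finitely many elements that move labels of one piece to labels of another makes the family
  of those \<open>W\<close> over which all 3-cycles are available invariant under a finite generating set of
  \<open>G\<close>.  By expansivity, finitely many further 3-cycles make this family contain all clopen
  sets.  Conjugating 3-cycles by one another then moves the labels along words in the
  generators, so that all 3-cycles over small sets are obtained.
\<close>

section \<open>Actions on zero-dimensional compact spaces\<close>

text \<open>The obstacle is uniformity: the finite set must be fixed in advance, whereas base sets
  shrink without bound and labels are words of unbounded length. The two kinds of growth are treated
  separately. For the base sets, finitely many labels are kept on each piece; a commutator creates
  no new labels, so Boolean operations and translations can be iterated freely. For the labels,
  \<open>good\<close> speaks about an unspecified neighbourhood of one point, which each step along
  a word may shrink; compactness comes back only after all labels have been reached. The
  relabellings fixed in advance are conjugations by elements of the alternating group. One such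
  element serves all base sets inside a neighbourhood, so finitely many suffice. The degree 8 comes
  from the second stage: one centre, four positions to avoid and three free labels; the commutator
  argument asks for 5. Finite generation is phrased as: every function group containing
  \<open>F\<close> contains every 3-cycle.\<close>

definition zero_dimensional :: "'x topology \<Rightarrow> bool" where
  "zero_dimensional X \<longleftrightarrow>
     (\<forall>U x. openin X U \<and> x \<in> U \<longrightarrow> (\<exists>K. openin X K \<and> closedin X K \<and> x \<in> K \<and> K \<subseteq> U))"

text \<open>Minimality is represented by infinite orbits, which supply labels with images outside
  any finite set, and essential freeness by \<open>effective\<close>, which makes the label of a
  germ unique. Expansivity enters later, as a finite family of clopen sets whose translates separate
  points.\<close>

locale cantor_action = group G for G :: "('g, 'b) monoid_scheme" (structure) +
  fixes X :: "'x topology" and \<alpha> :: "'g \<Rightarrow> 'x \<Rightarrow> 'x"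
  assumes act_one: "x \<in> topspace X \<Longrightarrow> \<alpha> \<one> x = x"
    and act_mult: "\<lbrakk>g \<in> carrier G; h \<in> carrier G; x \<in> topspace X\<rbrakk> \<Longrightarrow> \<alpha> (g \<otimes> h) x = \<alpha> g (\<alpha> h x)"
    and act_homeo: "g \<in> carrier G \<Longrightarrow> homeomorphic_map X X (\<alpha> g)"
    and compact: "compact_space X"
    and hausdorff: "Hausdorff_space X"
    and zero_dim: "zero_dimensional X"
    and infinite_orbit: "x \<in> topspace X \<Longrightarrow> infinite (orbit G \<alpha> x)"
    and effective: "\<lbrakk>g \<in> carrier G; openin X U; U \<noteq> {}; \<And>u. u \<in> U \<Longrightarrow> \<alpha> g u = u\<rbrakk> \<Longrightarrow> g = \<one>"
begin

definition clopen :: "'x set \<Rightarrow> bool" where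
  "clopen V \<longleftrightarrow> openin X V \<and> closedin X V"

lemma clopen_subset: "clopen V \<Longrightarrow> V \<subseteq> topspace X"
  by (simp add: clopen_def openin_subset)

lemma clopen_open: "clopen V \<Longrightarrow> openin X V"
  by (simp add: clopen_def)

lemma clopen_empty [simp]: "clopen {}" and clopen_top [simp]: "clopen (topspace X)"
  by (auto simp: clopen_def)

lemma clopen_Int: "clopen V \<Longrightarrow> clopen W \<Longrightarrow> clopen (V \<inter> W)"
  and clopen_Un: "clopen V \<Longrightarrow> clopen W \<Longrightarrow> clopen (V \<union> W)"
  and clopen_Diff: "clopen V \<Longrightarrow> clopen W \<Longrightarrow> clopen (V - W)"
  by (auto simp: clopen_def openin_diff closedin_diff)

lemma clopen_nbhd:
  assumes "openin X U" "x \<in> U"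
  obtains K where "clopen K" "x \<in> K" "K \<subseteq> U"
  using assms zero_dim unfolding zero_dimensional_def clopen_def by blast

lemma act_in: "\<lbrakk>g \<in> carrier G; x \<in> topspace X\<rbrakk> \<Longrightarrow> \<alpha> g x \<in> topspace X"
  using act_homeo homeomorphic_imp_surjective_map by blast

lemma act_inv: "\<lbrakk>g \<in> carrier G; x \<in> topspace X\<rbrakk> \<Longrightarrow> \<alpha> (inv g) (\<alpha> g x) = x"
  and act_inv': "\<lbrakk>g \<in> carrier G; x \<in> topspace X\<rbrakk> \<Longrightarrow> \<alpha> g (\<alpha> (inv g) x) = x"
  using act_mult[of "inv g" g x] act_mult[of g "inv g" x] act_one[of x] by simp_all

lemma act_eq: "\<lbrakk>g \<in> carrier G; x \<in> topspace X; y \<in> topspace X\<rbrakk> \<Longrightarrow> \<alpha> g x = \<alpha> g y \<longleftrightarrow> x = y"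
  by (metis act_inv)

lemma act_image_open: "g \<in> carrier G \<Longrightarrow> openin X U \<Longrightarrow> openin X (\<alpha> g ` U)"
  by (meson act_homeo homeomorphic_map_openness_eq)

lemma act_image_clopen: "g \<in> carrier G \<Longrightarrow> clopen U \<Longrightarrow> clopen (\<alpha> g ` U)"
  unfolding clopen_def by (meson act_homeo homeomorphic_map_openness_eq homeomorphic_map_closedness_eq)

lemma act_preimage_open:
  assumes "g \<in> carrier G" "openin X U" shows "openin X {x \<in> topspace X. \<alpha> g x \<in> U}"
  using assms act_homeo homeomorphic_imp_continuous_map openin_continuous_map_preimage by blast

lemma act_image_mult: "\<lbrakk>g \<in> carrier G; h \<in> carrier G; U \<subseteq> topspace X\<rbrakk> \<Longrightarrow> \<alpha> g ` \<alpha> h ` U = \<alpha> (g \<otimes> h) ` U"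
  unfolding image_image by (rule image_cong) (auto simp: act_mult subset_iff)

lemma act_image_mem: 
  "\<lbrakk>g \<in> carrier G; U \<subseteq> topspace X; x \<in> topspace X\<rbrakk> \<Longrightarrow> \<alpha> g x \<in> \<alpha> g ` U \<longleftrightarrow> x \<in> U"
  by (auto simp: act_eq subset_iff)

lemma act_image_Int: "\<lbrakk>g \<in> carrier G; U \<subseteq> topspace X; V \<subseteq> topspace X\<rbrakk> \<Longrightarrow>
    \<alpha> g ` (U \<inter> V) = \<alpha> g ` U \<inter> \<alpha> g ` V"
  using inj_on_image_Int[OF homeomorphic_imp_injective_map[OF act_homeo]] by blast

section \<open>Compactness arguments with clopen sets\<close>

lemma compact_clopen_cover:
  assumes V: "clopen V" and U: "\<And>x. x \<in> V \<Longrightarrow> \<exists>U. openin X U \<and> x \<in> U \<and> (\<forall>W. clopen W \<and> W \<subseteq> U \<longrightarrow> N W)"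
  obtains \<K> where "finite \<K>" "V \<subseteq> \<Union>\<K>" "\<And>K. K \<in> \<K> \<Longrightarrow> clopen K \<and> (\<forall>W. clopen W \<and> W \<subseteq> K \<longrightarrow> N W)"
proof -
  define \<U> where "\<U> = {K. clopen K \<and> (\<forall>W. clopen W \<and> W \<subseteq> K \<longrightarrow> N W)}"
  have "V \<subseteq> \<Union>\<U>"
  proof
    fix x assume "x \<in> V"
    then obtain U where U1: "openin X U" "x \<in> U" "\<forall>W. clopen W \<and> W \<subseteq> U \<longrightarrow> N W" using U by blast
    then obtain K where "clopen K" "x \<in> K" "K \<subseteq> U" using clopen_nbhd by metis
    then show "x \<in> \<Union>\<U>" using U1 unfolding \<U>_def by blast
  qed
  moreover have "compactin X V" using V compact closedin_compact_space clopen_def by blast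
  moreover have "\<forall>U\<in>\<U>. openin X U" by (auto simp: \<U>_def clopen_def)
  ultimately obtain \<F> where "finite \<F>" "\<F> \<subseteq> \<U>" "V \<subseteq> \<Union>\<F>"
    unfolding compactin_def by meson
  then show ?thesis using that[of \<F>] unfolding \<U>_def by blast
qed

text \<open>A finite subcover is made disjoint by splitting off one member at a time; this is why
  the local hypothesis covers all clopen subsets of \<open>U\<close>, not just \<open>U\<close>
  itself. Passing from germs to global statements is always done through this principle or the
  partition lemma below.\<close>

lemma clopen_induct:
  assumes V: "clopen V"
    and empty: "\<Phi> {}"
    and un: "\<And>U W. \<lbrakk>clopen U; clopen W; U \<inter> W = {}; \<Phi> U; \<Phi> W\<rbrakk> \<Longrightarrow> \<Phi> (U \<union> W)"
    and loc: "\<And>x. x \<in> V \<Longrightarrow> \<exists>U. openin X U \<and> x \<in> U \<and> (\<forall>W. clopen W \<and> W \<subseteq> U \<longrightarrow> \<Phi> W)"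
  shows "\<Phi> V"
proof -
  obtain \<K> where \<K>: "finite \<K>" "V \<subseteq> \<Union>\<K>" "\<And>K. K \<in> \<K> \<Longrightarrow> clopen K \<and> (\<forall>W. clopen W \<and> W \<subseteq> K \<longrightarrow> \<Phi> W)"
    using compact_clopen_cover[OF V loc] by metis
  have "\<forall>W. clopen W \<and> W \<subseteq> \<Union>\<K> \<longrightarrow> \<Phi> W"
    using \<K>(1,3)
  proof (induction rule: finite_induct)
    case (insert K \<K>)
    show ?case
    proof (intro allI impI)
      fix W assume W: "clopen W \<and> W \<subseteq> \<Union>(insert K \<K>)"
      have K: "clopen K" using insert.prems by blast
      have 1: "\<Phi> (W \<inter> K)" using insert.prems W K clopen_Int by blast
      have "clopen (W - K)" "W - K \<subseteq> \<Union>\<K>" using W K clopen_Diff by auto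
      moreover have "\<forall>W. clopen W \<and> W \<subseteq> \<Union>\<K> \<longrightarrow> \<Phi> W"
        by (rule insert.IH) (use insert.prems in blast)
      ultimately have 2: "\<Phi> (W - K)" by simp
      have "W \<inter> K \<union> (W - K) = W" by blast
      then show "\<Phi> W" using un[OF clopen_Int clopen_Diff _ 1 2] W K by (metis Int_Diff_disjoint)
    qed
  qed (use empty in auto)
  then show ?thesis using V \<K>(2) by blast
qed

lemma clopen_partition:
  assumes loc: "\<And>x. x \<in> topspace X \<Longrightarrow> \<exists>U. openin X U \<and> x \<in> U \<and> (\<forall>W. clopen W \<and> W \<subseteq> U \<longrightarrow> N W)"
  obtains \<P> where "finite \<P>" "\<Union>\<P> = topspace X" "pairwise disjnt \<P>" "\<And>P. P \<in> \<P> \<Longrightarrow> clopen P \<and> N P"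
proof -
  have "\<exists>\<P>. finite \<P> \<and> \<Union>\<P> = topspace X \<and> pairwise disjnt \<P> \<and> (\<forall>P\<in>\<P>. clopen P \<and> N P)"
  proof (rule clopen_induct[OF clopen_top])
    fix U W assume "U \<inter> W = {}" and
      "\<exists>\<P>. finite \<P> \<and> \<Union>\<P> = U \<and> pairwise disjnt \<P> \<and> (\<forall>P\<in>\<P>. clopen P \<and> N P)"
      "\<exists>\<P>. finite \<P> \<and> \<Union>\<P> = W \<and> pairwise disjnt \<P> \<and> (\<forall>P\<in>\<P>. clopen P \<and> N P)"
    then obtain \<P> \<Q> where *: "U \<inter> W = {}" "finite \<P>" "\<Union>\<P> = U" "pairwise disjnt \<P>" "\<forall>P\<in>\<P>. clopen P \<and> N P"
      "finite \<Q>" "\<Union>\<Q> = W" "pairwise disjnt \<Q>" "\<forall>P\<in>\<Q>. clopen P \<and> N P" by metis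
    then have "pairwise disjnt (\<P> \<union> \<Q>)" unfolding pairwise_def disjnt_def by blast
    then show "\<exists>\<P>. finite \<P> \<and> \<Union>\<P> = U \<union> W \<and> pairwise disjnt \<P> \<and> (\<forall>P\<in>\<P>. clopen P \<and> N P)"
      using * by (intro exI[of _ "\<P> \<union> \<Q>"]) auto
  next
    fix x assume "x \<in> topspace X"
    then obtain U where U: "openin X U" "x \<in> U" "\<forall>W. clopen W \<and> W \<subseteq> U \<longrightarrow> N W" using loc by blast
    then show "\<exists>U. openin X U \<and> x \<in> U \<and> (\<forall>W. clopen W \<and> W \<subseteq> U \<longrightarrow>
       (\<exists>\<P>. finite \<P> \<and> \<Union>\<P> = W \<and> pairwise disjnt \<P> \<and> (\<forall>P\<in>\<P>. clopen P \<and> N P)))"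
      by (intro exI[of _ U] conjI allI impI, simp, simp) (rule_tac x="{W}" in exI, auto)
  qed (intro exI[of _ "{}"], auto)
  then obtain \<P> where "finite \<P>" "\<Union>\<P> = topspace X" "pairwise disjnt \<P>" "\<forall>P\<in>\<P>. clopen P \<and> N P"
    by meson
  then show ?thesis by (intro that[of \<P>]) auto
qed

text \<open>Two compactness arguments, as in Stone duality: for fixed \<open>x\<close> in
  \<open>C\<close>, finitely many members of \<open>\<B>\<close> missing \<open>x\<close> cover the
  complement of \<open>C\<close>, and the complement of their union is a member around
  \<open>x\<close> inside \<open>C\<close>; finitely many such members then cover
  \<open>C\<close>.\<close>

lemma boolean_separating:
  assumes clp: "\<And>W. W \<in> \<B> \<Longrightarrow> clopen W"
    and top: "topspace X \<in> \<B>"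
    and compl: "\<And>W. W \<in> \<B> \<Longrightarrow> topspace X - W \<in> \<B>"
    and int: "\<And>W W'. W \<in> \<B> \<Longrightarrow> W' \<in> \<B> \<Longrightarrow> W \<inter> W' \<in> \<B>"
    and sep: "\<And>x y. \<lbrakk>x \<in> topspace X; y \<in> topspace X; x \<noteq> y\<rbrakk> \<Longrightarrow> \<exists>W\<in>\<B>. x \<in> W \<and> y \<notin> W"
    and C: "clopen C"
  shows "C \<in> \<B>"
proof -
  have un: "W \<union> W' \<in> \<B>" if "W \<in> \<B>" "W' \<in> \<B>" for W W'
  proof -
    have "W \<union> W' = topspace X - ((topspace X - W) \<inter> (topspace X - W'))"
      using that clp clopen_subset by blast
    then show ?thesis using that compl int by simp
  qed
  have empty: "{} \<in> \<B>" using compl[OF top] by simp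
  have Un: "\<Union>\<F> \<in> \<B>" if "finite \<F>" "\<F> \<subseteq> \<B>" for \<F>
    using that by (induction rule: finite_induct) (auto simp: empty un)
  have opn: "openin X W" if "W \<in> \<B>" for W using clp clopen_def that by blast
  have cpt: "compactin X D" if "clopen D" for D using that compact closedin_compact_space clopen_def by blast
  have 1: "\<exists>W\<in>\<B>. x \<in> W \<and> W \<subseteq> C" if x: "x \<in> C" for x
  proof -
    have "topspace X - C \<subseteq> \<Union>{W \<in> \<B>. x \<notin> W}"
    proof
      fix y assume y: "y \<in> topspace X - C"
      then have "\<exists>W\<in>\<B>. y \<in> W \<and> x \<notin> W" using sep[of y x] x C clopen_subset by blast
      then show "y \<in> \<Union>{W \<in> \<B>. x \<notin> W}" by blast
    qed
    moreover have "compactin X (topspace X - C)" using cpt clopen_Diff C clopen_top by blast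
    ultimately obtain \<F> where \<F>: "finite \<F>" "\<F> \<subseteq> {W \<in> \<B>. x \<notin> W}" "topspace X - C \<subseteq> \<Union>\<F>"
      unfolding compactin_def using opn by (metis (no_types, lifting) mem_Collect_eq)
    then have "topspace X - \<Union>\<F> \<in> \<B>" by (intro compl Un) auto
    moreover have "x \<in> topspace X - \<Union>\<F>" using \<F>(2) x clopen_subset[OF C] by blast
    moreover have "topspace X - \<Union>\<F> \<subseteq> C" using \<F>(3) by blast
    ultimately show ?thesis by blast
  qed
  then have "C \<subseteq> \<Union>{W \<in> \<B>. W \<subseteq> C}" by blast
  then obtain \<F> where \<F>: "finite \<F>" "\<F> \<subseteq> {W \<in> \<B>. W \<subseteq> C}" "C \<subseteq> \<Union>\<F>"
    using cpt[OF C] opn unfolding compactin_def by (metis (no_types, lifting) mem_Collect_eq)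
  then have "C = \<Union>\<F>" by blast
  moreover have "\<Union>\<F> \<in> \<B>" using \<F> by (intro Un) auto
  ultimately show ?thesis by simp
qed

text \<open>Finitely many open conditions, one for each pair of labels with distinct images at
  \<open>x\<close>. Pairs with equal images impose nothing, so any finite set of labels may be
  passed, coincidences included.\<close>

lemma separating_nbhd:
  assumes L: "finite L" "L \<subseteq> carrier G" and x: "x \<in> U" and U: "openin X U"
  obtains V where "clopen V" "x \<in> V" "V \<subseteq> U"
    "\<And>a b. \<lbrakk>a \<in> L; b \<in> L; \<alpha> a x \<noteq> \<alpha> b x\<rbrakk> \<Longrightarrow> \<alpha> a ` V \<inter> \<alpha> b ` V = {}"
proof -
  have xT: "x \<in> topspace X" using x U openin_subset by blast
  have "\<exists>W. openin X W \<and> x \<in> W \<and> (\<alpha> a x \<noteq> \<alpha> b x \<longrightarrow> \<alpha> a ` W \<inter> \<alpha> b ` W = {})" if "a \<in> L" "b \<in> L" for a b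
  proof (cases "\<alpha> a x = \<alpha> b x")
    case False
    have "\<alpha> a x \<in> topspace X" "\<alpha> b x \<in> topspace X" using that L act_in xT by auto
    then obtain A B where AB: "openin X A" "openin X B" "\<alpha> a x \<in> A" "\<alpha> b x \<in> B" "disjnt A B"
      using hausdorff False unfolding Hausdorff_space_def by metis
    define W where "W = {x \<in> topspace X. \<alpha> a x \<in> A} \<inter> {x \<in> topspace X. \<alpha> b x \<in> B}"
    have "openin X W" unfolding W_def using act_preimage_open AB that L by blast
    moreover have "\<alpha> a ` W \<inter> \<alpha> b ` W = {}" using AB(5) by (auto simp: W_def disjnt_iff)
    moreover have "x \<in> W" using AB xT unfolding W_def by blast
    ultimately show ?thesis by blast
  qed (use xT in auto)
  then have "\<forall>p\<in>L \<times> L. \<exists>W. openin X W \<and> x \<in> W \<and>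
      (\<alpha> (fst p) x \<noteq> \<alpha> (snd p) x \<longrightarrow> \<alpha> (fst p) ` W \<inter> \<alpha> (snd p) ` W = {})"
    by auto
  from bchoice[OF this] obtain W where W: "\<forall>p\<in>L \<times> L. openin X (W p) \<and> x \<in> W p \<and>
      (\<alpha> (fst p) x \<noteq> \<alpha> (snd p) x \<longrightarrow> \<alpha> (fst p) ` W p \<inter> \<alpha> (snd p) ` W p = {})"
    by metis
  define V where "V = U \<inter> (\<Inter>p\<in>L \<times> L. W p)"
  have "openin X V"
  proof (cases "L = {}")
    case False
    then have "openin X (\<Inter>p\<in>L \<times> L. W p)" using L W by (intro openin_INT2) auto
    then show ?thesis unfolding V_def using U by blast
  qed (simp add: V_def U)
  moreover have "x \<in> V" using W x unfolding V_def by blast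
  ultimately obtain K where K: "clopen K" "x \<in> K" "K \<subseteq> V" using clopen_nbhd by metis
  have "\<alpha> a ` K \<inter> \<alpha> b ` K = {}" if "a \<in> L" "b \<in> L" "\<alpha> a x \<noteq> \<alpha> b x" for a b
  proof -
    have "K \<subseteq> W (a,b)" using K that unfolding V_def by blast
    moreover have "\<alpha> a ` W (a,b) \<inter> \<alpha> b ` W (a,b) = {}" using W that by auto
    ultimately show ?thesis by blast
  qed
  then show ?thesis using that K unfolding V_def by blast
qed

lemma orbit_avoid:
  assumes "x \<in> topspace X" "finite E"
  obtains g where "g \<in> carrier G" "\<alpha> g x \<notin> E"
proof -
  have "\<not> orbit G \<alpha> x \<subseteq> E" using infinite_orbit[OF assms(1)] assms(2) finite_subset by blast
  then show ?thesis using that unfolding orbit_def by blast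
qed

lemma orbit_labels:
  fixes n :: nat
  assumes "x \<in> topspace X" "finite E"
  shows "\<exists>l. (\<forall>i<n. l i \<in> carrier G \<and> \<alpha> (l i) x \<notin> E) \<and> inj_on (\<lambda>i. \<alpha> (l i) x) {..<n}"
proof (induction n)
  case (Suc n)
  then obtain l where l: "\<forall>i<n. l i \<in> carrier G \<and> \<alpha> (l i) x \<notin> E" "inj_on (\<lambda>i. \<alpha> (l i) x) {..<n}" by blast
  obtain g where g: "g \<in> carrier G" "\<alpha> g x \<notin> E \<union> (\<lambda>i. \<alpha> (l i) x) ` {..<n}"
    using orbit_avoid[of x "E \<union> (\<lambda>i. \<alpha> (l i) x) ` {..<n}"] assms by blast
  show ?case
  proof (intro exI[of _ "l(n := g)"] conjI)
    show "inj_on (\<lambda>i. \<alpha> ((l(n := g)) i) x) {..<Suc n}"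
      using l(2) g(2) unfolding inj_on_def lessThan_Suc
      by (smt (verit) UnI2 fun_upd_apply imageI insert_iff lessThan_iff)
  qed (use l g in \<open>auto simp: less_Suc_eq\<close>)
qed auto

end

section \<open>Local 3-cycles\<close>

text \<open>Groups of permutations are handled as sets of total functions rather than as monoid
  records, since the finite generation argument quantifies over an arbitrary such group containing a
  given finite set.\<close>

definition function_group :: "('x \<Rightarrow> 'x) set \<Rightarrow> bool" where
  "function_group \<Gamma> \<longleftrightarrow> id \<in> \<Gamma> \<and> (\<forall>f\<in>\<Gamma>. \<forall>g\<in>\<Gamma>. f \<circ> g \<in> \<Gamma>) \<and>
     (\<forall>f\<in>\<Gamma>. \<exists>h\<in>\<Gamma>. f \<circ> h = id \<and> h \<circ> f = id)"

lemma function_group_id: "function_group \<Gamma> \<Longrightarrow> id \<in> \<Gamma>"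
  and function_group_comp: "function_group \<Gamma> \<Longrightarrow> f \<in> \<Gamma> \<Longrightarrow> g \<in> \<Gamma> \<Longrightarrow> f \<circ> g \<in> \<Gamma>"
  by (auto simp: function_group_def)

lemma function_group_inverse:
  assumes "function_group \<Gamma>" "f \<in> \<Gamma>"
  obtains h where "h \<in> \<Gamma>" "\<And>x. f (h x) = x" "\<And>x. h (f x) = x"
  using assms unfolding function_group_def by (metis comp_apply id_apply)

lemma function_group_inj: "function_group \<Gamma> \<Longrightarrow> f \<in> \<Gamma> \<Longrightarrow> inj f"
  by (metis function_group_inverse injI)

lemma function_group_cancel_left:
  assumes "function_group \<Gamma>" "f \<in> \<Gamma>" "f \<circ> g \<in> \<Gamma>" shows "g \<in> \<Gamma>"
proof -
  obtain h where "h \<in> \<Gamma>" "\<And>x. h (f x) = x" using function_group_inverse assms(1,2) by metis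
  then have "h \<circ> (f \<circ> g) = g" "h \<circ> (f \<circ> g) \<in> \<Gamma>" using function_group_comp assms by auto
  then show ?thesis by simp
qed

lemma function_group_cancel_right:
  assumes "function_group \<Gamma>" "f \<in> \<Gamma>" "g \<circ> f \<in> \<Gamma>" shows "g \<in> \<Gamma>"
proof -
  obtain h where "h \<in> \<Gamma>" "\<And>x. f (h x) = x" using function_group_inverse assms(1,2) by metis
  then have "(g \<circ> f) \<circ> h = g" "(g \<circ> f) \<circ> h \<in> \<Gamma>" using function_group_comp assms by auto
  then show ?thesis by simp
qed

text \<open>By injectivity the only preimage of \<open>f' u\<close> under \<open>\<delta>\<close> is
  \<open>f u\<close>. This shows that a conjugated cycle has no support beyond the moved
  translates.\<close>

lemma notin_image_transport:
  assumes "inj \<delta>" "\<And>u. u \<in> W \<Longrightarrow> \<delta> (f u) = f' u" "x \<notin> f ` W"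
  shows "\<delta> x \<notin> f' ` W"
proof
  assume "\<delta> x \<in> f' ` W"
  then obtain u where "u \<in> W" "\<delta> x = f' u" by blast
  then have "\<delta> x = \<delta> (f u)" using assms(2) by simp
  then have "x = f u" using assms(1) by (simp add: inj_eq)
  then show False using assms(3) \<open>u \<in> W\<close> by blast
qed

context cantor_action
begin

definition disj3 :: "'x set \<Rightarrow> 'g \<Rightarrow> 'g \<Rightarrow> 'g \<Rightarrow> bool" where
  "disj3 V a b c \<longleftrightarrow> clopen V \<and> {a, b, c} \<subseteq> carrier G \<and>
     \<alpha> a ` V \<inter> \<alpha> b ` V = {} \<and> \<alpha> b ` V \<inter> \<alpha> c ` V = {} \<and> \<alpha> c ` V \<inter> \<alpha> a ` V = {}"

text \<open>One base set and three labels describe the cycle \<open>\<alpha> a v\<close>,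
  \<open>\<alpha> b v\<close>, \<open>\<alpha> c v\<close> simultaneously for all \<open>v\<close>
  in \<open>V\<close>. Restricting it means shrinking \<open>V\<close>, relabelling it means
  changing \<open>a\<close>, \<open>b\<close>, \<open>c\<close>; the two stages of the argument vary
  these independently.\<close>

definition rot :: "'x set \<Rightarrow> 'g \<Rightarrow> 'g \<Rightarrow> 'g \<Rightarrow> 'x \<Rightarrow> 'x" where
  "rot V a b c x =
     (if x \<in> \<alpha> a ` V then \<alpha> (b \<otimes> inv a) x
      else if x \<in> \<alpha> b ` V then \<alpha> (c \<otimes> inv b) x
      else if x \<in> \<alpha> c ` V then \<alpha> (a \<otimes> inv c) x else x)"

lemma act_quotient: "\<lbrakk>a \<in> carrier G; b \<in> carrier G; v \<in> topspace X\<rbrakk> \<Longrightarrow> \<alpha> (b \<otimes> inv a) (\<alpha> a v) = \<alpha> b v"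
  by (simp add: act_mult act_in act_inv)

lemma disj3_rotate: "disj3 V a b c \<Longrightarrow> disj3 V b c a"
  and disj3_swap: "disj3 V a b c \<Longrightarrow> disj3 V a c b"
  unfolding disj3_def by auto

lemma disj3_subset:
  assumes "disj3 V a b c" "clopen W" "W \<subseteq> V"
  shows "disj3 W a b c"
proof -
  have "\<alpha> g ` W \<inter> \<alpha> h ` W = {}" if "\<alpha> g ` V \<inter> \<alpha> h ` V = {}" for g h
    using that image_mono[OF assms(3), of "\<alpha> g"] image_mono[OF assms(3), of "\<alpha> h"] by blast
  then show ?thesis using assms unfolding disj3_def by simp
qed

lemma disj3_notin:
  assumes "disj3 V a b c" "u \<in> V" "S \<subseteq> V"
  shows "\<alpha> a u \<notin> \<alpha> b ` S" "\<alpha> b u \<notin> \<alpha> c ` S" "\<alpha> c u \<notin> \<alpha> a ` S"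
    "\<alpha> b u \<notin> \<alpha> a ` S" "\<alpha> c u \<notin> \<alpha> b ` S" "\<alpha> a u \<notin> \<alpha> c ` S"
  using assms unfolding disj3_def disjoint_iff by (metis image_eqI image_mono subsetD)+

lemma rot_apply:
  assumes "disj3 V a b c" "v \<in> V"
  shows "rot V a b c (\<alpha> a v) = \<alpha> b v" "rot V a b c (\<alpha> b v) = \<alpha> c v" "rot V a b c (\<alpha> c v) = \<alpha> a v"
proof -
  have G: "a \<in> carrier G" "b \<in> carrier G" "c \<in> carrier G" "v \<in> topspace X"
    using assms clopen_subset unfolding disj3_def by auto
  have n: "\<alpha> b v \<notin> \<alpha> a ` V" "\<alpha> c v \<notin> \<alpha> a ` V" "\<alpha> c v \<notin> \<alpha> b ` V"
    using disj3_notin[OF assms order_refl] by auto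
  show "rot V a b c (\<alpha> a v) = \<alpha> b v" "rot V a b c (\<alpha> b v) = \<alpha> c v" "rot V a b c (\<alpha> c v) = \<alpha> a v"
    using assms(2) n by (auto simp: rot_def act_quotient G)
qed

lemma rot_outside: "x \<notin> \<alpha> a ` V \<Longrightarrow> x \<notin> \<alpha> b ` V \<Longrightarrow> x \<notin> \<alpha> c ` V \<Longrightarrow> rot V a b c x = x"
  by (simp add: rot_def)

lemma rot_empty [simp]: "rot {} a b c = id"
  by (auto simp: rot_def)

lemma translate_cases:
  obtains v where "v \<in> V" "x = \<alpha> a v" | v where "v \<in> V" "x = \<alpha> b v" | v where "v \<in> V" "x = \<alpha> c v"
  | "x \<notin> \<alpha> a ` V" "x \<notin> \<alpha> b ` V" "x \<notin> \<alpha> c ` V"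
  by (metis imageE)

lemma rot_rotate:
  assumes "disj3 V a b c" shows "rot V b c a = rot V a b c"
proof
  fix x show "rot V b c a x = rot V a b c x"
    by (rule translate_cases[where V=V and x=x and a=a and b=b and c=c])
      (use assms disj3_rotate rot_apply rot_outside in metis)+
qed

lemma rot_swap:
  assumes "disj3 V a b c" shows "rot V a c b \<circ> rot V a b c = id"
proof
  fix x show "(rot V a c b \<circ> rot V a b c) x = id x"
    by (rule translate_cases[where V=V and x=x and a=a and b=b and c=c])
      (simp_all add: rot_apply[OF assms] rot_apply[OF disj3_swap[OF assms]] rot_outside)
qed

lemma rot_swap_mem:
  assumes "function_group \<Gamma>" "disj3 V a b c" "rot V a b c \<in> \<Gamma>" shows "rot V a c b \<in> \<Gamma>"
  using function_group_cancel_right[OF assms(1,3)] rot_swap[OF assms(2)] function_group_id[OF assms(1)] by simp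

lemma rot_rotate_mem:
  assumes "disj3 V a b c" "rot V a b c \<in> \<Gamma>" shows "rot V b c a \<in> \<Gamma>"
  using rot_rotate assms by simp

lemma disj3_label_image_Int:
  assumes "g \<in> carrier G" "U \<subseteq> topspace X" "V \<subseteq> topspace X" "U \<inter> V = {}" "u \<in> U" 
  shows "\<alpha> g u \<notin> \<alpha> g ` V"
  using assms act_image_mem[of g V u] by auto

text \<open>Disjoint bases have disjoint translates under one label, and \<open>disj3\<close>
  separates different labels; hence each factor fixes the support of the other.\<close>

lemma rot_Un:
  assumes "disj3 (V \<union> W) a b c" "clopen V" "clopen W" "V \<inter> W = {}"
  shows "rot (V \<union> W) a b c = rot V a b c \<circ> rot W a b c"
proof
  have V: "disj3 V a b c" and W: "disj3 W a b c" using assms disj3_subset by blast+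
  have G: "a \<in> carrier G" "b \<in> carrier G" "c \<in> carrier G" using V unfolding disj3_def by auto
  have T: "V \<subseteq> topspace X" "W \<subseteq> topspace X" using assms clopen_subset by auto
  have out: "rot S a b c (\<alpha> a x) = \<alpha> a x" "rot S a b c (\<alpha> b x) = \<alpha> b x" "rot S a b c (\<alpha> c x) = \<alpha> c x"
    if "x \<in> R" "R = V \<and> S = W \<or> R = W \<and> S = V" for x R S
  proof -
    have *: "x \<in> V \<union> W" "S \<subseteq> V \<union> W" "\<And>g. g \<in> carrier G \<Longrightarrow> \<alpha> g x \<notin> \<alpha> g ` S"
      using that disj3_label_image_Int T assms(4) by blast+
    show "rot S a b c (\<alpha> a x) = \<alpha> a x" "rot S a b c (\<alpha> b x) = \<alpha> b x" "rot S a b c (\<alpha> c x) = \<alpha> c x"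
      using * G disj3_notin[OF assms(1) *(1,2)] by (simp_all add: rot_outside)
  qed
  fix x show "rot (V \<union> W) a b c x = (rot V a b c \<circ> rot W a b c) x"
    by (rule translate_cases[where V="V \<union> W" and x=x and a=a and b=b and c=c])
      (auto simp: rot_apply[OF assms(1)] rot_apply[OF V] rot_apply[OF W] out rot_outside image_Un)
qed

text \<open>An identity among permutations of the four letters \<open>a\<close>, \<open>b\<close>,
  \<open>c\<close>, \<open>p\<close>, checked letter by letter: the spare letter \<open>p\<close>
  cancels. It finishes the commutator computation in \<open>rot_Int\<close>.\<close>

lemma rot_mult:
  assumes "disj3 V a b c" "disj3 V a b p" "disj3 V c b p"
  shows "rot V c b p \<circ> rot V a p b = rot V a c b"
proof
  have 1: "disj3 V a p b" "disj3 V a c b" using assms disj3_swap by auto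
  note r = rot_apply[OF assms(3)] rot_apply[OF 1(1)] rot_apply[OF 1(2)]
  have c: "rot V a p b (\<alpha> c v) = \<alpha> c v" if "v \<in> V" for v
    using disj3_notin[OF assms(1) that order_refl] disj3_notin[OF assms(3) that order_refl] by (simp add: rot_outside)
  have a: "rot V c b p (\<alpha> a v) = \<alpha> a v" if "v \<in> V" for v
    using disj3_notin[OF assms(1) that order_refl] disj3_notin[OF assms(2) that order_refl] by (simp add: rot_outside)
  have p: "rot V a c b (\<alpha> p v) = \<alpha> p v" if "v \<in> V" for v
    using disj3_notin[OF assms(2) that order_refl] disj3_notin[OF assms(3) that order_refl] by (simp add: rot_outside)
  fix x show "(rot V c b p \<circ> rot V a p b) x = rot V a c b x"
  proof (cases "x \<in> \<alpha> p ` V")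
    case True then show ?thesis by (auto simp: r c a p)
  next
    case False
    show ?thesis
      by (rule translate_cases[where V=V and x=x and a=a and b=b and c=c]) (use False in \<open>simp_all add: r c a p rot_outside\<close>)
  qed
qed

text \<open>Right multiplication of all labels by \<open>g\<close> leaves quotients such as
  \<open>b \<otimes> inv a\<close> unchanged, so translating the base and translating the labels
  describe the same map. This trades base points for labels in both stages.\<close>

lemma rot_shift:
  assumes "g \<in> carrier G" "a \<in> carrier G" "b \<in> carrier G" "c \<in> carrier G" "V \<subseteq> topspace X"
  shows "rot (\<alpha> g ` V) a b c = rot V (a \<otimes> g) (b \<otimes> g) (c \<otimes> g)"
proof -
  have "b \<otimes> g \<otimes> inv (a \<otimes> g) = b \<otimes> inv a" if "a \<in> carrier G" "b \<in> carrier G" for a b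
  proof -
    have "b \<otimes> g \<otimes> inv (a \<otimes> g) = b \<otimes> (g \<otimes> inv g) \<otimes> inv a"
      using that assms(1) by (simp only: inv_mult_group m_assoc m_closed inv_closed)
    then show ?thesis using that assms(1) by simp
  qed
  then show ?thesis unfolding rot_def using assms by (simp add: act_image_mult cong: if_cong)
qed

lemma disj3_shift:
  assumes "g \<in> carrier G" "a \<in> carrier G" "b \<in> carrier G" "c \<in> carrier G" "clopen V"
  shows "disj3 (\<alpha> g ` V) a b c \<longleftrightarrow> disj3 V (a \<otimes> g) (b \<otimes> g) (c \<otimes> g)"
  unfolding disj3_def using assms act_image_mult clopen_subset act_image_clopen by simp

text \<open>The conjugator only has to move the three translates of \<open>W\<close> as prescribed;
  injectivity keeps the other points away from the new translates, wherever they go. Hence one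
  \<open>\<delta>\<close> serves all base sets inside a given neighbourhood.\<close>

lemma rot_conj:
  assumes \<Gamma>: "function_group \<Gamma>" "\<delta> \<in> \<Gamma>" "rot W a b c \<in> \<Gamma>"
    and W: "disj3 W a b c" "disj3 W a' b' c'"
    and \<delta>: "\<And>u. u \<in> W \<Longrightarrow> \<delta> (\<alpha> a u) = \<alpha> a' u \<and> \<delta> (\<alpha> b u) = \<alpha> b' u \<and> \<delta> (\<alpha> c u) = \<alpha> c' u"
  shows "rot W a' b' c' \<in> \<Gamma>"
proof -
  have inj: "inj \<delta>" by (rule function_group_inj[OF \<Gamma>(1,2)])
  have "rot W a' b' c' \<circ> \<delta> = \<delta> \<circ> rot W a b c"
  proof
    fix x show "(rot W a' b' c' \<circ> \<delta>) x = (\<delta> \<circ> rot W a b c) x"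
    proof (rule translate_cases[where V=W and x=x and a=a and b=b and c=c])
      assume *: "x \<notin> \<alpha> a ` W" "x \<notin> \<alpha> b ` W" "x \<notin> \<alpha> c ` W"
      then have "\<delta> x \<notin> \<alpha> a' ` W" "\<delta> x \<notin> \<alpha> b' ` W" "\<delta> x \<notin> \<alpha> c' ` W"
        using notin_image_transport[OF inj, where f="\<alpha> a" and f'="\<alpha> a'" and W=W]
          notin_image_transport[OF inj, where f="\<alpha> b" and f'="\<alpha> b'" and W=W]
          notin_image_transport[OF inj, where f="\<alpha> c" and f'="\<alpha> c'" and W=W] \<delta> by auto
      then show ?thesis using * by (simp add: rot_outside)
    qed (simp_all add: rot_apply[OF W(1)] rot_apply[OF W(2)] \<delta>)
  qed
  moreover have "\<delta> \<circ> rot W a b c \<in> \<Gamma>" by (rule function_group_comp[OF \<Gamma>(1) \<Gamma>(2) \<Gamma>(3)])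
  ultimately show ?thesis using function_group_cancel_right[OF \<Gamma>(1,2)] by simp
qed

text \<open>Two 3-cycles that share exactly one letter have a 3-cycle as commutator. Here
  \<open>x\<close> over \<open>W\<close> and \<open>y\<close> over \<open>W'\<close> share the
  letter \<open>a\<close>: over \<open>W \<inter> W'\<close> conjugation by \<open>y\<close> turns
  \<open>x\<close> into the cycle on \<open>c\<close>, \<open>b\<close>, \<open>p\<close>, while
  over \<open>W - W'\<close> it leaves \<open>x\<close> alone, so the commutator lives over the
  intersection only. The five \<open>disj3\<close> hypotheses say that all five translates are
  pairwise disjoint.\<close>

lemma rot_Int:
  assumes \<Gamma>: "function_group \<Gamma>"
    and P: "disj3 P a b c" "disj3 P a p q" "disj3 P b c p" "disj3 P b p q" "disj3 P c p q"
    and W: "clopen W" "W \<subseteq> P" "clopen W'" "W' \<subseteq> P"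
    and mem: "rot W a b p \<in> \<Gamma>" "rot W' a c q \<in> \<Gamma>"
  shows "rot (W \<inter> W') a c b \<in> \<Gamma>"
proof -
  define V R where "V = W \<inter> W'" and "R = W - W'"
  have VR: "clopen V" "clopen R" "V \<inter> R = {}" "V \<union> R = W" "V \<subseteq> P" "R \<subseteq> P" "V \<subseteq> W'"
    using W clopen_Int clopen_Diff unfolding V_def R_def by auto
  have P': "disj3 P a b p" "disj3 P a c q" "disj3 P c b p"
    using P unfolding disj3_def by (auto simp: Int_commute)
  let ?x = "rot W a b p" and ?y = "rot W' a c q"
  have x: "?x = rot V a b p \<circ> rot R a b p"
    using rot_Un[of V R a b p] VR disj3_subset[OF P'(1)] W by auto
  have d: "disj3 W' a c q" "disj3 R a b p" "disj3 V a b p" "disj3 V c b p" "disj3 V a b c" "disj3 W a b p"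
    using disj3_subset P P' VR W by metis+
  have G: "a \<in> carrier G" using P unfolding disj3_def by auto
  have T: "P \<subseteq> topspace X" using P clopen_subset unfolding disj3_def by auto
  have yb: "?y (\<alpha> b u) = \<alpha> b u" if "u \<in> P" for u
    using disj3_notin[OF P(1) that W(4)] disj3_notin[OF P(4) that W(4)] by (simp add: rot_outside)
  have yp: "?y (\<alpha> p u) = \<alpha> p u" if "u \<in> P" for u
    using disj3_notin[OF P(2) that W(4)] disj3_notin[OF P(3) that W(4)] disj3_notin[OF P(4) that W(4)]
    by (simp add: rot_outside)
  have yaR: "?y (\<alpha> a u) = \<alpha> a u" if "u \<in> R" for u
  proof (rule rot_outside)
    have "W' \<inter> R = {}" by (auto simp: R_def)
    then show "\<alpha> a u \<notin> \<alpha> a ` W'" using disj3_label_image_Int[of a R W' u] G T VR W that by (metis Int_commute subset_trans)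
    have u: "u \<in> P" using that VR by auto
    show "\<alpha> a u \<notin> \<alpha> c ` W'" "\<alpha> a u \<notin> \<alpha> q ` W'"
      using disj3_notin[OF P'(2) u W(4)] by auto
  qed
  have ya: "?y (\<alpha> a u) = \<alpha> c u" if "u \<in> V" for u
    using rot_apply[OF d(1)] that VR by auto
  have inj: "inj ?y" by (rule function_group_inj[OF \<Gamma> mem(2)])
  note yV = yb[OF subsetD[OF VR(5)]] yp[OF subsetD[OF VR(5)]]
    and yR = yb[OF subsetD[OF VR(6)]] yp[OF subsetD[OF VR(6)]]
  have out: "rot V c b p (?y s) = ?y s" if "s \<notin> \<alpha> a ` V" "s \<notin> \<alpha> b ` V" "s \<notin> \<alpha> p ` V" for s
    using that ya yV notin_image_transport[OF inj, where f="\<alpha> a" and f'="\<alpha> c" and W=V]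
      notin_image_transport[OF inj, where f="\<alpha> b" and f'="\<alpha> b" and W=V]
      notin_image_transport[OF inj, where f="\<alpha> p" and f'="\<alpha> p" and W=V]
    by (intro rot_outside) auto
  have out': "rot R a b p (?y s) = ?y s" if "s \<notin> \<alpha> a ` R" "s \<notin> \<alpha> b ` R" "s \<notin> \<alpha> p ` R" for s
    using that yaR yR notin_image_transport[OF inj, where f="\<alpha> a" and f'="\<alpha> a" and W=R]
      notin_image_transport[OF inj, where f="\<alpha> b" and f'="\<alpha> b" and W=R]
      notin_image_transport[OF inj, where f="\<alpha> p" and f'="\<alpha> p" and W=R]
    by (intro rot_outside) auto
  have conjV: "rot V c b p \<circ> ?y = ?y \<circ> rot V a b p"
  proof
    fix s show "(rot V c b p \<circ> ?y) s = (?y \<circ> rot V a b p) s"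
      by (rule translate_cases[where V=V and x=s and a=a and b=b and c=p])
        (simp_all add: rot_apply[OF d(3)] rot_apply[OF d(4)] ya yV rot_outside out)
  qed
  have conjR: "rot R a b p \<circ> ?y = ?y \<circ> rot R a b p"
  proof
    fix s show "(rot R a b p \<circ> ?y) s = (?y \<circ> rot R a b p) s"
      by (rule translate_cases[where V=R and x=s and a=a and b=b and c=p])
        (simp_all add: rot_apply[OF d(2)] yaR yR rot_outside out')
  qed
  \<comment> \<open>The products \<open>?y \<circ> ?x\<close> and \<open>?x \<circ> ?y\<close> are
    compared: the part of \<open>?x\<close> over \<open>R\<close> cancels, and the two cycles left
    over \<open>V\<close> are multiplied by \<open>rot_mult\<close>.\<close>
  have "?y \<circ> ?x = rot V c b p \<circ> rot R a b p \<circ> ?y"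
    unfolding x using conjV conjR by (metis comp_assoc)
  also have "\<dots> = (rot V c b p \<circ> rot V a p b) \<circ> (?x \<circ> ?y)"
  proof -
    have "rot V a p b \<circ> rot V a b p = id" using rot_swap d(3) by blast
    then have "rot V a p b \<circ> ?x = rot R a b p" unfolding x by (metis comp_assoc id_comp)
    then show ?thesis by (metis comp_assoc)
  qed
  also have "rot V c b p \<circ> rot V a p b = rot V a c b" using rot_mult d by blast
  finally have e: "?y \<circ> ?x = rot V a c b \<circ> (?x \<circ> ?y)" .
  have "?y \<circ> ?x \<in> \<Gamma>" by (rule function_group_comp[OF \<Gamma> mem(2,1)])
  then have "rot V a c b \<circ> (?x \<circ> ?y) \<in> \<Gamma>" by (simp only: e)
  then show ?thesis unfolding V_def[symmetric]
    using function_group_cancel_right[OF \<Gamma>] mem function_group_comp[OF \<Gamma>] by blast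
qed

text \<open>Iterates \<open>rot_Un\<close>; the bound \<open>Z\<close> keeps every union inside one
  set with disjoint translates.\<close>

lemma rot_Union_mem:
  assumes \<Gamma>: "function_group \<Gamma>" and Z: "disj3 Z a b c"
    and \<K>: "finite \<K>" "pairwise disjnt \<K>" "\<And>K. K \<in> \<K> \<Longrightarrow> clopen K \<and> rot (K \<inter> Z) a b c \<in> \<Gamma>"
  shows "rot (\<Union>\<K> \<inter> Z) a b c \<in> \<Gamma>"
proof -
  have "clopen (\<Union>\<K>) \<and> rot (\<Union>\<K> \<inter> Z) a b c \<in> \<Gamma>"
    using \<K>
  proof (induction rule: finite_induct)
    case (insert K \<K>)
    have IH: "clopen (\<Union>\<K>)" "rot (\<Union>\<K> \<inter> Z) a b c \<in> \<Gamma>" using insert by (auto simp: pairwise_insert)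
    have K: "clopen K" "rot (K \<inter> Z) a b c \<in> \<Gamma>" using insert by auto
    have Zc: "clopen Z" using Z unfolding disj3_def by auto
    have dj: "(K \<inter> Z) \<inter> (\<Union>\<K> \<inter> Z) = {}" using insert.prems(1) insert.hyps
      by (force simp: pairwise_insert disjnt_iff)
    have "disj3 ((K \<inter> Z) \<union> (\<Union>\<K> \<inter> Z)) a b c"
      by (rule disj3_subset[OF Z]) (use clopen_Int clopen_Un K IH Zc in auto)
    then have "rot ((K \<inter> Z) \<union> (\<Union>\<K> \<inter> Z)) a b c = rot (K \<inter> Z) a b c \<circ> rot (\<Union>\<K> \<inter> Z) a b c"
      by (rule rot_Un) (use clopen_Int K IH Zc dj in auto)
    moreover have "(K \<inter> Z) \<union> (\<Union>\<K> \<inter> Z) = \<Union>(insert K \<K>) \<inter> Z" by auto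
    ultimately have "rot (\<Union>(insert K \<K>) \<inter> Z) a b c \<in> \<Gamma>"
      using K IH function_group_comp[OF \<Gamma>] by metis
    then show ?case using K IH clopen_Un by simp
  qed (use function_group_id[OF \<Gamma>] in auto)
  then show ?thesis by blast
qed

section \<open>Bootstrapping from expansivity\<close>

text \<open>The labels are moved one at a time, \<open>a m\<close> to \<open>b m\<close> by the
  3-cycle on \<open>a m\<close>, \<open>b m\<close> and a fresh label \<open>f\<close>. The
  auxiliary letter keeps everything within 3-cycles, so no parity condition on the rearrangement
  arises. Since sources and targets have different images at \<open>x\<close>, each cycle fixes the
  labels already moved and those still waiting.\<close>

lemma transport_disjoint:
  fixes n :: nat
  assumes \<A>: "function_group \<A>" "\<And>V a b c. disj3 V a b c \<Longrightarrow> rot V a b c \<in> \<A>"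
    and x: "x \<in> topspace X"
    and G: "\<And>i. i < n \<Longrightarrow> a i \<in> carrier G \<and> b i \<in> carrier G"
    and inj: "inj_on (\<lambda>i. \<alpha> (a i) x) {..<n}" "inj_on (\<lambda>i. \<alpha> (b i) x) {..<n}"
    and dj: "\<And>i j. i < n \<Longrightarrow> j < n \<Longrightarrow> \<alpha> (a i) x \<noteq> \<alpha> (b j) x"
  shows "\<exists>\<delta>\<in>\<A>. \<exists>U. openin X U \<and> x \<in> U \<and> (\<forall>u\<in>U. \<forall>i<n. \<delta> (\<alpha> (a i) u) = \<alpha> (b i) u)"
proof -
  have "\<exists>\<delta>\<in>\<A>. \<exists>U. openin X U \<and> x \<in> U \<and>
      (\<forall>u\<in>U. \<forall>i<n. \<delta> (\<alpha> (a i) u) = \<alpha> ((if i < m then b else a) i) u)" if "m \<le> n" for m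
    using that
  proof (induction m)
    case 0
    show ?case using function_group_id[OF \<A>(1)] x by (intro bexI[of _ id] exI[of _ "topspace X"]) auto
  next
    case (Suc m)
    then obtain \<delta> U where \<delta>: "\<delta> \<in> \<A>" "openin X U" "x \<in> U"
      "\<And>u i. u \<in> U \<Longrightarrow> i < n \<Longrightarrow> \<delta> (\<alpha> (a i) u) = \<alpha> ((if i < m then b else a) i) u"
      by (metis Suc_leD)
    have m: "m < n" using Suc.prems by simp
    let ?E = "(\<lambda>i. \<alpha> (a i) x) ` {..<n} \<union> (\<lambda>i. \<alpha> (b i) x) ` {..<n}"
    obtain f where f: "f \<in> carrier G" "\<alpha> f x \<notin> ?E" using orbit_avoid[OF x, of ?E] by blast
    then have fne: "\<alpha> f x \<noteq> \<alpha> (a i) x" "\<alpha> f x \<noteq> \<alpha> (b i) x" if "i < n" for i using that by auto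
    let ?L = "insert f (a ` {..<n} \<union> b ` {..<n})"
    obtain V where V: "clopen V" "x \<in> V" "V \<subseteq> U"
      "\<And>g h. \<lbrakk>g \<in> ?L; h \<in> ?L; \<alpha> g x \<noteq> \<alpha> h x\<rbrakk> \<Longrightarrow> \<alpha> g ` V \<inter> \<alpha> h ` V = {}"
    proof (rule separating_nbhd[of ?L x U])
      show "?L \<subseteq> carrier G" using f G by auto
    qed (use \<delta> in auto)
    have ne: "\<alpha> (a m) x \<noteq> \<alpha> (b m) x" "\<alpha> (b m) x \<noteq> \<alpha> f x" "\<alpha> f x \<noteq> \<alpha> (a m) x"
      using fne dj m by force+
    have d: "disj3 V (a m) (b m) f"
      unfolding disj3_def using V f G m ne by auto
    let ?\<rho> = "rot V (a m) (b m) f"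
    have fix1: "?\<rho> (\<alpha> g u) = \<alpha> g u"
      if "u \<in> V" "g \<in> ?L" "\<alpha> g x \<noteq> \<alpha> (a m) x" "\<alpha> g x \<noteq> \<alpha> (b m) x" "\<alpha> g x \<noteq> \<alpha> f x" for g u
    proof -
      have "\<alpha> g ` V \<inter> \<alpha> (a m) ` V = {}" "\<alpha> g ` V \<inter> \<alpha> (b m) ` V = {}" "\<alpha> g ` V \<inter> \<alpha> f ` V = {}"
        using V(4) that m by auto
      then show ?thesis using that(1) by (intro rot_outside) blast+
    qed
    have "(?\<rho> \<circ> \<delta>) (\<alpha> (a i) u) = \<alpha> ((if i < Suc m then b else a) i) u" if "u \<in> V" "i < n" for u i
    proof -
      consider "i < m" | "i = m" | "m < i" by linarith
      then show ?thesis
      proof cases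
        case 1
        have "\<alpha> (b i) x \<noteq> \<alpha> (a m) x" "\<alpha> (b i) x \<noteq> \<alpha> (b m) x" "\<alpha> (b i) x \<noteq> \<alpha> f x"
          using 1 that dj[of m i] m fne[of i] inj(2) by (force simp: inj_on_def)+
        then have "?\<rho> (\<alpha> (b i) u) = \<alpha> (b i) u" using that by (intro fix1) auto
        then show ?thesis using 1 \<delta>(4) that V(3) by auto
      next
        case 2
        then show ?thesis using \<delta>(4)[of u i] that V(3) rot_apply(1)[OF d that(1)] by auto
      next
        case 3
        have "\<alpha> (a i) x \<noteq> \<alpha> (a m) x" "\<alpha> (a i) x \<noteq> \<alpha> (b m) x" "\<alpha> (a i) x \<noteq> \<alpha> f x"
          using 3 that dj[of i m] m fne[of i] inj(1) by (force simp: inj_on_def)+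
        then have "?\<rho> (\<alpha> (a i) u) = \<alpha> (a i) u" using that by (intro fix1) auto
        then show ?thesis using 3 \<delta>(4) that V(3) by auto
      qed
    qed
    moreover have "?\<rho> \<circ> \<delta> \<in> \<A>" by (rule function_group_comp[OF \<A>(1) \<A>(2)[OF d] \<delta>(1)])
    ultimately show ?case using V(1,2) clopen_open by (intro bexI[of _ "?\<rho> \<circ> \<delta>"] exI[of _ V]) auto
  qed
  from this[of n] show ?thesis by simp
qed

text \<open>Sources and targets may overlap here, so both are sent to a third family
  \<open>e\<close> of fresh labels; the transporter is the first map followed by the inverse of the
  second.\<close>

lemma transport_exists:
  fixes n :: nat
  assumes \<A>: "function_group \<A>" "\<And>V a b c. disj3 V a b c \<Longrightarrow> rot V a b c \<in> \<A>"
    and x: "x \<in> topspace X"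
    and G: "\<And>i. i < n \<Longrightarrow> a i \<in> carrier G" "\<And>i. i < n \<Longrightarrow> b i \<in> carrier G"
    and inj: "inj_on (\<lambda>i. \<alpha> (a i) x) {..<n}" "inj_on (\<lambda>i. \<alpha> (b i) x) {..<n}"
  obtains \<delta> U where "\<delta> \<in> \<A>" "openin X U" "x \<in> U" "\<And>u i. u \<in> U \<Longrightarrow> i < n \<Longrightarrow> \<delta> (\<alpha> (a i) u) = \<alpha> (b i) u"
proof -
  let ?E = "(\<lambda>i. \<alpha> (a i) x) ` {..<n} \<union> (\<lambda>i. \<alpha> (b i) x) ` {..<n}"
  obtain e where e: "\<forall>i<n. e i \<in> carrier G \<and> \<alpha> (e i) x \<notin> ?E" "inj_on (\<lambda>i. \<alpha> (e i) x) {..<n}"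
    using orbit_labels[OF x, of ?E n] by blast
  have "\<exists>\<delta>\<in>\<A>. \<exists>U. openin X U \<and> x \<in> U \<and> (\<forall>u\<in>U. \<forall>i<n. \<delta> (\<alpha> (a i) u) = \<alpha> (e i) u)"
    by (rule transport_disjoint[OF \<A> x _ inj(1) e(2)]) (use G e in force)+
  then obtain \<delta>1 U1 where 1: "\<delta>1 \<in> \<A>" "openin X U1" "x \<in> U1"
    "\<And>u i. u \<in> U1 \<Longrightarrow> i < n \<Longrightarrow> \<delta>1 (\<alpha> (a i) u) = \<alpha> (e i) u" by metis
  have "\<exists>\<delta>\<in>\<A>. \<exists>U. openin X U \<and> x \<in> U \<and> (\<forall>u\<in>U. \<forall>i<n. \<delta> (\<alpha> (b i) u) = \<alpha> (e i) u)"
    by (rule transport_disjoint[OF \<A> x _ inj(2) e(2)]) (use G e in force)+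
  then obtain \<delta>2 U2 where 2: "\<delta>2 \<in> \<A>" "openin X U2" "x \<in> U2"
    "\<And>u i. u \<in> U2 \<Longrightarrow> i < n \<Longrightarrow> \<delta>2 (\<alpha> (b i) u) = \<alpha> (e i) u" by metis
  obtain h where h: "h \<in> \<A>" "\<And>y. h (\<delta>2 y) = y" using function_group_inverse[OF \<A>(1) 2(1)] by metis
  show ?thesis
  proof (rule that[of "h \<circ> \<delta>1" "U1 \<inter> U2"])
    show "h \<circ> \<delta>1 \<in> \<A>" by (rule function_group_comp[OF \<A>(1) h(1) 1(1)])
    fix u i assume "u \<in> U1 \<inter> U2" "i < n"
    then have "\<delta>1 (\<alpha> (a i) u) = \<delta>2 (\<alpha> (b i) u)" using 1(4) 2(4) by simp
    then show "(h \<circ> \<delta>1) (\<alpha> (a i) u) = \<alpha> (b i) u" using h(2) by simp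
  qed (use 1 2 in auto)
qed

section \<open>Label systems and the Boolean algebra of controlled sets\<close>

definition label_system :: "'x set set \<Rightarrow> ('x set \<Rightarrow> nat \<Rightarrow> 'g) \<Rightarrow> nat \<Rightarrow> bool" where
  "label_system \<P> l n \<longleftrightarrow> finite \<P> \<and> \<Union>\<P> = topspace X \<and> pairwise disjnt \<P> \<and>
     (\<forall>P\<in>\<P>. clopen P \<and> (\<forall>i<n. l P i \<in> carrier G) \<and>
        (\<forall>i<n. \<forall>j<n. i \<noteq> j \<longrightarrow> \<alpha> (l P i) ` P \<inter> \<alpha> (l P j) ` P = {}))"

text \<open>The sets \<open>W\<close> for which \<open>\<Gamma>\<close> contains all 3-cycles over the pieces of \<open>W\<close> form a Boolean
  algebra; once it is translation invariant and separates points, it contains every clopen set.\<close>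

definition controlled :: "('x \<Rightarrow> 'x) set \<Rightarrow> 'x set set \<Rightarrow> ('x set \<Rightarrow> nat \<Rightarrow> 'g) \<Rightarrow> nat \<Rightarrow> 'x set set" where
  "controlled \<Gamma> \<P> l n = {W. clopen W \<and> (\<forall>P\<in>\<P>. \<forall>i<n. \<forall>j<n. \<forall>k<n.
     i \<noteq> j \<longrightarrow> j \<noteq> k \<longrightarrow> i \<noteq> k \<longrightarrow> rot (W \<inter> P) (l P i) (l P j) (l P k) \<in> \<Gamma>)}"

text \<open>Infinite orbits give \<open>n\<close> labels with distinct images at each point, their
  translates stay disjoint on a neighbourhood, and compactness leaves finitely many pieces, each
  with its own labels. Over one piece the translates form a multisection of degree \<open>n\<close>,
  on which the cycles \<open>rot\<close> generate an alternating group of degree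
  \<open>n\<close>.\<close>

lemma label_system_exists: "\<exists>\<P> l. label_system \<P> l n"
proof -
  let ?N = "\<lambda>P. \<exists>l. (\<forall>i<n. l i \<in> carrier G) \<and>
    (\<forall>i<n. \<forall>j<n. i \<noteq> j \<longrightarrow> \<alpha> (l i) ` P \<inter> \<alpha> (l j) ` P = {})"
  obtain \<P> where \<P>: "finite \<P>" "\<Union>\<P> = topspace X" "pairwise disjnt \<P>" "\<And>P. P \<in> \<P> \<Longrightarrow> clopen P \<and> ?N P"
  proof (rule clopen_partition[of ?N])
    fix x assume x: "x \<in> topspace X"
    obtain l where l: "\<forall>i<n. l i \<in> carrier G \<and> \<alpha> (l i) x \<notin> {}" "inj_on (\<lambda>i. \<alpha> (l i) x) {..<n}"
      using orbit_labels[OF x, of "{}" n] by auto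
    obtain V where V: "clopen V" "x \<in> V" "V \<subseteq> topspace X"
      "\<And>g h. \<lbrakk>g \<in> l ` {..<n}; h \<in> l ` {..<n}; \<alpha> g x \<noteq> \<alpha> h x\<rbrakk> \<Longrightarrow> \<alpha> g ` V \<inter> \<alpha> h ` V = {}"
      by (rule separating_nbhd[of "l ` {..<n}" x "topspace X"]) (use l x in auto)
    have "?N W" if "W \<subseteq> V" for W
    proof (intro exI[of _ l] conjI allI impI)
      fix i j assume "i < n" "j < n" "i \<noteq> j"
      then have "\<alpha> (l i) x \<noteq> \<alpha> (l j) x" using l(2) by (auto simp: inj_on_def)
      then have "\<alpha> (l i) ` V \<inter> \<alpha> (l j) ` V = {}" using V(4) \<open>i < n\<close> \<open>j < n\<close> by simp
      then show "\<alpha> (l i) ` W \<inter> \<alpha> (l j) ` W = {}"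
        using image_mono[OF that, of "\<alpha> (l i)"] image_mono[OF that, of "\<alpha> (l j)"] by blast
    qed (use l in auto)
    then show "\<exists>U. openin X U \<and> x \<in> U \<and> (\<forall>W. clopen W \<and> W \<subseteq> U \<longrightarrow> ?N W)"
      using V clopen_open by (intro exI[of _ V]) simp
  qed auto
  then have "\<forall>P\<in>\<P>. ?N P" by blast
  from bchoice[OF this] obtain l where "\<forall>P\<in>\<P>. (\<forall>i<n. l P i \<in> carrier G) \<and>
    (\<forall>i<n. \<forall>j<n. i \<noteq> j \<longrightarrow> \<alpha> (l P i) ` P \<inter> \<alpha> (l P j) ` P = {})" by metis
  then have "label_system \<P> l n" unfolding label_system_def using \<P> by simp
  then show ?thesis by blast
qed

lemma label_system_disj3:
  assumes "label_system \<P> l n" "P \<in> \<P>" "i < n" "j < n" "k < n" "i \<noteq> j" "j \<noteq> k" "i \<noteq> k" "clopen W" "W \<subseteq> P"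
  shows "disj3 W (l P i) (l P j) (l P k)"
  by (rule disj3_subset[of P]) (use assms in \<open>simp_all add: disj3_def label_system_def\<close>)

lemma label_system_inj:
  assumes "label_system \<P> l n" "P \<in> \<P>" "x \<in> P"
  shows "inj_on (\<lambda>i. \<alpha> (l P i) x) {..<n}"
proof (rule inj_onI)
  fix i j assume *: "i \<in> {..<n}" "j \<in> {..<n}" "\<alpha> (l P i) x = \<alpha> (l P j) x"
  then have "\<alpha> (l P i) ` P \<inter> \<alpha> (l P j) ` P \<noteq> {}" using assms(3) by (metis IntI empty_iff imageI)
  then show "i = j" using assms(1,2) * unfolding label_system_def by blast
qed

text \<open>\<open>rot_Un\<close> factors the cycle over a whole piece into its parts over
  \<open>W\<close> and over the complement; the whole and one part lie in the group, hence so does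
  the other part.\<close>

lemma controlled_compl:
  assumes \<Gamma>: "function_group \<Gamma>" and ls: "label_system \<P> l n"
    and top: "topspace X \<in> controlled \<Gamma> \<P> l n" and W: "W \<in> controlled \<Gamma> \<P> l n"
  shows "topspace X - W \<in> controlled \<Gamma> \<P> l n"
proof -
  have c: "clopen W" using W by (simp add: controlled_def)
  have "rot ((topspace X - W) \<inter> P) (l P i) (l P j) (l P k) \<in> \<Gamma>"
    if "P \<in> \<P>" "i < n" "j < n" "k < n" "i \<noteq> j" "j \<noteq> k" "i \<noteq> k" for P i j k
  proof -
    have P: "clopen P" using ls that(1) by (simp add: label_system_def)
    have e: "(W \<inter> P) \<union> ((topspace X - W) \<inter> P) = P" "topspace X \<inter> P = P" using clopen_subset[OF P] by auto
    have "rot ((W \<inter> P) \<union> ((topspace X - W) \<inter> P)) (l P i) (l P j) (l P k) =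
      rot (W \<inter> P) (l P i) (l P j) (l P k) \<circ> rot ((topspace X - W) \<inter> P) (l P i) (l P j) (l P k)"
      unfolding e using label_system_disj3[OF ls that P order_refl]
      by (subst e(1)[symmetric], intro rot_Un) (use e c P clopen_Int clopen_Diff in auto)
    then have "rot (W \<inter> P) (l P i) (l P j) (l P k) \<circ> rot ((topspace X - W) \<inter> P) (l P i) (l P j) (l P k) \<in> \<Gamma>"
    proof -
      have "rot (topspace X \<inter> P) (l P i) (l P j) (l P k) \<in> \<Gamma>" using top that by (simp add: controlled_def)
      then show ?thesis using \<open>rot (_ \<union> _) _ _ _ = _\<close> unfolding e by simp
    qed
    moreover have "rot (W \<inter> P) (l P i) (l P j) (l P k) \<in> \<Gamma>" using W that by (simp add: controlled_def)
    ultimately show ?thesis using function_group_cancel_left[OF \<Gamma>] by blast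
  qed
  then show ?thesis using c clopen_Diff by (simp add: controlled_def)
qed

text \<open>\<open>rot_Int\<close> works inside an alternating group of degree 5, so two spare labels are needed.\<close>

lemma controlled_Int:
  assumes \<Gamma>: "function_group \<Gamma>" and ls: "label_system \<P> l n" and n: "5 \<le> n"
    and W: "W \<in> controlled \<Gamma> \<P> l n" "W' \<in> controlled \<Gamma> \<P> l n"
  shows "W \<inter> W' \<in> controlled \<Gamma> \<P> l n"
proof -
  have c: "clopen W" "clopen W'" using W by (simp_all add: controlled_def)
  have "rot ((W \<inter> W') \<inter> P) (l P i) (l P j) (l P k) \<in> \<Gamma>"
    if P: "P \<in> \<P>" and ijk: "i < n" "j < n" "k < n" "i \<noteq> j" "j \<noteq> k" "i \<noteq> k" for P i j k
  proof -
    have cP: "clopen P" using ls P by (simp add: label_system_def)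
    have "card ({..<n} - {i,j,k}) = n - 3" using ijk by (subst card_Diff_subset) auto
    then have "2 \<le> card ({..<n} - {i,j,k})" using n by simp
    then obtain T where "T \<subseteq> {..<n} - {i,j,k}" "card T = 2" by (meson obtain_subset_with_card_n)
    then obtain p q where pq: "p < n" "q < n" "p \<noteq> q" "p \<notin> {i,j,k}" "q \<notin> {i,j,k}"
      unfolding card_2_iff by auto
    note d = label_system_disj3[OF ls P _ _ _ _ _ _ cP order_refl]
    \<comment> \<open>The conclusion of \<open>rot_Int\<close> lists its letters as
      \<open>a\<close>, \<open>c\<close>, \<open>b\<close>, so \<open>j\<close> plays the role of
      \<open>c\<close> and \<open>k\<close> that of \<open>b\<close>.\<close>
    have "rot ((W \<inter> P) \<inter> (W' \<inter> P)) (l P i) (l P j) (l P k) \<in> \<Gamma>"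
      by (rule rot_Int[OF \<Gamma>, where P=P and p="l P p" and q="l P q"])
        (use ijk pq d c cP clopen_Int W P in \<open>auto simp: controlled_def\<close>)
    moreover have "(W \<inter> P) \<inter> (W' \<inter> P) = (W \<inter> W') \<inter> P" by auto
    ultimately show ?thesis by simp
  qed
  then show ?thesis using c clopen_Int by (simp add: controlled_def)
qed

text \<open>On \<open>Q\<close>, conjugation by \<open>\<delta>\<close> turns 3-cycles over \<open>Q\<close> with the labels of \<open>P'\<close> into 3-cycles over
  \<open>\<alpha> s ` Q\<close> with the labels of \<open>P\<close>.\<close>

definition transport_piece :: "('x \<Rightarrow> 'x) set \<Rightarrow> 'x set set \<Rightarrow> ('x set \<Rightarrow> nat \<Rightarrow> 'g) \<Rightarrow> nat \<Rightarrow> 'g \<Rightarrow>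
    'x set \<Rightarrow> ('x \<Rightarrow> 'x) \<Rightarrow> bool" where
  "transport_piece \<A> \<P> l n s Q \<delta> \<longleftrightarrow> \<delta> \<in> \<A> \<and> (\<exists>P'\<in>\<P>. \<exists>P\<in>\<P>. Q \<subseteq> P' \<and> \<alpha> s ` Q \<subseteq> P \<and>
     (\<forall>u\<in>Q. \<forall>i<n. \<delta> (\<alpha> (l P' i) u) = \<alpha> (l P i \<otimes> s) u))"

text \<open>At each \<open>x\<close> the labels \<open>l P i \<otimes> s\<close> have distinct
  images because they are the labels of the piece \<open>P\<close> around
  \<open>\<alpha> s x\<close>, evaluated there; so \<open>transport_exists\<close> applies.
  Compactness leaves finitely many pieces, and with them finitely many conjugators for each
  \<open>s\<close>.\<close>

lemma transport_partition:
  assumes \<A>: "function_group \<A>" "\<And>V a b c. disj3 V a b c \<Longrightarrow> rot V a b c \<in> \<A>"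
    and ls: "label_system \<P> l n" and s: "s \<in> carrier G"
  shows "\<exists>\<Q>. finite \<Q> \<and> \<Union>\<Q> = topspace X \<and> pairwise disjnt \<Q> \<and>
    (\<forall>Q\<in>\<Q>. clopen Q \<and> (\<exists>\<delta>. transport_piece \<A> \<P> l n s Q \<delta>))"
proof -
  have clP: "\<And>P. P \<in> \<P> \<Longrightarrow> clopen P" and lG: "\<And>P i. P \<in> \<P> \<Longrightarrow> i < n \<Longrightarrow> l P i \<in> carrier G"
    and UP: "\<Union>\<P> = topspace X" using ls by (auto simp: label_system_def)
  let ?N = "\<lambda>Q. \<exists>\<delta>. transport_piece \<A> \<P> l n s Q \<delta>"
  obtain \<Q> where "finite \<Q>" "\<Union>\<Q> = topspace X" "pairwise disjnt \<Q>" "\<And>Q. Q \<in> \<Q> \<Longrightarrow> clopen Q \<and> ?N Q"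
  proof (rule clopen_partition[of ?N])
    fix x assume x: "x \<in> topspace X"
    obtain P' where P': "P' \<in> \<P>" "x \<in> P'" using x UP by blast
    obtain P where P: "P \<in> \<P>" "\<alpha> s x \<in> P" using act_in[OF s x] UP by blast
    have "inj_on (\<lambda>i. \<alpha> (l P i \<otimes> s) x) {..<n}"
      using label_system_inj[OF ls P] lG[OF P(1)] s x by (simp add: act_mult inj_on_def)
    then obtain \<delta> U where \<delta>: "\<delta> \<in> \<A>" "openin X U" "x \<in> U"
       "\<And>u i. u \<in> U \<Longrightarrow> i < n \<Longrightarrow> \<delta> (\<alpha> (l P' i) u) = \<alpha> (l P i \<otimes> s) u"
      using transport_exists[OF \<A> x, of n "l P'" "\<lambda>i. l P i \<otimes> s"] label_system_inj[OF ls P'] lG P P' s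
      by (metis m_closed)
    define V where "V = U \<inter> P' \<inter> {y \<in> topspace X. \<alpha> s y \<in> P}"
    have "openin X V" unfolding V_def using \<delta> clP P P' s act_preimage_open clopen_open by (intro openin_Int) auto
    moreover have "x \<in> V" using \<delta> P P' x by (simp add: V_def)
    moreover have "transport_piece \<A> \<P> l n s W \<delta>" if "W \<subseteq> V" for W
      unfolding transport_piece_def
      using that \<delta> P P' by (intro conjI bexI[of _ P'] bexI[of _ P]) (auto simp: V_def)
    ultimately show "\<exists>U. openin X U \<and> x \<in> U \<and> (\<forall>W. clopen W \<and> W \<subseteq> U \<longrightarrow> ?N W)"
      by (intro exI[of _ V]) auto
  qed auto
  then show ?thesis by (intro exI[of _ \<Q>]) auto
qed

text \<open>The translate of \<open>W\<close> has to carry the labels of the pieces it lands in, not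
  of those it came from. Each part \<open>W \<inter> Q\<close> is controlled because
  \<open>Q\<close> is, so its cycles lie in the group; the conjugator of \<open>Q\<close> relabels
  them by \<open>l P i \<otimes> s\<close>, and \<open>rot_shift\<close> reads the result as a cycle
  over the translated part with the labels of \<open>P\<close>.\<close>

lemma controlled_translate:
  assumes \<Gamma>: "function_group \<Gamma>" and ls: "label_system \<P> l n" and n: "5 \<le> n" and s: "s \<in> carrier G"
    and \<Q>: "finite \<Q>" "\<Union>\<Q> = topspace X" "pairwise disjnt \<Q>"
      "\<And>Q. Q \<in> \<Q> \<Longrightarrow> Q \<in> controlled \<Gamma> \<P> l n \<and> (\<exists>\<delta>. transport_piece \<Gamma> \<P> l n s Q \<delta>)"
    and W: "W \<in> controlled \<Gamma> \<P> l n"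
  shows "\<alpha> s ` W \<in> controlled \<Gamma> \<P> l n"
proof -
  have clP: "\<And>P. P \<in> \<P> \<Longrightarrow> clopen P" and lG: "\<And>P i. P \<in> \<P> \<Longrightarrow> i < n \<Longrightarrow> l P i \<in> carrier G"
    using ls by (auto simp: label_system_def)
  have c: "clopen W" using W by (simp_all add: controlled_def)
  have clQ: "clopen Q" if "Q \<in> \<Q>" for Q using \<Q>(4)[OF that] by (simp add: controlled_def)
  have T: "W \<subseteq> topspace X" "\<And>Q. Q \<in> \<Q> \<Longrightarrow> Q \<subseteq> topspace X" using c clQ clopen_subset by auto
  have "rot (\<alpha> s ` W \<inter> P) (l P i) (l P j) (l P k) \<in> \<Gamma>"
    if P: "P \<in> \<P>" and ijk: "i < n" "j < n" "k < n" "i \<noteq> j" "j \<noteq> k" "i \<noteq> k" for P i j k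
  proof -
    let ?Z = "\<alpha> s ` W \<inter> P" and ?\<K> = "(`) (\<alpha> s) ` \<Q>"
    have cZ: "clopen ?Z" using clopen_Int act_image_clopen s c clP[OF P] by blast
    have "rot (\<Union>?\<K> \<inter> ?Z) (l P i) (l P j) (l P k) \<in> \<Gamma>"
    proof (rule rot_Union_mem[OF \<Gamma>])
      show "disj3 ?Z (l P i) (l P j) (l P k)" using label_system_disj3[OF ls P ijk cZ] by simp
      show "finite ?\<K>" using \<Q>(1) by simp
      show "pairwise disjnt ?\<K>"
      proof (rule pairwiseI, clarsimp)
        fix Q Q' assume Q: "Q \<in> \<Q>" "Q' \<in> \<Q>" "\<alpha> s ` Q \<noteq> \<alpha> s ` Q'"
        then have "Q \<inter> Q' = {}" using \<Q>(3) by (auto simp: pairwise_def disjnt_def)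
        then have "\<alpha> s ` Q \<inter> \<alpha> s ` Q' = {}" using act_image_Int[OF s T(2) T(2)] Q by (metis image_empty)
        then show "disjnt (\<alpha> s ` Q) (\<alpha> s ` Q')" by (simp add: disjnt_def)
      qed
      fix K assume "K \<in> ?\<K>"
      then obtain Q where Q: "Q \<in> \<Q>" "K = \<alpha> s ` Q" by blast
      obtain \<delta> P' P1 where \<delta>: "\<delta> \<in> \<Gamma>" "P' \<in> \<P>" "P1 \<in> \<P>" "Q \<subseteq> P'" "\<alpha> s ` Q \<subseteq> P1"
        "\<And>u i. u \<in> Q \<Longrightarrow> i < n \<Longrightarrow> \<delta> (\<alpha> (l P' i) u) = \<alpha> (l P1 i \<otimes> s) u"
        using \<Q>(4)[OF Q(1)] unfolding transport_piece_def by metis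
      have "rot (K \<inter> ?Z) (l P i) (l P j) (l P k) \<in> \<Gamma>"
      \<comment> \<open>A translated piece lies in a single \<open>P1\<close>; if that is not
        \<open>P\<close>, it misses \<open>P\<close> and the cycle over it is the identity.\<close>
      proof (cases "P1 = P")
        case True
        have e: "K \<inter> ?Z = \<alpha> s ` (W \<inter> Q)"
          using act_image_Int[OF s T(1) T(2)[OF Q(1)]] \<delta>(5) Q(2) True by blast
        have "W \<inter> Q \<in> controlled \<Gamma> \<P> l n" using controlled_Int[OF \<Gamma> ls n W] \<Q>(4)[OF Q(1)] by blast
        moreover have "W \<inter> Q \<inter> P' = W \<inter> Q" using \<delta>(4) by blast
        ultimately have mem: "rot (W \<inter> Q) (l P' i) (l P' j) (l P' k) \<in> \<Gamma>" and cWQ: "clopen (W \<inter> Q)"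
          using ijk \<delta>(2) by (force simp: controlled_def)+
        have "clopen (\<alpha> s ` (W \<inter> Q))" using act_image_clopen s cWQ by blast
        then have "disj3 (\<alpha> s ` (W \<inter> Q)) (l P i) (l P j) (l P k)"
          by (rule label_system_disj3[OF ls P ijk]) (use e in blast)
        then have d: "disj3 (W \<inter> Q) (l P i \<otimes> s) (l P j \<otimes> s) (l P k \<otimes> s)"
          using disj3_shift s lG P ijk cWQ by simp
        have "rot (W \<inter> Q) (l P i \<otimes> s) (l P j \<otimes> s) (l P k \<otimes> s) \<in> \<Gamma>"
        proof (rule rot_conj[OF \<Gamma> \<delta>(1) mem _ d])
          show "disj3 (W \<inter> Q) (l P' i) (l P' j) (l P' k)"
            by (rule label_system_disj3[OF ls \<delta>(2) ijk cWQ]) (use \<delta>(4) in blast)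
        qed (use \<delta>(6) True ijk in auto)
        then show ?thesis unfolding e using rot_shift s lG P ijk clopen_subset[OF cWQ] by simp
      next
        case False
        then have "P1 \<inter> P = {}" using ls P \<delta>(3) by (auto simp: label_system_def pairwise_def disjnt_def)
        then have "K \<inter> ?Z = {}" using \<delta>(5) Q(2) by blast
        then show ?thesis using function_group_id[OF \<Gamma>] by simp
      qed
      moreover have "clopen K" using Q clQ act_image_clopen s by blast
      ultimately show "clopen K \<and> rot (K \<inter> ?Z) (l P i) (l P j) (l P k) \<in> \<Gamma>" by blast
    qed
    moreover have "\<Union>?\<K> = \<alpha> s ` topspace X" using \<Q>(2) by blast
    moreover have "\<alpha> s ` topspace X = topspace X"
      using act_homeo[OF s] homeomorphic_imp_surjective_map by blast
    moreover have "topspace X \<inter> ?Z = ?Z" using clopen_subset[OF cZ] by blast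
    ultimately show ?thesis by simp
  qed
  then show ?thesis using c s act_image_clopen by (simp add: controlled_def)
qed

text \<open>Invariance under generators and their inverses spreads to the whole group by induction
  on \<open>generate\<close>. For distinct \<open>x\<close>, \<open>y\<close> the separating set is
  the translate by \<open>inv g\<close> of a member of \<open>\<E>\<close> that separates
  \<open>\<alpha> g x\<close> from \<open>\<alpha> g y\<close>.\<close>

lemma controlled_clopen:
  assumes \<Gamma>: "function_group \<Gamma>" and ls: "label_system \<P> l n" and n: "5 \<le> n"
    and S: "S \<subseteq> carrier G" "generate G S = carrier G"
    and top: "topspace X \<in> controlled \<Gamma> \<P> l n"
    and \<E>: "\<E> \<subseteq> controlled \<Gamma> \<P> l n"
      "\<And>x y. \<lbrakk>x \<in> topspace X; y \<in> topspace X; x \<noteq> y\<rbrakk> \<Longrightarrow> \<exists>g\<in>carrier G. \<exists>E\<in>\<E>. \<alpha> g x \<in> E \<and> \<alpha> g y \<notin> E"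
    and tr: "\<And>s W. s \<in> S \<union> m_inv G ` S \<Longrightarrow> W \<in> controlled \<Gamma> \<P> l n \<Longrightarrow> \<alpha> s ` W \<in> controlled \<Gamma> \<P> l n"
    and C: "clopen C"
  shows "C \<in> controlled \<Gamma> \<P> l n"
proof -
  let ?B = "controlled \<Gamma> \<P> l n"
  have cB: "clopen W" if "W \<in> ?B" for W using that by (simp add: controlled_def)
  have inv: "g \<in> carrier G \<and> (\<forall>W\<in>?B. \<alpha> g ` W \<in> ?B)" if "g \<in> generate G S" for g
    using that
  proof induction
    case one
    have "\<alpha> \<one> ` W = W" if "W \<subseteq> topspace X" for W using that by (force simp: act_one)
    then have "\<forall>W\<in>?B. \<alpha> \<one> ` W = W" using cB clopen_subset by metis
    then show ?case by simp
  next
    case (eng g h)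
    have "\<alpha> (g \<otimes> h) ` W \<in> ?B" if "W \<in> ?B" for W
    proof -
      have "\<alpha> g ` \<alpha> h ` W = \<alpha> (g \<otimes> h) ` W"
        using act_image_mult eng.IH clopen_subset[OF cB[OF that]] by blast
      moreover have "\<alpha> g ` \<alpha> h ` W \<in> ?B" using eng.IH that by blast
      ultimately show ?thesis by simp
    qed
    then show ?case using eng.IH by simp
  next
    case (incl h)
    then show ?case using tr S by blast
  next
    case (inv h)
    then have "m_inv G h \<in> S \<union> m_inv G ` S" "h \<in> carrier G" using S by auto
    then show ?case using tr by simp
  qed
  show ?thesis
  proof (rule boolean_separating[of ?B])
    fix x y assume xy: "x \<in> topspace X" "y \<in> topspace X" "x \<noteq> y"
    then obtain g E where g: "g \<in> carrier G" "E \<in> \<E>" "\<alpha> g x \<in> E" "\<alpha> g y \<notin> E" using \<E>(2) by blast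
    have E: "E \<in> ?B" "E \<subseteq> topspace X" using g \<E>(1) cB clopen_subset by auto
    have "inv g \<in> generate G S" using S(2) g(1) by simp
    then have "\<alpha> (inv g) ` E \<in> ?B" using inv E(1) by blast
    moreover have "x \<in> \<alpha> (inv g) ` E" using imageI[OF g(3), of "\<alpha> (inv g)"] act_inv[OF g(1) xy(1)] by simp
    moreover have "y \<notin> \<alpha> (inv g) ` E"
    proof
      assume "y \<in> \<alpha> (inv g) ` E"
      then obtain e where "e \<in> E" "y = \<alpha> (inv g) e" by blast
      then show False using act_inv'[OF g(1)] E(2) g(4) by auto
    qed
    ultimately show "\<exists>W\<in>?B. x \<in> W \<and> y \<notin> W" by blast
  next
    show "\<And>W. W \<in> ?B \<Longrightarrow> clopen W" by (rule cB)
    show "topspace X \<in> ?B" by (rule top)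
    show "\<And>W. W \<in> ?B \<Longrightarrow> topspace X - W \<in> ?B" by (rule controlled_compl[OF \<Gamma> ls top])
    show "\<And>W W'. W \<in> ?B \<Longrightarrow> W' \<in> ?B \<Longrightarrow> W \<inter> W' \<in> ?B" by (rule controlled_Int[OF \<Gamma> ls n])
    show "clopen C" by (rule C)
  qed
qed

text \<open>The finite set has two parts: \<open>F1\<close> puts the sets of \<open>\<Z>\<close>
  into the Boolean algebra, for all triples of labels, and \<open>F2\<close> contains one conjugator
  for every piece of every partition \<open>\<Q> s\<close>. The pieces belong to \<open>\<Z>\<close>
  because \<open>controlled_translate\<close> wants them controlled beforehand. All choices are made
  inside \<open>\<A>\<close>, before any \<open>\<Gamma>\<close> is given.\<close>

lemma finite_scale:
  assumes \<A>: "function_group \<A>" "\<And>V a b c. disj3 V a b c \<Longrightarrow> rot V a b c \<in> \<A>"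
    and ls: "label_system \<P> l n" and n: "5 \<le> n"
    and S: "finite S" "S \<subseteq> carrier G" "generate G S = carrier G"
    and \<E>: "finite \<E>" "\<And>E. E \<in> \<E> \<Longrightarrow> clopen E"
      "\<And>x y. \<lbrakk>x \<in> topspace X; y \<in> topspace X; x \<noteq> y\<rbrakk> \<Longrightarrow> \<exists>g\<in>carrier G. \<exists>E\<in>\<E>. \<alpha> g x \<in> E \<and> \<alpha> g y \<notin> E"
  obtains F where "finite F" "F \<subseteq> \<A>"
    "\<And>\<Gamma> C. function_group \<Gamma> \<Longrightarrow> F \<subseteq> \<Gamma> \<Longrightarrow> clopen C \<Longrightarrow> C \<in> controlled \<Gamma> \<P> l n"
proof -
  let ?S = "S \<union> m_inv G ` S"
  have "\<forall>s\<in>?S. \<exists>\<Q>. finite \<Q> \<and> \<Union>\<Q> = topspace X \<and> pairwise disjnt \<Q> \<and>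
    (\<forall>Q\<in>\<Q>. clopen Q \<and> (\<exists>\<delta>. transport_piece \<A> \<P> l n s Q \<delta>))"
    using S(2) by (intro ballI transport_partition[OF \<A> ls]) auto
  from bchoice[OF this] obtain \<Q> where \<Q>: "\<forall>s\<in>?S. finite (\<Q> s) \<and> \<Union>(\<Q> s) = topspace X \<and> pairwise disjnt (\<Q> s) \<and>
    (\<forall>Q\<in>\<Q> s. clopen Q \<and> (\<exists>\<delta>. transport_piece \<A> \<P> l n s Q \<delta>))" by (rule exE)
  define D where "D s Q = (SOME \<delta>. transport_piece \<A> \<P> l n s Q \<delta>)" for s Q
  have D: "transport_piece \<A> \<P> l n s Q (D s Q)" if "s \<in> ?S" "Q \<in> \<Q> s" for s Q
  proof -
    have "\<exists>\<delta>. transport_piece \<A> \<P> l n s Q \<delta>" using bspec[OF \<Q> that(1)] that(2) by blast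
    then show ?thesis unfolding D_def by (rule someI_ex)
  qed
  define \<Z> where "\<Z> = insert (topspace X) (\<E> \<union> (\<Union>s\<in>?S. \<Q> s))"
  define J where "J = {(i, j, k). i < n \<and> j < n \<and> k < n \<and> i \<noteq> j \<and> j \<noteq> k \<and> i \<noteq> k}"
  define F1 where "F1 = (\<lambda>(Z, P, i, j, k). rot (Z \<inter> P) (l P i) (l P j) (l P k)) ` (\<Z> \<times> \<P> \<times> J)"
  define F2 where "F2 = (\<lambda>(s, Q). D s Q) ` (SIGMA s:?S. \<Q> s)"
  have P: "finite \<P>" "\<And>P. P \<in> \<P> \<Longrightarrow> clopen P" using ls by (auto simp: label_system_def)
  have "finite J" by (rule finite_subset[of _ "{..<n} \<times> {..<n} \<times> {..<n}"]) (auto simp: J_def)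
  moreover have "finite \<Z>" using \<E>(1) \<Q> S(1) by (auto simp: \<Z>_def)
  ultimately have fin: "finite (F1 \<union> F2)" using P S(1) \<Q> unfolding F1_def F2_def by (intro finite_UnI finite_imageI finite_SigmaI) auto
  have cZ: "clopen Z" if "Z \<in> \<Z>" for Z using that \<E>(2) \<Q> by (auto simp: \<Z>_def)
  have "F1 \<subseteq> \<A>"
  proof
    fix f assume "f \<in> F1"
    then obtain Z P i j k where *: "Z \<in> \<Z>" "P \<in> \<P>" "(i, j, k) \<in> J" "f = rot (Z \<inter> P) (l P i) (l P j) (l P k)"
      by (auto simp: F1_def)
    have "disj3 (Z \<inter> P) (l P i) (l P j) (l P k)"
      using * label_system_disj3[OF ls *(2), of i j k "Z \<inter> P"] clopen_Int[OF cZ P(2)] by (simp add: J_def)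
    then show "f \<in> \<A>" using \<A>(2) * by simp
  qed
  moreover have "F2 \<subseteq> \<A>" using D by (auto simp: F2_def transport_piece_def)
  ultimately have FA: "F1 \<union> F2 \<subseteq> \<A>" by simp
  show ?thesis
  proof (rule that[OF fin FA])
    fix \<Gamma> C assume \<Gamma>: "function_group \<Gamma>" "F1 \<union> F2 \<subseteq> \<Gamma>" and C: "clopen C"
    have Z: "Z \<in> controlled \<Gamma> \<P> l n" if "Z \<in> \<Z>" for Z
    proof -
      have "rot (Z \<inter> P) (l P i) (l P j) (l P k) \<in> F1" if "P \<in> \<P>" "(i, j, k) \<in> J" for P i j k
        using \<open>Z \<in> \<Z>\<close> that unfolding F1_def by force
      then show ?thesis using cZ[OF that] \<Gamma>(2) unfolding controlled_def J_def by auto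
    qed
    have piece: "transport_piece \<Gamma> \<P> l n s Q (D s Q)" if "s \<in> ?S" "Q \<in> \<Q> s" for s Q
    proof -
      have "D s Q \<in> F2" using that unfolding F2_def by force
      then show ?thesis using D[OF that] \<Gamma>(2) unfolding transport_piece_def by blast
    qed
    show "C \<in> controlled \<Gamma> \<P> l n"
    proof (rule controlled_clopen[OF \<Gamma>(1) ls n S(2,3) _ _ \<E>(3) _ C])
      show "topspace X \<in> controlled \<Gamma> \<P> l n" by (rule Z) (simp add: \<Z>_def)
      show "\<E> \<subseteq> controlled \<Gamma> \<P> l n" using Z by (auto simp: \<Z>_def)
      fix s W assume s: "s \<in> ?S" and W: "W \<in> controlled \<Gamma> \<P> l n"
      show "\<alpha> s ` W \<in> controlled \<Gamma> \<P> l n"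
      proof (rule controlled_translate[OF \<Gamma>(1) ls n _ _ _ _ _ W])
        show "s \<in> carrier G" using s S(2) by auto
        show "finite (\<Q> s)" "\<Union>(\<Q> s) = topspace X" "pairwise disjnt (\<Q> s)" using \<Q> s by blast+
        fix Q assume Q: "Q \<in> \<Q> s"
        then have "Q \<in> \<Z>" using s by (auto simp: \<Z>_def)
        then show "Q \<in> controlled \<Gamma> \<P> l n \<and> (\<exists>\<delta>. transport_piece \<Gamma> \<P> l n s Q \<delta>)"
          using Z piece[OF s Q] by blast
      qed
    qed
  qed
qed

section \<open>From one label system to all labels\<close>

text \<open>A statement about germs at \<open>x\<close>: the neighbourhood is existentially
  quantified, so inductions along words of arbitrary length may shrink it at each step. The uniform
  statement is recovered in \<open>rot_all\<close>.\<close>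

definition good :: "('x \<Rightarrow> 'x) set \<Rightarrow> 'x \<Rightarrow> 'g \<Rightarrow> 'g \<Rightarrow> 'g \<Rightarrow> bool" where
  "good \<Gamma> x a b c \<longleftrightarrow> {a, b, c} \<subseteq> carrier G \<and> \<alpha> a x \<noteq> \<alpha> b x \<and> \<alpha> b x \<noteq> \<alpha> c x \<and> \<alpha> c x \<noteq> \<alpha> a x \<and>
     (\<exists>U. openin X U \<and> x \<in> U \<and> (\<forall>W. clopen W \<and> W \<subseteq> U \<longrightarrow> rot W a b c \<in> \<Gamma>))"

lemma good_local:
  assumes "good \<Gamma> x a b c"
  obtains V where "clopen V" "x \<in> V" "disj3 V a b c"
    "\<And>W. clopen W \<Longrightarrow> W \<subseteq> V \<Longrightarrow> disj3 W a b c \<and> rot W a b c \<in> \<Gamma>"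
proof -
  obtain U where U: "openin X U" "x \<in> U" "\<And>W. clopen W \<Longrightarrow> W \<subseteq> U \<Longrightarrow> rot W a b c \<in> \<Gamma>"
    using assms unfolding good_def by auto
  obtain V where V: "clopen V" "x \<in> V" "V \<subseteq> U"
    "\<And>g h. \<lbrakk>g \<in> {a,b,c}; h \<in> {a,b,c}; \<alpha> g x \<noteq> \<alpha> h x\<rbrakk> \<Longrightarrow> \<alpha> g ` V \<inter> \<alpha> h ` V = {}"
    by (rule separating_nbhd[of "{a,b,c}" x U]) (use assms U in \<open>auto simp: good_def\<close>)
  have d: "disj3 V a b c" using V(1,4) assms unfolding disj3_def good_def by simp
  show ?thesis
  proof (rule that[OF V(1,2) d])
    fix W assume "clopen W" "W \<subseteq> V"
    then show "disj3 W a b c \<and> rot W a b c \<in> \<Gamma>" using disj3_subset[OF d] U(3) V(3) by blast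
  qed
qed

lemma good_rotate:
  assumes "good \<Gamma> x a b c" shows "good \<Gamma> x b c a"
proof -
  obtain V where V: "clopen V" "x \<in> V" "\<And>W. clopen W \<Longrightarrow> W \<subseteq> V \<Longrightarrow> disj3 W a b c \<and> rot W a b c \<in> \<Gamma>"
    using good_local[OF assms] by metis
  then have "\<forall>W. clopen W \<and> W \<subseteq> V \<longrightarrow> rot W b c a \<in> \<Gamma>" using rot_rotate_mem by blast
  then show ?thesis using assms V(1,2) clopen_open unfolding good_def by auto
qed

lemma good_swap:
  assumes "function_group \<Gamma>" "good \<Gamma> x a b c" shows "good \<Gamma> x a c b"
proof -
  obtain V where V: "clopen V" "x \<in> V" "\<And>W. clopen W \<Longrightarrow> W \<subseteq> V \<Longrightarrow> disj3 W a b c \<and> rot W a b c \<in> \<Gamma>"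
    using good_local[OF assms(2)] by metis
  then have "\<forall>W. clopen W \<and> W \<subseteq> V \<longrightarrow> rot W a c b \<in> \<Gamma>" using rot_swap_mem[OF assms(1)] by blast
  moreover have "\<alpha> b x \<noteq> \<alpha> a x" "\<alpha> c x \<noteq> \<alpha> b x" "\<alpha> a x \<noteq> \<alpha> c x" "{a, c, b} \<subseteq> carrier G"
    using assms(2) by (auto simp: good_def)
  ultimately show ?thesis using V(1,2) clopen_open unfolding good_def by metis
qed

text \<open>Conjugating by the 3-cycle on \<open>a\<close>, \<open>p\<close>, \<open>q\<close> moves the label \<open>a\<close> to \<open>p\<close> and fixes \<open>b\<close> and \<open>c\<close>.\<close>

lemma good_replace:
  assumes \<Gamma>: "function_group \<Gamma>" and g: "good \<Gamma> x a b c" "good \<Gamma> x a p q"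
    and ne: "\<alpha> p x \<noteq> \<alpha> b x" "\<alpha> p x \<noteq> \<alpha> c x" "\<alpha> q x \<noteq> \<alpha> b x" "\<alpha> q x \<noteq> \<alpha> c x"
  shows "good \<Gamma> x p b c"
proof -
  obtain V1 where V1: "clopen V1" "x \<in> V1" "\<And>W. clopen W \<Longrightarrow> W \<subseteq> V1 \<Longrightarrow> disj3 W a b c \<and> rot W a b c \<in> \<Gamma>"
    using good_local[OF g(1)] by metis
  obtain V2 where V2: "clopen V2" "x \<in> V2" "\<And>W. clopen W \<Longrightarrow> W \<subseteq> V2 \<Longrightarrow> disj3 W a p q \<and> rot W a p q \<in> \<Gamma>"
    using good_local[OF g(2)] by metis
  let ?L = "{a, b, c, p, q}"
  have L: "?L \<subseteq> carrier G" using g by (simp add: good_def)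
  have d: "\<alpha> a x \<noteq> \<alpha> b x" "\<alpha> b x \<noteq> \<alpha> c x" "\<alpha> c x \<noteq> \<alpha> a x" "\<alpha> a x \<noteq> \<alpha> p x" "\<alpha> p x \<noteq> \<alpha> q x" "\<alpha> q x \<noteq> \<alpha> a x"
    using g by (simp_all add: good_def)
  obtain V where V: "clopen V" "x \<in> V" "V \<subseteq> V1 \<inter> V2"
    "\<And>g h. \<lbrakk>g \<in> ?L; h \<in> ?L; \<alpha> g x \<noteq> \<alpha> h x\<rbrakk> \<Longrightarrow> \<alpha> g ` V \<inter> \<alpha> h ` V = {}"
    by (rule separating_nbhd[of ?L x "V1 \<inter> V2"]) (use L V1 V2 clopen_open clopen_Int in auto)
  have "disj3 V p b c" unfolding disj3_def using V(1,4) L d ne by simp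
  have "rot W p b c \<in> \<Gamma>" if W: "clopen W" "W \<subseteq> V" for W
  proof (rule rot_conj[OF \<Gamma>])
    have "W \<subseteq> V1" "W \<subseteq> V2" using W V by auto
    then show "rot W a p q \<in> \<Gamma>" "rot W a b c \<in> \<Gamma>" "disj3 W a b c" using V1(3) V2(3) W by auto
    show "disj3 W p b c" using disj3_subset[OF \<open>disj3 V p b c\<close>] W by blast
    fix u assume u: "u \<in> W"
    have fx: "rot W a p q (\<alpha> h u) = \<alpha> h u" if "h \<in> {b, c}" for h
    proof -
      have "\<alpha> h ` V \<inter> \<alpha> a ` V = {}" "\<alpha> h ` V \<inter> \<alpha> p ` V = {}" "\<alpha> h ` V \<inter> \<alpha> q ` V = {}"
        by (rule V(4); use that d ne in auto)+
      then show ?thesis using W(2) u by (intro rot_outside) blast+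
    qed
    have "rot W a p q (\<alpha> a u) = \<alpha> p u" using rot_apply(1)[of W a p q u] V2(3) W \<open>W \<subseteq> V2\<close> u by blast
    then show "rot W a p q (\<alpha> a u) = \<alpha> p u \<and> rot W a p q (\<alpha> b u) = \<alpha> b u \<and> rot W a p q (\<alpha> c u) = \<alpha> c u"
      using fx by simp
  qed
  then show ?thesis unfolding good_def using V(1,2) clopen_open L d ne by auto
qed

text \<open>Change of base point: the label \<open>a\<close> at \<open>\<alpha> g x\<close> and the
  label \<open>a \<otimes> g\<close> at \<open>x\<close> lead to the same point. Run backwards, it
  brings any chosen label to \<open>\<one>\<close>.\<close>

lemma good_shift:
  assumes x: "x \<in> topspace X" and g: "g \<in> carrier G" and good: "good \<Gamma> (\<alpha> g x) a b c"
  shows "good \<Gamma> x (a \<otimes> g) (b \<otimes> g) (c \<otimes> g)"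
proof -
  have G: "a \<in> carrier G" "b \<in> carrier G" "c \<in> carrier G" using good by (simp_all add: good_def)
  obtain U where U: "openin X U" "\<alpha> g x \<in> U" "\<And>W. clopen W \<Longrightarrow> W \<subseteq> U \<Longrightarrow> rot W a b c \<in> \<Gamma>"
    using good unfolding good_def by auto
  have "rot W (a \<otimes> g) (b \<otimes> g) (c \<otimes> g) \<in> \<Gamma>" if "clopen W" "W \<subseteq> {x \<in> topspace X. \<alpha> g x \<in> U}" for W
  proof -
    have "rot (\<alpha> g ` W) a b c \<in> \<Gamma>" using act_image_clopen[OF g that(1)] that(2) by (intro U(3)) auto
    then show ?thesis using rot_shift[OF g G] clopen_subset[OF that(1)] by simp
  qed
  moreover have "openin X {x \<in> topspace X. \<alpha> g x \<in> U}" using act_preimage_open g U by blast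
  ultimately show ?thesis using good g G x U(2) unfolding good_def
    by (auto simp: act_mult intro!: exI[of _ "{x \<in> topspace X. \<alpha> g x \<in> U}"])
qed

lemma good_unshift:
  assumes x: "x \<in> topspace X" and g: "g \<in> carrier G" and good: "good \<Gamma> x a b c"
  shows "good \<Gamma> (\<alpha> g x) (a \<otimes> inv g) (b \<otimes> inv g) (c \<otimes> inv g)"
  using good_shift[of "\<alpha> g x" "inv g" \<Gamma> a b c] act_inv[OF g x] act_in[OF g x] g good by simp

text \<open>Slot 0 holds the centre and is overwritten by \<open>\<one>\<close> or by
  \<open>s\<close>; the other \<open>n - 1\<close> labels, the arms, are common to both versions.
  The arms link \<open>\<one>\<close> to \<open>s\<close> although no triple is required to contain
  both, which would be impossible when \<open>\<alpha> s x = x\<close>.\<close>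

definition star :: "('x \<Rightarrow> 'x) set \<Rightarrow> nat \<Rightarrow> 'x \<Rightarrow> 'g \<Rightarrow> (nat \<Rightarrow> 'g) \<Rightarrow> bool" where
  "star \<Gamma> n x s c \<longleftrightarrow> (\<forall>t\<in>{\<one>, s}. \<forall>i<n. \<forall>j<n. \<forall>k<n. i \<noteq> j \<longrightarrow> j \<noteq> k \<longrightarrow> i \<noteq> k \<longrightarrow>
     good \<Gamma> x ((c(0 := t)) i) ((c(0 := t)) j) ((c(0 := t)) k))"

text \<open>The new translates are the images of the old ones under one injective map, so their
  disjointness comes for free with the conjugator.\<close>

lemma disj3_transport:
  assumes "disj3 W a b c" "inj \<delta>" "{a', b', c'} \<subseteq> carrier G"
    and \<delta>: "\<And>u. u \<in> W \<Longrightarrow> \<delta> (\<alpha> a u) = \<alpha> a' u \<and> \<delta> (\<alpha> b u) = \<alpha> b' u \<and> \<delta> (\<alpha> c u) = \<alpha> c' u"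
  shows "disj3 W a' b' c'"
proof -
  have "\<alpha> a' ` W = \<delta> ` \<alpha> a ` W" "\<alpha> b' ` W = \<delta> ` \<alpha> b ` W" "\<alpha> c' ` W = \<delta> ` \<alpha> c ` W"
    using \<delta> by (force simp: image_image intro!: image_cong)+
  then show ?thesis using assms(1,3) unfolding disj3_def by (simp add: image_Int[OF assms(2), symmetric])
qed

text \<open>Two conjugators per piece suffice, carrying the labels of the system to the star centred
  at \<open>\<one>\<close> and to the one centred at \<open>s\<close>. They act on all controlled
  cycles at once, so finitely many of them give \<open>good\<close> for every triple of star labels
  at every point.\<close>

lemma star_finite_scale:
  assumes \<A>: "function_group \<A>" "\<And>V a b c. disj3 V a b c \<Longrightarrow> rot V a b c \<in> \<A>"
    and ls: "label_system \<P> l n" and s: "s \<in> carrier G"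
  shows "\<exists>F. finite F \<and> F \<subseteq> \<A> \<and> (\<forall>\<Gamma>. function_group \<Gamma> \<and> F \<subseteq> \<Gamma> \<and>
    (\<forall>C. clopen C \<longrightarrow> C \<in> controlled \<Gamma> \<P> l n) \<longrightarrow> (\<forall>x\<in>topspace X. \<exists>c. star \<Gamma> n x s c))"
proof -
  have clP: "\<And>P. P \<in> \<P> \<Longrightarrow> clopen P" and lG: "\<And>P i. P \<in> \<P> \<Longrightarrow> i < n \<Longrightarrow> l P i \<in> carrier G"
    and UP: "\<Union>\<P> = topspace X" using ls by (auto simp: label_system_def)
  define mv where "mv \<delta> P (c :: nat \<Rightarrow> 'g) Q \<longleftrightarrow> \<delta> \<in> \<A> \<and> (\<forall>u\<in>Q. \<forall>i<n. \<delta> (\<alpha> (l P i) u) = \<alpha> (c i) u)" for \<delta> P c Q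
  define piece where "piece Q c \<delta> \<delta>' \<longleftrightarrow> (\<forall>i<n. c i \<in> carrier G) \<and>
    (\<exists>P\<in>\<P>. Q \<subseteq> P \<and> mv \<delta> P (c(0 := \<one>)) Q \<and> mv \<delta>' P (c(0 := s)) Q)" for Q c \<delta> \<delta>'
  let ?N = "\<lambda>Q. \<exists>c \<delta> \<delta>'. piece Q c \<delta> \<delta>'"
  obtain \<Q> where \<Q>: "finite \<Q>" "\<Union>\<Q> = topspace X" "pairwise disjnt \<Q>" "\<And>Q. Q \<in> \<Q> \<Longrightarrow> clopen Q \<and> ?N Q"
  proof (rule clopen_partition[of ?N])
    fix x assume x: "x \<in> topspace X"
    obtain P where P: "P \<in> \<P>" "x \<in> P" using x UP by blast
    \<comment> \<open>Avoiding both \<open>x\<close> and \<open>\<alpha> s x\<close> keeps the arms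
      distinct from either centre, also when the two points coincide.\<close>
    obtain c where c: "\<forall>i<n. c i \<in> carrier G \<and> \<alpha> (c i) x \<notin> {x, \<alpha> s x}" "inj_on (\<lambda>i. \<alpha> (c i) x) {..<n}"
      using orbit_labels[OF x, of "{x, \<alpha> s x}" n] by auto
    have ex: "\<exists>\<delta> U. openin X U \<and> x \<in> U \<and> mv \<delta> P (c(0 := t)) U" if t: "t \<in> {\<one>, s}" for t
    proof -
      have tx: "\<alpha> t x \<in> {x, \<alpha> s x}" "t \<in> carrier G" using t x s act_one by auto
      have "inj_on (\<lambda>i. \<alpha> ((c(0 := t)) i) x) {..<n}"
      proof (rule inj_onI)
        fix i j assume ij: "i \<in> {..<n}" "j \<in> {..<n}" "\<alpha> ((c(0 := t)) i) x = \<alpha> ((c(0 := t)) j) x"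
        have "\<alpha> (c i) x \<noteq> \<alpha> t x" "\<alpha> (c j) x \<noteq> \<alpha> t x" using c(1) ij tx(1) by force+
        then show "i = j" using ij inj_onD[OF c(2), of i j] by (auto split: if_splits)
      qed
      note inj = this
      show ?thesis
      proof (rule transport_exists[OF \<A> x, of n "l P" "c(0 := t)"])
        show "inj_on (\<lambda>i. \<alpha> (l P i) x) {..<n}" by (rule label_system_inj[OF ls P])
        show "inj_on (\<lambda>i. \<alpha> ((c(0 := t)) i) x) {..<n}" by (rule inj)
        show "l P i \<in> carrier G" "(c(0 := t)) i \<in> carrier G" if "i < n" for i
          using that lG[OF P(1)] c(1) tx(2) by auto
        fix \<delta> U assume "\<delta> \<in> \<A>" "openin X U" "x \<in> U"
          "\<And>u i. u \<in> U \<Longrightarrow> i < n \<Longrightarrow> \<delta> (\<alpha> (l P i) u) = \<alpha> ((c(0 := t)) i) u"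
        then show ?thesis unfolding mv_def by (intro exI[of _ \<delta>] exI[of _ U]) simp
      qed
    qed
    obtain \<delta> U where U: "openin X U" "x \<in> U" "mv \<delta> P (c(0 := \<one>)) U" using ex by blast
    obtain \<delta>' U' where U': "openin X U'" "x \<in> U'" "mv \<delta>' P (c(0 := s)) U'" using ex by blast
    have "piece W c \<delta> \<delta>'" if "W \<subseteq> U \<inter> U' \<inter> P" for W
    proof -
      have "mv \<delta> P (c(0 := \<one>)) W" "mv \<delta>' P (c(0 := s)) W" using U(3) U'(3) that by (auto simp: mv_def)
      then show ?thesis unfolding piece_def using c(1) P(1) that by auto
    qed
    then show "\<exists>U. openin X U \<and> x \<in> U \<and> (\<forall>W. clopen W \<and> W \<subseteq> U \<longrightarrow> ?N W)"
      using openin_Int[OF openin_Int[OF U(1) U'(1)] clopen_open[OF clP[OF P(1)]]] U(2) U'(2) P(2)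
      by (intro exI[of _ "U \<inter> U' \<inter> P"]) auto
  qed auto
  have "\<forall>Q\<in>\<Q>. \<exists>t. piece Q (fst t) (fst (snd t)) (snd (snd t))"
  proof
    fix Q assume "Q \<in> \<Q>"
    then obtain c \<delta> \<delta>' where "piece Q c \<delta> \<delta>'" using \<Q>(4) by metis
    then show "\<exists>t. piece Q (fst t) (fst (snd t)) (snd (snd t))" by (intro exI[of _ "(c, \<delta>, \<delta>')"]) simp
  qed
  from bchoice[OF this] obtain t where t: "\<forall>Q\<in>\<Q>. piece Q (fst (t Q)) (fst (snd (t Q))) (snd (snd (t Q)))" by (rule exE)
  define F where "F = (\<lambda>Q. fst (snd (t Q))) ` \<Q> \<union> (\<lambda>Q. snd (snd (t Q))) ` \<Q>"
  have "\<exists>c. star \<Gamma> n x s c" if \<Gamma>: "function_group \<Gamma>" "F \<subseteq> \<Gamma>"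
    and all: "\<And>C. clopen C \<Longrightarrow> C \<in> controlled \<Gamma> \<P> l n" and x: "x \<in> topspace X" for \<Gamma> x
  proof -
    obtain Q where Q: "Q \<in> \<Q>" "x \<in> Q" using x \<Q>(2) by blast
    obtain c \<delta> \<delta>' where cd: "t Q = (c, \<delta>, \<delta>')" by (metis prod_cases3)
    have pc: "piece Q c \<delta> \<delta>'" using t Q cd by force
    have "\<delta> \<in> F" "\<delta>' \<in> F" unfolding F_def using Q cd by force+
    then have mem: "\<delta> \<in> \<Gamma>" "\<delta>' \<in> \<Gamma>" using \<Gamma>(2) by auto
    obtain P where P: "P \<in> \<P>" "Q \<subseteq> P" "mv \<delta> P (c(0 := \<one>)) Q" "mv \<delta>' P (c(0 := s)) Q"
      and cG: "\<forall>i<n. c i \<in> carrier G" using pc unfolding piece_def by blast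
    have Qc: "clopen Q" using \<Q>(4) Q by blast
    have good: "good \<Gamma> x (e i) (e j) (e k)"
      if d: "d \<in> \<Gamma>" and m: "mv d P e Q" and eG: "\<forall>i<n. e i \<in> carrier G"
        and ijk: "i < n" "j < n" "k < n" "i \<noteq> j" "j \<noteq> k" "i \<noteq> k" for d e i j k
    proof -
      have mm: "\<And>u. u \<in> Q \<Longrightarrow> d (\<alpha> (l P i) u) = \<alpha> (e i) u \<and> d (\<alpha> (l P j) u) = \<alpha> (e j) u \<and> d (\<alpha> (l P k) u) = \<alpha> (e k) u"
        using m ijk unfolding mv_def by blast
      have D: "disj3 W (l P i) (l P j) (l P k)" "disj3 W (e i) (e j) (e k)" if W: "clopen W" "W \<subseteq> Q" for W
      proof -
        show 1: "disj3 W (l P i) (l P j) (l P k)"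
          by (rule label_system_disj3[OF ls P(1) ijk W(1)]) (use W P in blast)
        show "disj3 W (e i) (e j) (e k)"
          by (rule disj3_transport[OF 1 function_group_inj[OF \<Gamma>(1) d]]) (use eG ijk mm W in auto)
      qed
      have "rot W (e i) (e j) (e k) \<in> \<Gamma>" if W: "clopen W" "W \<subseteq> Q" for W
      proof (rule rot_conj[OF \<Gamma>(1) d _ D[OF W]])
        have "W \<inter> P = W" using W P by blast
        then show "rot W (l P i) (l P j) (l P k) \<in> \<Gamma>" using all[OF W(1)] P(1) ijk unfolding controlled_def by force
      qed (use mm W in auto)
      moreover have "\<alpha> (e i) x \<noteq> \<alpha> (e j) x" "\<alpha> (e j) x \<noteq> \<alpha> (e k) x" "\<alpha> (e k) x \<noteq> \<alpha> (e i) x"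
        using disj3_notin[OF D(2)[OF Qc order_refl] Q(2) order_refl] Q(2) by (metis imageI)+
      ultimately show ?thesis unfolding good_def using eG ijk Qc Q(2) clopen_open by auto
    qed
    have "star \<Gamma> n x s c" unfolding star_def
      using good[OF mem(1) P(3)] good[OF mem(2) P(4)] cG s by simp
    then show ?thesis by blast
  qed
  moreover have "finite F" using \<Q>(1) by (simp add: F_def)
  moreover have "F \<subseteq> \<A>"
  proof -
    have "\<delta> \<in> \<A> \<and> \<delta>' \<in> \<A>" if pc: "piece Q c \<delta> \<delta>'" for Q c \<delta> \<delta>'
    proof -
      obtain P where "mv \<delta> P (c(0 := \<one>)) Q" "mv \<delta>' P (c(0 := s)) Q"
        using pc unfolding piece_def by blast
      then show ?thesis by (simp add: mv_def)
    qed
    then have "fst (snd (t Q)) \<in> \<A> \<and> snd (snd (t Q)) \<in> \<A>" if "Q \<in> \<Q>" for Q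
      using bspec[OF t that] by blast
    then show ?thesis unfolding F_def by (intro Un_least image_subsetI) auto
  qed
  ultimately show ?thesis by (intro exI[of _ F] conjI allI impI ballI) auto
qed

section \<open>Moving labels along words in the generators\<close>

lemma star_good:
  assumes "star \<Gamma> n x s c" "0 < i" "i < n" "0 < j" "j < n" "i \<noteq> j"
  shows "good \<Gamma> x \<one> (c i) (c j)" "good \<Gamma> x s (c i) (c j)"
proof -
  have "good \<Gamma> x ((c(0 := t)) 0) ((c(0 := t)) i) ((c(0 := t)) j)" if "t \<in> {\<one>, s}" for t
    using assms that unfolding star_def by (metis gr0I less_imp_neq less_trans)
  then show "good \<Gamma> x \<one> (c i) (c j)" "good \<Gamma> x s (c i) (c j)" using assms by force+
qed

text \<open>The arms have distinct images, since any two of them occur in a good triple. There are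
  at least seven and at most four images are excluded, so three remain; this fixes the degree
  8.\<close>

lemma star_choose:
  assumes st: "star \<Gamma> n x s c" and n: "8 \<le> n" and E: "finite E" "card E \<le> 4"
  obtains i j k where "0 < i" "i < n" "0 < j" "j < n" "0 < k" "k < n" "i \<noteq> j" "j \<noteq> k" "i \<noteq> k"
    "\<alpha> (c i) x \<notin> E" "\<alpha> (c j) x \<notin> E" "\<alpha> (c k) x \<notin> E"
proof -
  let ?f = "\<lambda>i. \<alpha> (c i) x"
  have "inj_on ?f {0<..<n}"
  proof (rule inj_onI, rule ccontr)
    fix i j assume "i \<in> {0<..<n}" "j \<in> {0<..<n}" "?f i = ?f j" "i \<noteq> j"
    then show False using star_good(1)[OF st, of i j] by (auto simp: good_def)
  qed
  then have "card {i \<in> {0<..<n}. ?f i \<in> E} \<le> card E"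
    using E(1) by (intro card_inj_on_le[of ?f]) (auto simp: inj_on_def)
  moreover have e: "{i \<in> {0<..<n}. ?f i \<notin> E} = {0<..<n} - {i \<in> {0<..<n}. ?f i \<in> E}" by auto
  have "card {i \<in> {0<..<n}. ?f i \<notin> E} = card {0<..<n} - card {i \<in> {0<..<n}. ?f i \<in> E}"
    unfolding e by (rule card_Diff_subset) auto
  ultimately have "3 \<le> card {i \<in> {0<..<n}. ?f i \<notin> E}" using n E(2) by simp
  then obtain T where "T \<subseteq> {i \<in> {0<..<n}. ?f i \<notin> E}" "card T = 3" by (meson obtain_subset_with_card_n)
  then obtain i j k where "i \<noteq> j" "j \<noteq> k" "i \<noteq> k" "{i, j, k} \<subseteq> {i \<in> {0<..<n}. ?f i \<notin> E}"
    unfolding card_3_iff by auto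
  then show ?thesis by (intro that[of i j k]) auto
qed

text \<open>The label to be replaced is always \<open>\<one>\<close>; \<open>good_unshift\<close>
  reduces every other label to this case. The two inequalities are those without which the new
  triple could not be good.\<close>

definition movable :: "('x \<Rightarrow> 'x) set \<Rightarrow> 'g \<Rightarrow> bool" where
  "movable \<Gamma> g \<longleftrightarrow> (\<forall>x\<in>topspace X. \<forall>b c. good \<Gamma> x \<one> b c \<longrightarrow> \<alpha> g x \<noteq> \<alpha> b x \<longrightarrow> \<alpha> g x \<noteq> \<alpha> c x \<longrightarrow>
     good \<Gamma> x g b c)"

lemma movable_one: "movable \<Gamma> \<one>"
  by (simp add: movable_def)

text \<open>The path from \<open>\<one>\<close> to \<open>s\<close> passes through an arm:
  \<open>\<one>\<close> is replaced by \<open>e i\<close>, and \<open>e i\<close> by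
  \<open>s\<close>, using the two versions of the star. A direct step would require a good triple
  containing both \<open>\<one>\<close> and \<open>s\<close>.\<close>

lemma movable_generator:
  assumes \<Gamma>: "function_group \<Gamma>" and n: "8 \<le> n"
    and st: "\<And>x. x \<in> topspace X \<Longrightarrow> \<exists>c. star \<Gamma> n x s c"
  shows "movable \<Gamma> s"
  unfolding movable_def
proof (intro ballI allI impI)
  fix x b c assume x: "x \<in> topspace X" and g: "good \<Gamma> x \<one> b c" and ne: "\<alpha> s x \<noteq> \<alpha> b x" "\<alpha> s x \<noteq> \<alpha> c x"
  obtain e where e: "star \<Gamma> n x s e" using st x by blast
  have "card {\<alpha> b x, \<alpha> c x} \<le> 4" by (simp add: card_insert_if)
  then obtain i j where ij: "0 < i" "i < n" "0 < j" "j < n" "i \<noteq> j"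
    "\<alpha> (e i) x \<notin> {\<alpha> b x, \<alpha> c x}" "\<alpha> (e j) x \<notin> {\<alpha> b x, \<alpha> c x}"
    using star_choose[OF e n, of "{\<alpha> b x, \<alpha> c x}"] by (metis finite.emptyI finite.insertI)
  note s = star_good[OF e ij(1-5)]
  have "good \<Gamma> x (e i) b c" by (rule good_replace[OF \<Gamma> g s(1)]) (use ij in auto)
  moreover have "good \<Gamma> x (e i) s (e j)" using good_swap[OF \<Gamma> good_rotate[OF s(2)]] .
  ultimately show "good \<Gamma> x s b c" by (rule good_replace[OF \<Gamma>]) (use ij ne in auto)
qed

text \<open>The triple of \<open>\<one>\<close> and two arms is moved twice: to \<open>h\<close> at
  \<open>x\<close>, then, seen from the base point \<open>\<alpha> h x\<close> where
  \<open>h\<close> reads as \<open>\<one>\<close>, to \<open>g\<close>; back at \<open>x\<close>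
  this is \<open>g \<otimes> h\<close>. With it the given triple is taken from \<open>\<one>\<close>
  to an arm and on to \<open>g \<otimes> h\<close>.\<close>

lemma movable_mult:
  assumes \<Gamma>: "function_group \<Gamma>" and n: "8 \<le> n"
    and st: "\<And>x. x \<in> topspace X \<Longrightarrow> \<exists>c. star \<Gamma> n x s c"
    and G: "g \<in> carrier G" "h \<in> carrier G" and mv: "movable \<Gamma> g" "movable \<Gamma> h"
  shows "movable \<Gamma> (g \<otimes> h)"
  unfolding movable_def
proof (intro ballI allI impI)
  fix x b c assume x: "x \<in> topspace X" and good: "good \<Gamma> x \<one> b c"
    and ne: "\<alpha> (g \<otimes> h) x \<noteq> \<alpha> b x" "\<alpha> (g \<otimes> h) x \<noteq> \<alpha> c x"
  obtain e where e: "star \<Gamma> n x s e" using st x by blast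
  \<comment> \<open>The arms must stay clear of the two fixed letters and of both positions reached
    by the moving letter; these are the four excluded points behind the count in
    \<open>star_choose\<close>.\<close>
  let ?E = "{\<alpha> b x, \<alpha> c x, \<alpha> h x, \<alpha> (g \<otimes> h) x}"
  have "card ?E \<le> 4" by (simp add: card_insert_if)
  then obtain i j where ij: "0 < i" "i < n" "0 < j" "j < n" "i \<noteq> j" "\<alpha> (e i) x \<notin> ?E" "\<alpha> (e j) x \<notin> ?E"
    using star_choose[OF e n, of ?E] by (metis finite.emptyI finite.insertI)
  have s: "good \<Gamma> x \<one> (e i) (e j)" by (rule star_good[OF e ij(1-5)])
  have eG: "e i \<in> carrier G" "e j \<in> carrier G" using s by (simp_all add: good_def)
  have 1: "good \<Gamma> x (e i) b c" by (rule good_replace[OF \<Gamma> good s]) (use ij in auto)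
  have 2: "good \<Gamma> x h (e i) (e j)" using mv(2) x s ij unfolding movable_def by (metis insertCI)
  have "good \<Gamma> (\<alpha> h x) (h \<otimes> inv h) (e i \<otimes> inv h) (e j \<otimes> inv h)" by (rule good_unshift[OF x G(2) 2])
  then have "good \<Gamma> (\<alpha> h x) \<one> (e i \<otimes> inv h) (e j \<otimes> inv h)" using G by simp
  moreover have "\<alpha> (e k \<otimes> inv h) (\<alpha> h x) = \<alpha> (e k) x" if "k \<in> {i, j}" for k
    using act_quotient[of h "e k" x] G eG x that by blast
  moreover have "\<alpha> g (\<alpha> h x) = \<alpha> (g \<otimes> h) x" using act_mult G x by simp
  ultimately have "good \<Gamma> (\<alpha> h x) g (e i \<otimes> inv h) (e j \<otimes> inv h)"
    using mv(1) act_in[OF G(2) x] ij unfolding movable_def by (metis insertCI)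
  then have "good \<Gamma> x (g \<otimes> h) (e i \<otimes> inv h \<otimes> h) (e j \<otimes> inv h \<otimes> h)" by (rule good_shift[OF x G(2)])
  then have "good \<Gamma> x (g \<otimes> h) (e i) (e j)" using eG G by (simp add: m_assoc)
  then have "good \<Gamma> x (e i) (g \<otimes> h) (e j)" using good_swap[OF \<Gamma> good_rotate] by blast
  with 1 show "good \<Gamma> x (g \<otimes> h) b c" by (rule good_replace[OF \<Gamma>]) (use ij ne in auto)
qed

lemma movable_all:
  assumes \<Gamma>: "function_group \<Gamma>" and n: "8 \<le> n" and S: "S \<subseteq> carrier G" "generate G S = carrier G"
    and st: "\<And>x s. x \<in> topspace X \<Longrightarrow> s \<in> insert \<one> (S \<union> m_inv G ` S) \<Longrightarrow> \<exists>c. star \<Gamma> n x s c"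
    and g: "g \<in> carrier G"
  shows "movable \<Gamma> g"
proof -
  have "movable \<Gamma> g \<and> g \<in> carrier G" if "g \<in> generate G S" for g
    using that
  proof induction
    case (eng g h)
    have "movable \<Gamma> (g \<otimes> h)"
      \<comment> \<open>A product step takes from the star only its arms and the centre
        \<open>\<one>\<close>, so the star for \<open>\<one>\<close> serves.\<close>
      by (rule movable_mult[OF \<Gamma> n, of \<one>]) (use st eng.IH in auto)
    then show ?case using eng.IH by simp
  qed (use movable_one S st in \<open>auto intro!: movable_generator[OF \<Gamma> n]\<close>)
  then show ?thesis using g S by blast
qed

text \<open>Seen from \<open>\<alpha> p x\<close> the label \<open>p\<close> becomes
  \<open>\<one>\<close> and \<open>q\<close> becomes \<open>q \<otimes> inv p\<close>, so movability
  of that quotient applies.\<close>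

lemma good_move:
  assumes all: "\<forall>g\<in>carrier G. movable \<Gamma> g"
    and x: "x \<in> topspace X" and good: "good \<Gamma> x p b c" and q: "q \<in> carrier G"
    and ne: "\<alpha> q x \<noteq> \<alpha> b x" "\<alpha> q x \<noteq> \<alpha> c x"
  shows "good \<Gamma> x q b c"
proof -
  have G: "p \<in> carrier G" "b \<in> carrier G" "c \<in> carrier G" using good by (simp_all add: good_def)
  have "good \<Gamma> (\<alpha> p x) \<one> (b \<otimes> inv p) (c \<otimes> inv p)" using good_unshift[OF x G(1) good] G by simp
  moreover have "movable \<Gamma> (q \<otimes> inv p)" using all q G by simp
  moreover note act_quotient[OF G(1) q x] act_quotient[OF G(1,2) x] act_quotient[OF G(1,3) x] act_in[OF G(1) x]
  ultimately have "good \<Gamma> (\<alpha> p x) (q \<otimes> inv p) (b \<otimes> inv p) (c \<otimes> inv p)"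
    using ne unfolding movable_def by metis
  then have "good \<Gamma> x (q \<otimes> inv p \<otimes> p) (b \<otimes> inv p \<otimes> p) (c \<otimes> inv p \<otimes> p)" by (rule good_shift[OF x G(1)])
  then show ?thesis using G q by (simp add: m_assoc)
qed

text \<open>The entries of the triple of \<open>\<one>\<close> and two arms are replaced in turn by
  \<open>a\<close>, \<open>b\<close>, \<open>c\<close>, rotating so that the next entry stands in
  front. The arms avoid the images of \<open>a\<close>, \<open>b\<close>, \<open>c\<close>, so no
  intermediate triple degenerates.\<close>

lemma good_all:
  assumes \<Gamma>: "function_group \<Gamma>" and n: "8 \<le> n" and all: "\<forall>g\<in>carrier G. movable \<Gamma> g"
    and st: "star \<Gamma> n x \<one> e"
    and x: "x \<in> topspace X" and abc: "{a, b, c} \<subseteq> carrier G" "\<alpha> a x \<noteq> \<alpha> b x" "\<alpha> b x \<noteq> \<alpha> c x" "\<alpha> c x \<noteq> \<alpha> a x"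
  shows "good \<Gamma> x a b c"
proof -
  let ?E = "{\<alpha> a x, \<alpha> b x, \<alpha> c x}"
  have "card ?E \<le> 4" by (simp add: card_insert_if)
  then obtain i j where ij: "0 < i" "i < n" "0 < j" "j < n" "i \<noteq> j" "\<alpha> (e i) x \<notin> ?E" "\<alpha> (e j) x \<notin> ?E"
    using star_choose[OF st n, of ?E] by (metis finite.emptyI finite.insertI)
  have "good \<Gamma> x \<one> (e i) (e j)" by (rule star_good[OF st ij(1-5)])
  then have "good \<Gamma> x a (e i) (e j)" by (rule good_move[OF all x]) (use abc ij in auto)
  then have "good \<Gamma> x (e i) (e j) a" by (rule good_rotate)
  then have "good \<Gamma> x b (e j) a" by (rule good_move[OF all x]) (use abc ij in auto)
  then have "good \<Gamma> x (e j) a b" by (rule good_rotate)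
  then have "good \<Gamma> x c a b" by (rule good_move[OF all x]) (use abc ij in auto)
  then show ?thesis by (rule good_rotate)
qed

text \<open>Compactness returns from germs to sets. The guard \<open>W \<subseteq> V\<close> in the
  inductive property keeps the translates disjoint, as \<open>rot_Un\<close> demands.\<close>

lemma rot_all:
  assumes \<Gamma>: "function_group \<Gamma>"
    and good: "\<And>x a b c. \<lbrakk>x \<in> topspace X; {a, b, c} \<subseteq> carrier G; \<alpha> a x \<noteq> \<alpha> b x; \<alpha> b x \<noteq> \<alpha> c x; \<alpha> c x \<noteq> \<alpha> a x\<rbrakk> \<Longrightarrow>
      good \<Gamma> x a b c"
    and V: "disj3 V a b c"
  shows "rot V a b c \<in> \<Gamma>"
proof -
  have G: "{a, b, c} \<subseteq> carrier G" and cV: "clopen V" using V by (auto simp: disj3_def)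
  have "V \<subseteq> V \<longrightarrow> rot V a b c \<in> \<Gamma>"
  proof (rule clopen_induct[OF cV, where \<Phi> = "\<lambda>W. W \<subseteq> V \<longrightarrow> rot W a b c \<in> \<Gamma>"])
    fix U W assume *: "clopen U" "clopen W" "U \<inter> W = {}" "U \<subseteq> V \<longrightarrow> rot U a b c \<in> \<Gamma>" "W \<subseteq> V \<longrightarrow> rot W a b c \<in> \<Gamma>"
    show "U \<union> W \<subseteq> V \<longrightarrow> rot (U \<union> W) a b c \<in> \<Gamma>"
    proof
      assume "U \<union> W \<subseteq> V"
      then have "rot (U \<union> W) a b c = rot U a b c \<circ> rot W a b c"
        by (intro rot_Un disj3_subset[OF V]) (use * clopen_Un in auto)
      then show "rot (U \<union> W) a b c \<in> \<Gamma>" using function_group_comp[OF \<Gamma>] * \<open>U \<union> W \<subseteq> V\<close> by simp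
    qed
  next
    fix x assume x: "x \<in> V"
    have xT: "x \<in> topspace X" using clopen_subset[OF cV] x by blast
    have "\<alpha> a x \<noteq> \<alpha> b x" "\<alpha> b x \<noteq> \<alpha> c x" "\<alpha> c x \<noteq> \<alpha> a x"
      using disj3_notin[OF V x order_refl] x by (metis imageI)+
    then have "good \<Gamma> x a b c" by (rule good[OF xT G])
    then obtain U where "openin X U" "x \<in> U" "\<forall>W. clopen W \<and> W \<subseteq> U \<longrightarrow> rot W a b c \<in> \<Gamma>"
      by (auto simp: good_def)
    then show "\<exists>U. openin X U \<and> x \<in> U \<and> (\<forall>W. clopen W \<and> W \<subseteq> U \<longrightarrow> W \<subseteq> V \<longrightarrow> rot W a b c \<in> \<Gamma>)"
      by (intro exI[of _ U]) simp
  qed (use function_group_id[OF \<Gamma>] in simp)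
  then show ?thesis by simp
qed

text \<open>The conclusion speaks of every function group containing \<open>F\<close>, so it can be
  applied to the group generated by \<open>F\<close> without describing its elements.\<close>

theorem rot_finitely_generated:
  assumes \<A>: "function_group \<A>" "\<And>V a b c. disj3 V a b c \<Longrightarrow> rot V a b c \<in> \<A>"
    and S: "finite S" "S \<subseteq> carrier G" "generate G S = carrier G"
    and \<E>: "finite \<E>" "\<And>E. E \<in> \<E> \<Longrightarrow> clopen E"
      "\<And>x y. \<lbrakk>x \<in> topspace X; y \<in> topspace X; x \<noteq> y\<rbrakk> \<Longrightarrow> \<exists>g\<in>carrier G. \<exists>E\<in>\<E>. \<alpha> g x \<in> E \<and> \<alpha> g y \<notin> E"
  obtains F where "finite F" "F \<subseteq> \<A>"
    "\<And>\<Gamma> V a b c. function_group \<Gamma> \<Longrightarrow> F \<subseteq> \<Gamma> \<Longrightarrow> disj3 V a b c \<Longrightarrow> rot V a b c \<in> \<Gamma>"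
proof -
  obtain \<P> l where ls: "label_system \<P> l 8" using label_system_exists by blast
  obtain F0 where F0: "finite F0" "F0 \<subseteq> \<A>"
    "\<And>\<Gamma> C. function_group \<Gamma> \<Longrightarrow> F0 \<subseteq> \<Gamma> \<Longrightarrow> clopen C \<Longrightarrow> C \<in> controlled \<Gamma> \<P> l 8"
    by (rule finite_scale[OF \<A> ls _ S \<E>]) auto
  \<comment> \<open>The stars of the generators and their inverses serve
    \<open>movable_generator\<close>; the one for \<open>\<one>\<close> supplies arms to
    \<open>movable_mult\<close> and \<open>good_all\<close>.\<close>
  let ?S = "insert \<one> (S \<union> m_inv G ` S)"
  have "\<forall>s\<in>?S. \<exists>F. finite F \<and> F \<subseteq> \<A> \<and> (\<forall>\<Gamma>. function_group \<Gamma> \<and> F \<subseteq> \<Gamma> \<and>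
    (\<forall>C. clopen C \<longrightarrow> C \<in> controlled \<Gamma> \<P> l 8) \<longrightarrow> (\<forall>x\<in>topspace X. \<exists>c. star \<Gamma> 8 x s c))"
    using S(2) by (intro ballI star_finite_scale[OF \<A> ls]) auto
  from bchoice[OF this] obtain H where H: "\<forall>s\<in>?S. finite (H s) \<and> H s \<subseteq> \<A> \<and> (\<forall>\<Gamma>. function_group \<Gamma> \<and> H s \<subseteq> \<Gamma> \<and>
    (\<forall>C. clopen C \<longrightarrow> C \<in> controlled \<Gamma> \<P> l 8) \<longrightarrow> (\<forall>x\<in>topspace X. \<exists>c. star \<Gamma> 8 x s c))" by (rule exE)
  show ?thesis
  proof (rule that[of "F0 \<union> (\<Union>s\<in>?S. H s)"])
    show "finite (F0 \<union> (\<Union>s\<in>?S. H s))" using F0(1) S(1) H by simp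
    show "F0 \<union> (\<Union>s\<in>?S. H s) \<subseteq> \<A>" using F0(2) H by blast
    fix \<Gamma> V a b c assume \<Gamma>: "function_group \<Gamma>" and F: "F0 \<union> (\<Union>s\<in>?S. H s) \<subseteq> \<Gamma>" and V: "disj3 V a b c"
    have ctrl: "\<forall>C. clopen C \<longrightarrow> C \<in> controlled \<Gamma> \<P> l 8" using F0(3)[OF \<Gamma>] F by simp
    have st: "\<exists>c. star \<Gamma> 8 x s c" if "x \<in> topspace X" "s \<in> ?S" for x s
    proof -
      have "H s \<subseteq> \<Gamma>" using F that(2) by blast
      then show ?thesis using bspec[OF H that(2)] \<Gamma> ctrl that(1) by blast
    qed
    have mv: "\<forall>g\<in>carrier G. movable \<Gamma> g"
      by (intro ballI movable_all[OF \<Gamma> order_refl S(2,3) st])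
    show "rot V a b c \<in> \<Gamma>"
    proof (rule rot_all[OF \<Gamma> _ V])
      fix x a b c assume *: "x \<in> topspace X" "{a, b, c} \<subseteq> carrier G" "\<alpha> a x \<noteq> \<alpha> b x" "\<alpha> b x \<noteq> \<alpha> c x" "\<alpha> c x \<noteq> \<alpha> a x"
      obtain e where "star \<Gamma> 8 x \<one> e" using st[OF *(1)] by blast
      from good_all[OF \<Gamma> order_refl mv this *] show "good \<Gamma> x a b c" .
    qed
  qed
qed

section \<open>Elements of order three with locally constant labels\<close>

definition res :: "('x \<Rightarrow> 'x) \<Rightarrow> 'x set \<Rightarrow> 'x \<Rightarrow> 'x" where
  "res f Y x = (if x \<in> Y then f x else x)"

text \<open>Where the third power of \<open>f\<close> is the identity on \<open>W\<close>, this is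
  the union of the orbits of the points of \<open>W\<close>; it is invariant, so \<open>res\<close>
  can cut out \<open>f\<close> on it.\<close>

definition sat :: "('x \<Rightarrow> 'x) \<Rightarrow> 'x set \<Rightarrow> 'x set" where
  "sat f W = W \<union> f ` W \<union> f ` f ` W"

lemma res_Un:
  assumes "Y \<inter> Z = {}" "\<And>z. z \<in> Z \<Longrightarrow> f z \<in> Z"
  shows "res f (Y \<union> Z) = res f Y \<circ> res f Z"
proof
  fix x
  have "f x \<notin> Y" if "x \<in> Z" using assms that by blast
  then show "res f (Y \<union> Z) x = (res f Y \<circ> res f Z) x" using assms(1) by (auto simp: res_def)
qed

lemma sat_Un: "sat f (U \<union> W) = sat f U \<union> sat f W"
  by (auto simp: sat_def)

lemma disjoint_Un3:
  assumes "A \<inter> B = {}" "B \<inter> C = {}" "C \<inter> A = {}" "A1 \<subseteq> A" "A2 \<subseteq> A" "B1 \<subseteq> B" "B2 \<subseteq> B"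
    "C1 \<subseteq> C" "C2 \<subseteq> C" "A1 \<inter> A2 = {}" "B1 \<inter> B2 = {}" "C1 \<inter> C2 = {}"
  shows "(A1 \<union> B1 \<union> C1) \<inter> (A2 \<union> B2 \<union> C2) = {}"
  using assms by blast

text \<open>Near a point of \<open>V\<close> the map \<open>f\<close> is the cycle with labels
  \<open>\<one>\<close>, \<open>b\<close>, \<open>c\<close>, and \<open>clopen_induct\<close>
  multiplies these local factors. \<open>V\<close> is a fundamental domain for \<open>f\<close> on
  the set it moves, so disjoint parts of \<open>V\<close> have disjoint orbits. This reaches
  elements whose bisections carry several labels.\<close>

lemma cycle_mem:
  assumes \<Gamma>: "function_group \<Gamma>" "\<And>V a b c. disj3 V a b c \<Longrightarrow> rot V a b c \<in> \<Gamma>"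
    and V: "clopen V"
    and dj: "V \<inter> f ` V = {}" "f ` V \<inter> f ` f ` V = {}" "f ` f ` V \<inter> V = {}"
    and cyc: "\<And>v. v \<in> V \<Longrightarrow> f (f (f v)) = v"
    and out: "\<And>x. x \<notin> V \<union> f ` V \<union> f ` f ` V \<Longrightarrow> f x = x"
    and loc: "\<And>v. v \<in> V \<Longrightarrow> \<exists>U b c. openin X U \<and> v \<in> U \<and> b \<in> carrier G \<and> c \<in> carrier G \<and>
        (\<forall>u\<in>U \<inter> V. f u = \<alpha> b u \<and> f (f u) = \<alpha> c u)"
  shows "f \<in> \<Gamma>"
proof -
  have "V \<subseteq> V \<longrightarrow> res f (sat f V) \<in> \<Gamma>"
  proof (rule clopen_induct[OF V, where \<Phi> = "\<lambda>W. W \<subseteq> V \<longrightarrow> res f (sat f W) \<in> \<Gamma>"])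
    show "{} \<subseteq> V \<longrightarrow> res f (sat f {}) \<in> \<Gamma>"
    proof
      have "res f (sat f {}) = id" by (auto simp: res_def sat_def)
      then show "res f (sat f {}) \<in> \<Gamma>" using function_group_id[OF \<Gamma>(1)] by simp
    qed
  next
    fix U W assume *: "clopen U" "clopen W" "U \<inter> W = {}" "U \<subseteq> V \<longrightarrow> res f (sat f U) \<in> \<Gamma>" "W \<subseteq> V \<longrightarrow> res f (sat f W) \<in> \<Gamma>"
    show "U \<union> W \<subseteq> V \<longrightarrow> res f (sat f (U \<union> W)) \<in> \<Gamma>"
    proof
      assume UW: "U \<union> W \<subseteq> V"
      have inv: "f x \<in> sat f W" if "x \<in> sat f W" for x using that UW cyc by (auto simp: sat_def)
      have "sat f U \<inter> sat f W = {}"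
      proof -
        have "f ` U \<inter> f ` W = {}" "f ` f ` U \<inter> f ` f ` W = {}"
        proof -
          have i1: "inj_on f V" by (rule inj_onI) (metis cyc)
          have i2: "inj_on f (f ` V)" using cyc by (intro inj_onI) (metis imageE)
          have "f ` (U \<inter> W) = f ` U \<inter> f ` W" using inj_on_image_Int[OF i1] UW by simp
          moreover have "f ` (f ` U \<inter> f ` W) = f ` f ` U \<inter> f ` f ` W"
            by (rule inj_on_image_Int[OF i2]) (use UW in auto)
          ultimately show "f ` U \<inter> f ` W = {}" "f ` f ` U \<inter> f ` f ` W = {}" using *(3) by auto
        qed
        moreover have "f ` U \<subseteq> f ` V" "f ` W \<subseteq> f ` V" "f ` f ` U \<subseteq> f ` f ` V" "f ` f ` W \<subseteq> f ` f ` V"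
          using UW by auto
        ultimately show ?thesis unfolding sat_def
          by (intro disjoint_Un3[OF dj]) (use *(3) UW in auto)
      qed
      then have "res f (sat f (U \<union> W)) = res f (sat f U) \<circ> res f (sat f W)"
        unfolding sat_Un by (rule res_Un) (rule inv)
      then show "res f (sat f (U \<union> W)) \<in> \<Gamma>" using function_group_comp[OF \<Gamma>(1)] * UW by simp
    qed
  next
    fix v assume v: "v \<in> V"
    obtain U b c where U: "openin X U" "v \<in> U" "b \<in> carrier G" "c \<in> carrier G"
      "\<forall>u\<in>U \<inter> V. f u = \<alpha> b u \<and> f (f u) = \<alpha> c u" using loc[OF v] by metis
    have "res f (sat f W) \<in> \<Gamma>" if W: "clopen W" "W \<subseteq> U" "W \<subseteq> V" for W
    proof -
      have T: "W \<subseteq> topspace X" using clopen_subset W by blast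
      have im: "\<alpha> \<one> ` W = W" "\<alpha> b ` W = f ` W" "\<alpha> c ` W = f ` f ` W"
      proof -
        have u: "w \<in> topspace X" "f w = \<alpha> b w" "f (f w) = \<alpha> c w" if "w \<in> W" for w
          using that W U(5) T by auto
        show "\<alpha> \<one> ` W = W" using image_cong[OF refl, of W "\<alpha> \<one>" id] act_one u(1) by simp
        show "\<alpha> b ` W = f ` W" by (rule image_cong) (simp_all add: u(2))
        show "\<alpha> c ` W = f ` f ` W" unfolding image_image by (rule image_cong) (simp_all add: u(3))
      qed
      have sub: "f ` W \<subseteq> f ` V" "f ` f ` W \<subseteq> f ` f ` V" using W(3) by auto
      have "A1 \<inter> B1 = {}" if "A \<inter> B = {}" "A1 \<subseteq> A" "B1 \<subseteq> B" for A B A1 B1 :: "'x set"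
        using that by blast
      then have d: "disj3 W \<one> b c" unfolding disj3_def im using W U(3,4) dj sub by (metis bot_least empty_subsetI insert_subset one_closed)
      have u: "w \<in> topspace X" "f w = \<alpha> b w" "f (f w) = \<alpha> c w" "f (f (f w)) = w" if "w \<in> W" for w
        using that W U(5) cyc T by auto
      have "res f (sat f W) = rot W \<one> b c"
      proof
        fix x show "res f (sat f W) x = rot W \<one> b c x"
        proof (rule translate_cases[where V=W and x=x and a=\<one> and b=b and c=c])
          fix w assume w: "w \<in> W" "x = \<alpha> \<one> w"
          then show ?thesis using rot_apply(1)[OF d w(1)] u[OF w(1)] by (simp add: res_def sat_def act_one)
        next
          fix w assume w: "w \<in> W" "x = \<alpha> b w"
          have "x \<in> f ` W" using u(2)[OF w(1)] w by (metis imageI)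
          then show ?thesis using rot_apply(2)[OF d w(1)] u[OF w(1)] w by (simp add: res_def sat_def)
        next
          fix w assume w: "w \<in> W" "x = \<alpha> c w"
          have "x \<in> f ` f ` W" "f x = w" using u[OF w(1)] w by (metis imageI)+
          then show ?thesis using rot_apply(3)[OF d w(1)] u[OF w(1)] w by (simp add: res_def sat_def act_one)
        next
          assume "x \<notin> \<alpha> \<one> ` W" "x \<notin> \<alpha> b ` W" "x \<notin> \<alpha> c ` W"
          then show ?thesis using im by (simp add: rot_outside res_def sat_def)
        qed
      qed
      then show ?thesis using \<Gamma>(2)[OF d] by simp
    qed
    then show "\<exists>U. openin X U \<and> v \<in> U \<and> (\<forall>W. clopen W \<and> W \<subseteq> U \<longrightarrow> W \<subseteq> V \<longrightarrow> res f (sat f W) \<in> \<Gamma>)"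
      using U(1,2) by (intro exI[of _ U]) simp
  qed
  moreover have "res f (sat f V) = f"
  proof
    fix x show "res f (sat f V) x = f x"
      using out[of x] by (cases "x \<in> sat f V") (simp_all add: res_def, simp add: sat_def)
  qed
  ultimately show ?thesis by simp
qed

section \<open>The topological full group of the transformation groupoid\<close>

abbreviation gpd :: "('g \<times> 'x) groupoid_data" where
  "gpd \<equiv> transformation_groupoid G X \<alpha>"

lemma gpd_simps [simp]:
  "Arr gpd = prod_topology (discrete_topology (carrier G)) X"
  "src gpd (g, x) = (\<one>, x)" "rng gpd (g, x) = (\<one>, \<alpha> g x)"
  "cmp gpd (g, y) (h, x) = (g \<otimes> h, x)" "ginv gpd (g, x) = (inv g, \<alpha> g x)"
  by (simp_all add: transformation_groupoid_def)

lemma gpd_unit_space: "unit_space gpd = {\<one>} \<times> topspace X"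
  by (force simp: unit_space_def image_iff)

lemma openin_gpd:
  "openin (Arr gpd) B \<longleftrightarrow> B \<subseteq> carrier G \<times> topspace X \<and>
     (\<forall>g x. (g, x) \<in> B \<longrightarrow> (\<exists>U. openin X U \<and> x \<in> U \<and> {g} \<times> U \<subseteq> B))"
proof
  assume B: "openin (Arr gpd) B"
  have "\<exists>U. openin X U \<and> x \<in> U \<and> {g} \<times> U \<subseteq> B" if "(g, x) \<in> B" for g x
  proof -
    have "\<exists>V U. openin (discrete_topology (carrier G)) V \<and> openin X U \<and> g \<in> V \<and> x \<in> U \<and> V \<times> U \<subseteq> B"
      using B that unfolding gpd_simps openin_prod_topology_alt by blast
    then obtain V U where "openin X U" "g \<in> V" "x \<in> U" "V \<times> U \<subseteq> B" by blast
    then show ?thesis by (intro exI[of _ U]) auto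
  qed
  moreover have "B \<subseteq> carrier G \<times> topspace X" using openin_subset[OF B] by simp
  ultimately show "B \<subseteq> carrier G \<times> topspace X \<and>
     (\<forall>g x. (g, x) \<in> B \<longrightarrow> (\<exists>U. openin X U \<and> x \<in> U \<and> {g} \<times> U \<subseteq> B))" by simp
next
  assume *: "B \<subseteq> carrier G \<times> topspace X \<and>
     (\<forall>g x. (g, x) \<in> B \<longrightarrow> (\<exists>U. openin X U \<and> x \<in> U \<and> {g} \<times> U \<subseteq> B))"
  show "openin (Arr gpd) B" unfolding gpd_simps openin_prod_topology_alt
  proof (intro allI impI)
    fix g x assume "(g, x) \<in> B"
    then obtain U where "openin X U" "x \<in> U" "{g} \<times> U \<subseteq> B" "g \<in> carrier G" using * by blast
    then show "\<exists>V U. openin (discrete_topology (carrier G)) V \<and> openin X U \<and> g \<in> V \<and> x \<in> U \<and> V \<times> U \<subseteq> B"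
      by (intro exI[of _ "{g}"] exI[of _ U]) auto
  qed
qed

text \<open>The set of arrows attached to a map: \<open>(g, x)\<close> records that \<open>f\<close>
  agrees with \<open>\<alpha> g\<close> near \<open>x\<close>, not just at \<open>x\<close>. This
  makes the set open and, by effectiveness, \<open>g\<close> unique.\<close>

definition germs :: "('x \<Rightarrow> 'x) \<Rightarrow> ('g \<times> 'x) set" where
  "germs f = {(g, x). g \<in> carrier G \<and> x \<in> topspace X \<and> (\<exists>U. openin X U \<and> x \<in> U \<and> (\<forall>u\<in>U. f u = \<alpha> g u))}"

text \<open>Off the space the functions are pinned to the identity, so equal homeomorphisms are
  equal functions and \<open>id\<close>, composition and inverses are those of
  \<open>function_group\<close>. Continuity comes with the local agreement with some
  \<open>\<alpha> g\<close>.\<close>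

definition full :: "('x \<Rightarrow> 'x) set" where
  "full = {f. bij_betw f (topspace X) (topspace X) \<and> (\<forall>x. x \<notin> topspace X \<longrightarrow> f x = x) \<and>
     (\<forall>x\<in>topspace X. \<exists>g. (g, x) \<in> germs f)}"

lemma germsI: "\<lbrakk>g \<in> carrier G; openin X U; x \<in> U; \<And>u. u \<in> U \<Longrightarrow> f u = \<alpha> g u\<rbrakk> \<Longrightarrow> (g, x) \<in> germs f"
  unfolding germs_def using openin_subset by blast

lemma germsE:
  assumes "(g, x) \<in> germs f"
  obtains U where "g \<in> carrier G" "x \<in> topspace X" "openin X U" "x \<in> U" "\<And>u. u \<in> U \<Longrightarrow> f u = \<alpha> g u"
  using assms unfolding germs_def by blast

lemma germs_apply: "(g, x) \<in> germs f \<Longrightarrow> f x = \<alpha> g x"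
  by (auto elim: germsE)

text \<open>On a common neighbourhood \<open>inv h \<otimes> g\<close> acts trivially, and
  effectiveness makes it the unit. The correspondence between functions and bisections rests on
  this.\<close>

lemma germs_unique:
  assumes "(g, x) \<in> germs f" "(h, x) \<in> germs f"
  shows "g = h"
proof -
  obtain U where U: "g \<in> carrier G" "openin X U" "x \<in> U" "\<And>u. u \<in> U \<Longrightarrow> f u = \<alpha> g u"
    using assms(1) by (metis germsE)
  obtain V where V: "h \<in> carrier G" "openin X V" "x \<in> V" "\<And>u. u \<in> V \<Longrightarrow> f u = \<alpha> h u"
    using assms(2) by (metis germsE)
  have "inv h \<otimes> g = \<one>"
  proof (rule effective)
    show "openin X (U \<inter> V)" using U V by blast
    fix u assume u: "u \<in> U \<inter> V"
    then have uT: "u \<in> topspace X" using U openin_subset by blast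
    have "\<alpha> g u = \<alpha> h u" using U V u by (metis IntE)
    then show "\<alpha> (inv h \<otimes> g) u = u" using act_mult[of "inv h" g u] act_inv[of h u] U V uT by simp
  qed (use U V in auto)
  then show ?thesis using U V by (metis inv_closed inv_equality inv_inv)
qed

lemma full_bij: "f \<in> full \<Longrightarrow> bij_betw f (topspace X) (topspace X)"
  and full_outside: "f \<in> full \<Longrightarrow> x \<notin> topspace X \<Longrightarrow> f x = x"
  and full_germ: "f \<in> full \<Longrightarrow> x \<in> topspace X \<Longrightarrow> \<exists>g. (g, x) \<in> germs f"
  by (auto simp: full_def)

lemma full_in: "f \<in> full \<Longrightarrow> x \<in> topspace X \<Longrightarrow> f x \<in> topspace X"
  using full_bij bij_betwE by blast

lemma germs_comp:
  assumes "(g, h x) \<in> germs f" "(k, x) \<in> germs h"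
  shows "(g \<otimes> k, x) \<in> germs (f \<circ> h)"
proof -
  obtain U where U: "g \<in> carrier G" "openin X U" "h x \<in> U" "\<And>u. u \<in> U \<Longrightarrow> f u = \<alpha> g u"
    using assms(1) by (metis germsE)
  obtain V where V: "k \<in> carrier G" "openin X V" "x \<in> V" "\<And>u. u \<in> V \<Longrightarrow> h u = \<alpha> k u"
    using assms(2) by (metis germsE)
  have VT: "V \<subseteq> topspace X" using V openin_subset by blast
  show ?thesis
  proof (rule germsI[where U = "V \<inter> {y \<in> topspace X. \<alpha> k y \<in> U}"])
    show "openin X (V \<inter> {y \<in> topspace X. \<alpha> k y \<in> U})" using V U act_preimage_open by blast
    show "x \<in> V \<inter> {y \<in> topspace X. \<alpha> k y \<in> U}" using U(3) V(3,4) VT by auto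
    fix u assume "u \<in> V \<inter> {y \<in> topspace X. \<alpha> k y \<in> U}"
    then show "(f \<circ> h) u = \<alpha> (g \<otimes> k) u" using U(4) V(4) act_mult[OF U(1) V(1)] by auto
  qed (use U V in simp)
qed

lemma function_group_full: "function_group full"
  unfolding function_group_def
proof (intro conjI ballI)
  have "(\<one>, x) \<in> germs id" if "x \<in> topspace X" for x
    by (rule germsI[where U="topspace X"]) (use that in \<open>auto simp: act_one\<close>)
  then show "id \<in> full" by (auto simp: full_def)
  fix f assume f: "f \<in> full"
  show "f \<circ> g \<in> full" if g: "g \<in> full" for g
  proof -
    have "\<exists>k. (k, x) \<in> germs (f \<circ> g)" if "x \<in> topspace X" for x
      using full_germ[OF g that] full_germ[OF f full_in[OF g that]] germs_comp by blast
    then show ?thesis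
      using bij_betw_trans[OF full_bij[OF g] full_bij[OF f]] full_outside[OF f] full_outside[OF g]
      by (simp add: full_def)
  qed
  define h where "h y = (if y \<in> topspace X then inv_into (topspace X) f y else y)" for y
  have hf: "h (f x) = x" for x
    using full_bij[OF f] full_outside[OF f, of x] full_in[OF f, of x]
    by (cases "x \<in> topspace X") (auto simp: h_def bij_betw_inv_into_left)
  have fh: "f (h y) = y" for y
    using full_bij[OF f] full_outside[OF f, of y]
    by (cases "y \<in> topspace X") (auto simp: h_def bij_betw_inv_into_right)
  have hT: "h y \<in> topspace X" if "y \<in> topspace X" for y
    using that full_bij[OF f] by (auto simp: h_def bij_betw_def inv_into_into)
  have "bij_betw h (topspace X) (topspace X)"
    by (rule bij_betw_byWitness[where f' = f]) (use hf fh hT full_in[OF f] in auto)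
  moreover have "\<exists>k. (k, y) \<in> germs h" if y: "y \<in> topspace X" for y
  proof -
    obtain g where "(g, h y) \<in> germs f" using full_germ[OF f hT[OF y]] by blast
    then obtain U where U: "g \<in> carrier G" "openin X U" "h y \<in> U" "\<And>u. u \<in> U \<Longrightarrow> f u = \<alpha> g u"
      by (metis germsE)
    have "(inv g, y) \<in> germs h"
    proof (rule germsI[where U = "\<alpha> g ` U"])
      show "openin X (\<alpha> g ` U)" using act_image_open U by blast
      show "y \<in> \<alpha> g ` U" using fh U(3,4) by (metis imageI)
      fix v assume "v \<in> \<alpha> g ` U"
      then obtain u where u: "u \<in> U" "v = \<alpha> g u" by blast
      then have "h v = u" using hf U(4) by metis
      then show "h v = \<alpha> (inv g) v" using act_inv[OF U(1), of u] u openin_subset[OF U(2)] by auto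
    qed (use U in simp)
    then show ?thesis by blast
  qed
  ultimately have "h \<in> full" by (simp add: full_def h_def)
  then show "\<exists>h\<in>full. f \<circ> h = id \<and> h \<circ> f = id"
    using hf fh by (intro bexI[of _ h]) (auto simp: fun_eq_iff)
qed

text \<open>One inclusion composes germs; for the other, \<open>germs_unique\<close> forces the
  label of a composite germ to be the product of the labels.\<close>

lemma germs_set_cmp:
  assumes f: "f \<in> full" and h: "h \<in> full"
  shows "set_cmp gpd (germs f) (germs h) = germs (f \<circ> h)"
proof
  show "set_cmp gpd (germs f) (germs h) \<subseteq> germs (f \<circ> h)"
  proof
    fix z assume "z \<in> set_cmp gpd (germs f) (germs h)"
    then obtain g y k x where *: "(g, y) \<in> germs f" "(k, x) \<in> germs h" "y = \<alpha> k x" "z = (g \<otimes> k, x)"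
      by (auto simp: set_cmp_def)
    then show "z \<in> germs (f \<circ> h)" using germs_comp[of g h x f k] germs_apply[OF *(2)] by simp
  qed
  show "germs (f \<circ> h) \<subseteq> set_cmp gpd (germs f) (germs h)"
  proof (rule subrelI)
    fix m x assume mx: "(m, x) \<in> germs (f \<circ> h)"
    then have x: "x \<in> topspace X" by (elim germsE)
    obtain k where k: "(k, x) \<in> germs h" using full_germ[OF h x] by blast
    obtain g where g: "(g, h x) \<in> germs f" using full_germ[OF f full_in[OF h x]] by blast
    have "m = g \<otimes> k" using germs_unique[OF mx germs_comp[OF g k]] .
    then have "(m, x) = cmp gpd (g, h x) (k, x)" "src gpd (g, h x) = rng gpd (k, x)"
      using germs_apply[OF k] by simp_all
    then show "(m, x) \<in> set_cmp gpd (germs f) (germs h)" unfolding set_cmp_def using g k by blast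
  qed
qed

lemma germs_id: "germs id = unit_space gpd"
proof -
  have 1: "(\<one>, x) \<in> germs id" if "x \<in> topspace X" for x
    by (rule germsI[where U="topspace X"]) (use that in \<open>auto simp: act_one\<close>)
  have "g = \<one> \<and> x \<in> topspace X" if gx: "(g, x) \<in> germs id" for g x
  proof -
    have "x \<in> topspace X" using gx by (elim germsE)
    then show ?thesis using germs_unique[OF gx 1] by blast
  qed
  then show ?thesis unfolding gpd_unit_space using 1 by auto
qed

lemma germs_open: "openin (Arr gpd) (germs f)"
  unfolding openin_gpd
proof (intro conjI allI impI)
  show "germs f \<subseteq> carrier G \<times> topspace X" by (auto simp: germs_def)
  fix g x assume "(g, x) \<in> germs f"
  then obtain U where U: "g \<in> carrier G" "openin X U" "x \<in> U" "\<And>u. u \<in> U \<Longrightarrow> f u = \<alpha> g u" by (metis germsE)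
  then have "{g} \<times> U \<subseteq> germs f" using germsI by blast
  then show "\<exists>U. openin X U \<and> x \<in> U \<and> {g} \<times> U \<subseteq> germs f" using U by blast
qed

text \<open>Over a small clopen \<open>W\<close> the germs form the slice
  \<open>{g} \<times> W\<close>, which is compact; finitely many slices make up everything.\<close>

lemma germs_compact:
  assumes f: "f \<in> full" shows "compactin (Arr gpd) (germs f)"
proof -
  have "compactin (Arr gpd) (germs f \<inter> (UNIV \<times> topspace X))"
  proof (rule clopen_induct[OF clopen_top, where \<Phi> = "\<lambda>W. compactin (Arr gpd) (germs f \<inter> (UNIV \<times> W))"])
    fix x assume x: "x \<in> topspace X"
    obtain g where "(g, x) \<in> germs f" using full_germ[OF f x] by blast
    then obtain U where U: "g \<in> carrier G" "openin X U" "x \<in> U" "\<And>u. u \<in> U \<Longrightarrow> f u = \<alpha> g u" by (metis germsE)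
    have "compactin (Arr gpd) (germs f \<inter> (UNIV \<times> W))" if W: "clopen W" "W \<subseteq> U" for W
    proof -
      have 1: "(g, u) \<in> germs f" if "u \<in> W" for u using germsI[OF U(1,2) _ U(4)] that W by blast
      have "germs f \<inter> (UNIV \<times> W) = {g} \<times> W" using 1 germs_unique by blast
      moreover have "compactin X W" using W(1) compact closedin_compact_space clopen_def by blast
      ultimately show ?thesis using U(1) by (simp add: compactin_Times)
    qed
    then show "\<exists>U. openin X U \<and> x \<in> U \<and> (\<forall>W. clopen W \<and> W \<subseteq> U \<longrightarrow> compactin (Arr gpd) (germs f \<inter> (UNIV \<times> W)))"
      using U(2,3) by blast
  next
    fix U W assume "compactin (Arr gpd) (germs f \<inter> (UNIV \<times> U))" "compactin (Arr gpd) (germs f \<inter> (UNIV \<times> W))"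
    moreover have "germs f \<inter> (UNIV \<times> (U \<union> W)) = germs f \<inter> (UNIV \<times> U) \<union> germs f \<inter> (UNIV \<times> W)" by auto
    ultimately show "compactin (Arr gpd) (germs f \<inter> (UNIV \<times> (U \<union> W)))" using compactin_Un by metis
  qed simp
  moreover have "germs f \<inter> (UNIV \<times> topspace X) = germs f" by (auto simp: germs_def)
  ultimately show ?thesis by simp
qed

abbreviation "FG \<equiv> topological_full_group gpd"

lemma germs_in_FG:
  assumes f: "f \<in> full" shows "germs f \<in> carrier FG"
proof -
  have "inj_on (src gpd) (germs f)"
    by (rule inj_onI) (auto dest: germs_unique)
  moreover have "inj_on (rng gpd) (germs f)"
  proof (rule inj_onI)
    fix p q assume *: "p \<in> germs f" "q \<in> germs f" "rng gpd p = rng gpd q"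
    obtain g x h y where pq: "p = (g, x)" "q = (h, y)" by fastforce
    have xy: "(g, x) \<in> germs f" "(h, y) \<in> germs f" using * pq by auto
    then have "f x = f y" using * pq germs_apply by simp
    moreover have "x \<in> topspace X" "y \<in> topspace X" using xy by (auto elim: germsE)
    ultimately have "x = y" using full_bij[OF f] by (auto simp: bij_betw_def inj_on_def)
    then show "p = q" using xy germs_unique pq by blast
  qed
  moreover have "src gpd ` germs f = unit_space gpd"
  proof
    show "src gpd ` germs f \<subseteq> unit_space gpd" unfolding gpd_unit_space by (auto elim: germsE)
    show "unit_space gpd \<subseteq> src gpd ` germs f"
    proof
      fix z assume "z \<in> unit_space gpd"
      then obtain x where x: "x \<in> topspace X" "z = (\<one>, x)" unfolding gpd_unit_space by blast
      then obtain g where "(g, x) \<in> germs f" using full_germ[OF f] by blast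
      then show "z \<in> src gpd ` germs f" using x(2) by force
    qed
  qed
  moreover have "rng gpd ` germs f = unit_space gpd"
  proof
    show "rng gpd ` germs f \<subseteq> unit_space gpd" unfolding gpd_unit_space
      by (auto elim!: germsE intro: act_in)
    show "unit_space gpd \<subseteq> rng gpd ` germs f"
    proof
      fix z assume "z \<in> unit_space gpd"
      then obtain y where y: "y \<in> topspace X" "z = (\<one>, y)" unfolding gpd_unit_space by blast
      then obtain x where x: "x \<in> topspace X" "f x = y" using full_bij[OF f] by (metis bij_betw_def imageE)
      then obtain g where g: "(g, x) \<in> germs f" using full_germ[OF f] by blast
      then have "rng gpd (g, x) = z" using germs_apply[OF g] x y by simp
      then show "z \<in> rng gpd ` germs f" using g by (metis imageI)
    qed
  qed
  ultimately show ?thesis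
    using germs_open germs_compact[OF f] by (simp add: topological_full_group_def compact_open_bisection_def)
qed

text \<open>Openness of \<open>B\<close> upgrades pointwise agreement to agreement near each point,
  so \<open>B\<close> consists of germs; since each point has only one germ, there are no others. It
  is applied to the elements of the full group and to \<open>gamma\<close>.\<close>

lemma full_of_section:
  assumes B: "openin (Arr gpd) B"
    and fn: "\<And>g h x. (g, x) \<in> B \<Longrightarrow> (h, x) \<in> B \<Longrightarrow> g = h"
    and ex: "\<And>x. x \<in> topspace X \<Longrightarrow> \<exists>g. (g, x) \<in> B"
    and f: "\<And>g x. (g, x) \<in> B \<Longrightarrow> f x = \<alpha> g x" "\<And>x. x \<notin> topspace X \<Longrightarrow> f x = x"
      "bij_betw f (topspace X) (topspace X)"
  shows "f \<in> full" "germs f = B"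
proof -
  have sub: "B \<subseteq> germs f"
  proof (rule subrelI)
    fix g x assume gx: "(g, x) \<in> B"
    then obtain U where U: "openin X U" "x \<in> U" "{g} \<times> U \<subseteq> B" "g \<in> carrier G"
      using B unfolding openin_gpd by blast
    then show "(g, x) \<in> germs f" using f(1) by (intro germsI[where U=U]) auto
  qed
  then show "f \<in> full" using f(2,3) ex unfolding full_def by blast
  have "germs f \<subseteq> B"
  proof (rule subrelI)
    fix g x assume gx: "(g, x) \<in> germs f"
    then have "x \<in> topspace X" by (elim germsE)
    then obtain h where h: "(h, x) \<in> B" using ex by blast
    then have "g = h" using germs_unique[OF gx] sub by blast
    then show "(g, x) \<in> B" using h by simp
  qed
  then show "germs f = B" using sub by blast
qed

text \<open>A bisection with full source and range has exactly one arrow at each point, whose label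
  \<open>THE\<close> reads off; injectivity and surjectivity of \<open>rng\<close> make the
  resulting map a bijection.\<close>

lemma FG_carrier: "carrier FG = germs ` full"
proof
  show "germs ` full \<subseteq> carrier FG" using germs_in_FG by blast
  show "carrier FG \<subseteq> germs ` full"
  proof
    fix B assume "B \<in> carrier FG"
    then have B: "openin (Arr gpd) B" "inj_on (src gpd) B" "inj_on (rng gpd) B"
      "src gpd ` B = unit_space gpd" "rng gpd ` B = unit_space gpd"
      by (simp_all add: topological_full_group_def compact_open_bisection_def)
    have sub: "B \<subseteq> carrier G \<times> topspace X" using openin_subset[OF B(1)] by simp
    have fn: "g = h" if "(g, x) \<in> B" "(h, x) \<in> B" for g h x
      using inj_onD[OF B(2) _ that] by simp
    have ex: "\<exists>g. (g, x) \<in> B" if "x \<in> topspace X" for x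
    proof -
      have "(\<one>, x) \<in> src gpd ` B" using B(4) that gpd_unit_space by simp
      then show ?thesis by auto
    qed
    define f where "f x = (if x \<in> topspace X then \<alpha> (THE g. (g, x) \<in> B) x else x)" for x
    have f: "f x = \<alpha> g x" if "(g, x) \<in> B" for g x
    proof -
      have "(THE g. (g, x) \<in> B) = g" using fn that by blast
      then show ?thesis using that sub by (auto simp: f_def)
    qed
    have bij: "bij_betw f (topspace X) (topspace X)"
      unfolding bij_betw_def
    proof
      show "inj_on f (topspace X)"
      proof (rule inj_onI)
        fix x y assume xy: "x \<in> topspace X" "y \<in> topspace X" "f x = f y"
        obtain g h where gh: "(g, x) \<in> B" "(h, y) \<in> B" using ex xy by blast
        then have "rng gpd (g, x) = rng gpd (h, y)" using f xy by simp
        then show "x = y" using inj_onD[OF B(3) _ gh] by simp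
      qed
      show "f ` topspace X = topspace X"
      proof
        show "f ` topspace X \<subseteq> topspace X"
        proof (rule image_subsetI)
          fix x assume x: "x \<in> topspace X"
          obtain g where "(g, x) \<in> B" using ex[OF x] by blast
          then show "f x \<in> topspace X" using f sub act_in x by auto
        qed
        show "topspace X \<subseteq> f ` topspace X"
        proof
          fix y assume "y \<in> topspace X"
          then have "(\<one>, y) \<in> rng gpd ` B" using B(5) gpd_unit_space by simp
          then obtain g x where "(g, x) \<in> B" "y = \<alpha> g x" by auto
          then show "y \<in> f ` topspace X" using f sub by (metis SigmaE2 imageI subsetD)
        qed
      qed
    qed
    have out: "\<And>x. x \<notin> topspace X \<Longrightarrow> f x = x" by (simp add: f_def)
    have "f \<in> full" "germs f = B"
      by (rule full_of_section[where B=B and f=f]; fact B(1) fn ex f out bij)+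
    then show "B \<in> germs ` full" by blast
  qed
qed

lemma FG_mult: "f \<in> full \<Longrightarrow> h \<in> full \<Longrightarrow> germs f \<otimes>\<^bsub>FG\<^esub> germs h = germs (f \<circ> h)"
  using germs_set_cmp by (simp add: topological_full_group_def)

lemma FG_one: "\<one>\<^bsub>FG\<^esub> = germs id"
  using germs_id by (simp add: topological_full_group_def)

lemma FG_group: "group FG"
proof (rule groupI)
  note fg = function_group_full
  show "\<one>\<^bsub>FG\<^esub> \<in> carrier FG" using FG_one FG_carrier function_group_id[OF fg] by simp
  fix A assume "A \<in> carrier FG"
  then obtain f where f: "f \<in> full" "A = germs f" using FG_carrier by blast
  show "\<one>\<^bsub>FG\<^esub> \<otimes>\<^bsub>FG\<^esub> A = A" using f FG_one FG_mult[OF function_group_id[OF fg] f(1)] by simp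
  obtain h where h: "h \<in> full" "h \<circ> f = id" using fg f(1) unfolding function_group_def by blast
  then show "\<exists>B\<in>carrier FG. B \<otimes>\<^bsub>FG\<^esub> A = \<one>\<^bsub>FG\<^esub>"
    using FG_mult[OF h(1) f(1)] f FG_one FG_carrier by (intro bexI[of _ "germs h"]) auto
  fix B assume "B \<in> carrier FG"
  then obtain g where g: "g \<in> full" "B = germs g" using FG_carrier by blast
  have fg': "f \<circ> g \<in> full" by (rule function_group_comp[OF fg f(1) g(1)])
  then show "A \<otimes>\<^bsub>FG\<^esub> B \<in> carrier FG" using FG_mult[OF f(1) g(1)] f g FG_carrier by simp
  fix C assume "C \<in> carrier FG"
  then obtain k where k: "k \<in> full" "C = germs k" using FG_carrier by blast
  have gk: "g \<circ> k \<in> full" by (rule function_group_comp[OF fg g(1) k(1)])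
  show "A \<otimes>\<^bsub>FG\<^esub> B \<otimes>\<^bsub>FG\<^esub> C = A \<otimes>\<^bsub>FG\<^esub> (B \<otimes>\<^bsub>FG\<^esub> C)"
    unfolding f(2) g(2) k(2) FG_mult[OF f(1) g(1)] FG_mult[OF g(1) k(1)] FG_mult[OF fg' k(1)] FG_mult[OF f(1) gk]
    by (simp only: comp_assoc)
qed

lemma FG_inv:
  assumes "f \<in> full" "h \<in> full" "h \<circ> f = id"
  shows "inv\<^bsub>FG\<^esub> (germs f) = germs h"
  by (rule group.inv_equality[OF FG_group]) (use assms FG_mult FG_one FG_carrier in auto)

text \<open>The dictionary between subgroups of the full group and groups of functions, through
  which the result on 3-cycles becomes one about \<open>generate\<close>.\<close>

lemma function_group_germs_subgroup:
  assumes K: "subgroup K FG"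
  shows "function_group {f \<in> full. germs f \<in> K}"
  unfolding function_group_def
proof (intro conjI ballI)
  note fg = function_group_full
  show "id \<in> {f \<in> full. germs f \<in> K}" using function_group_id[OF fg] subgroup.one_closed[OF K] FG_one by simp
  fix f assume f: "f \<in> {f \<in> full. germs f \<in> K}"
  show "f \<circ> g \<in> {f \<in> full. germs f \<in> K}" if "g \<in> {f \<in> full. germs f \<in> K}" for g
    using function_group_comp[OF fg, of f g] subgroup.m_closed[OF K, of "germs f" "germs g"] FG_mult f that by simp
  obtain h where h: "h \<in> full" "f \<circ> h = id" "h \<circ> f = id" using fg f unfolding function_group_def by blast
  then have "germs h \<in> K" using FG_inv[of f h] subgroup.m_inv_closed[OF K, of "germs f"] f by simp
  then show "\<exists>h\<in>{f \<in> full. germs f \<in> K}. f \<circ> h = id \<and> h \<circ> f = id" using h by blast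
qed

section \<open>The alternating full group\<close>

abbreviation bdom :: "('g \<times> 'x) set \<Rightarrow> 'x set" where "bdom B \<equiv> snd ` B"

text \<open>Together with \<open>bdom\<close>, source and range as sets of points of the space;
  \<open>src\<close> and \<open>rng\<close> give the units \<open>(\<one>, x)\<close>
  instead.\<close>

definition bran :: "('g \<times> 'x) set \<Rightarrow> 'x set" where "bran B = (\<lambda>(g, x). \<alpha> g x) ` B"

lemma bdomI: "(g, x) \<in> B \<Longrightarrow> x \<in> bdom B" and branI: "(g, x) \<in> B \<Longrightarrow> \<alpha> g x \<in> bran B"
  by (force simp: bran_def)+

lemma bdomE: "x \<in> bdom B \<Longrightarrow> (\<And>g. (g, x) \<in> B \<Longrightarrow> thesis) \<Longrightarrow> thesis"
  and branE: "y \<in> bran B \<Longrightarrow> (\<And>g x. (g, x) \<in> B \<Longrightarrow> y = \<alpha> g x \<Longrightarrow> thesis) \<Longrightarrow> thesis"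
  by (auto simp: bran_def)

lemma src_image: "src gpd ` B = Pair \<one> ` bdom B" and rng_image: "rng gpd ` B = Pair \<one> ` bran B"
  unfolding bran_def image_image by (rule image_cong; auto)+

lemma continuous_map_evaluate:
  "continuous_map (Arr gpd) X (\<lambda>(g, x). \<alpha> g x)"
  unfolding continuous_map_def
proof (intro conjI allI impI)
  show "(\<lambda>(g, x). \<alpha> g x) \<in> topspace (Arr gpd) \<rightarrow> topspace X" using act_in by auto
  fix U assume U: "openin X U"
  show "openin (Arr gpd) {p \<in> topspace (Arr gpd). (case p of (g, x) \<Rightarrow> \<alpha> g x) \<in> U}"
    unfolding openin_gpd
  proof (intro conjI allI impI)
    fix g x assume "(g, x) \<in> {p \<in> topspace (Arr gpd). (case p of (g, x) \<Rightarrow> \<alpha> g x) \<in> U}"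
    then have gx: "g \<in> carrier G" "x \<in> topspace X" "\<alpha> g x \<in> U" by auto
    then show "\<exists>V. openin X V \<and> x \<in> V \<and> {g} \<times> V \<subseteq> {p \<in> topspace (Arr gpd). (case p of (g, x) \<Rightarrow> \<alpha> g x) \<in> U}"
      using act_preimage_open[OF gx(1) U] by (intro exI[of _ "{x \<in> topspace X. \<alpha> g x \<in> U}"]) auto
  qed auto
qed

lemma bisection_subset: "compact_open_bisection gpd B \<Longrightarrow> B \<subseteq> carrier G \<times> topspace X"
  unfolding compact_open_bisection_def openin_gpd by blast

lemma bisection_open:
  assumes "compact_open_bisection gpd B" "(g, x) \<in> B"
  obtains U where "openin X U" "x \<in> U" "\<And>u. u \<in> U \<Longrightarrow> (g, u) \<in> B"
proof -
  have "openin (Arr gpd) B" using assms(1) unfolding compact_open_bisection_def by (rule conjunct1)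
  from openin_gpd[THEN iffD1, OF this, THEN conjunct2, rule_format, OF assms(2)]
  obtain U where U: "openin X U \<and> x \<in> U \<and> {g} \<times> U \<subseteq> B" by (rule exE)
  then have "(g, u) \<in> B" if "u \<in> U" for u using that by (meson SigmaI insertI1 subsetD)
  with U show ?thesis by (intro that[of U]) simp_all
qed

lemma bisection_dom_unique: "compact_open_bisection gpd B \<Longrightarrow> (g, x) \<in> B \<Longrightarrow> (h, x) \<in> B \<Longrightarrow> g = h"
  unfolding compact_open_bisection_def by (auto dest: inj_onD[where x="(g, x)" and y="(h, x)"])

lemma bisection_ran_unique:
  "compact_open_bisection gpd B \<Longrightarrow> (g, x) \<in> B \<Longrightarrow> (h, y) \<in> B \<Longrightarrow> \<alpha> g x = \<alpha> h y \<Longrightarrow> g = h \<and> x = y"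
  unfolding compact_open_bisection_def by (auto dest: inj_onD[where x="(g, x)" and y="(h, y)" and f="rng gpd"])

text \<open>Open slice by slice, and closed as a compact image in a Hausdorff space.\<close>

lemma bisection_dom_clopen:
  assumes "compact_open_bisection gpd B" shows "clopen (bdom B)"
  unfolding clopen_def
proof
  show "openin X (bdom B)"
  proof (subst openin_subopen, intro ballI)
    fix x assume "x \<in> bdom B"
    then obtain g where g: "(g, x) \<in> B" by (metis bdomE)
    obtain U where "openin X U" "x \<in> U" "\<And>u. u \<in> U \<Longrightarrow> (g, u) \<in> B" using bisection_open[OF assms g] by metis
    then show "\<exists>U. openin X U \<and> x \<in> U \<and> U \<subseteq> bdom B"
      by (intro exI[of _ U] conjI subsetI) (auto intro: bdomI)
  qed
  have "compactin X (snd ` B)"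
    by (rule image_compactin[of "Arr gpd"]) (use assms in \<open>auto simp: compact_open_bisection_def continuous_map_snd\<close>)
  then show "closedin X (bdom B)" by (rule compactin_imp_closedin[OF hausdorff])
qed

lemma bisection_ran_closed:
  assumes "compact_open_bisection gpd B" shows "closedin X (bran B)"
proof -
  have "compactin X (bran B)" unfolding bran_def
    by (rule image_compactin[OF _ continuous_map_evaluate]) (use assms in \<open>simp add: compact_open_bisection_def\<close>)
  then show ?thesis by (rule compactin_imp_closedin[OF hausdorff])
qed

lemma admissibleD:
  assumes "gamma_admissible gpd B1 B2"
  shows "compact_open_bisection gpd B1" "compact_open_bisection gpd B2" "bran B1 = bdom B2"
    "bdom B1 \<inter> bdom B2 = {}" "bdom B1 \<inter> bran B2 = {}" "bdom B2 \<inter> bran B2 = {}"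
proof -
  have inj: "inj (Pair \<one> :: 'x \<Rightarrow> 'g \<times> 'x)" by (simp add: inj_def)
  have "compact_open_bisection gpd B1 \<and> compact_open_bisection gpd B2 \<and>
    Pair \<one> ` bran B1 = Pair \<one> ` bdom B2 \<and> Pair \<one> ` bdom B1 \<inter> Pair \<one> ` bran B1 = {} \<and>
    Pair \<one> ` bdom B1 \<inter> Pair \<one> ` bran B2 = {} \<and> Pair \<one> ` bran B1 \<inter> Pair \<one> ` bran B2 = {}"
    using assms unfolding gamma_admissible_def src_image rng_image .
  note * = this[THEN conjunct1] this[THEN conjunct2, THEN conjunct1]
    this[THEN conjunct2, THEN conjunct2, THEN conjunct1]
    this[THEN conjunct2, THEN conjunct2, THEN conjunct2, THEN conjunct1]
    this[THEN conjunct2, THEN conjunct2, THEN conjunct2, THEN conjunct2, THEN conjunct1]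
    this[THEN conjunct2, THEN conjunct2, THEN conjunct2, THEN conjunct2, THEN conjunct2]
  show r: "bran B1 = bdom B2" using *(3) inj_image_eq_iff[OF inj] by blast
  show "bdom B1 \<inter> bdom B2 = {}" "bdom B1 \<inter> bran B2 = {}" "bdom B2 \<inter> bran B2 = {}"
    using *(4-6) r by (simp_all add: image_Int[OF inj, symmetric])
qed (use assms in \<open>simp_all add: gamma_admissible_def\<close>)

text \<open>The third alternative is an arrow of the inverse of the product of \<open>B2\<close> and
  \<open>B1\<close>: on the path \<open>v\<close>, \<open>\<alpha> h v\<close>,
  \<open>\<alpha> (k \<otimes> h) v\<close> it leads from the end back to the beginning.\<close>

lemma gamma_iff:
  assumes adm: "gamma_admissible gpd B1 B2"
  shows "(g, x) \<in> gamma gpd B1 B2 \<longleftrightarrow> (g, x) \<in> B1 \<or> (g, x) \<in> B2 \<or>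
    (\<exists>h k v. (h, v) \<in> B1 \<and> (k, \<alpha> h v) \<in> B2 \<and> g = inv (k \<otimes> h) \<and> x = \<alpha> (k \<otimes> h) v) \<or>
    (g = \<one> \<and> x \<in> topspace X \<and> x \<notin> bdom B1 \<and> x \<notin> bdom B2 \<and> x \<notin> bran B2)"
proof -
  have "(g, x) \<in> ginv gpd ` set_cmp gpd B2 B1 \<longleftrightarrow>
    (\<exists>h k v. (h, v) \<in> B1 \<and> (k, \<alpha> h v) \<in> B2 \<and> g = inv (k \<otimes> h) \<and> x = \<alpha> (k \<otimes> h) v)"
  proof
    assume "(g, x) \<in> ginv gpd ` set_cmp gpd B2 B1"
    then obtain k y h v where "(k, y) \<in> B2" "(h, v) \<in> B1" "src gpd (k, y) = rng gpd (h, v)"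
      "(g, x) = ginv gpd (cmp gpd (k, y) (h, v))" unfolding set_cmp_def by auto
    then show "\<exists>h k v. (h, v) \<in> B1 \<and> (k, \<alpha> h v) \<in> B2 \<and> g = inv (k \<otimes> h) \<and> x = \<alpha> (k \<otimes> h) v"
      by (intro exI[of _ h] exI[of _ k] exI[of _ v]) auto
  next
    assume "\<exists>h k v. (h, v) \<in> B1 \<and> (k, \<alpha> h v) \<in> B2 \<and> g = inv (k \<otimes> h) \<and> x = \<alpha> (k \<otimes> h) v"
    then obtain h k v where *: "(h, v) \<in> B1" "(k, \<alpha> h v) \<in> B2" "g = inv (k \<otimes> h)" "x = \<alpha> (k \<otimes> h) v" by metis
    then have "cmp gpd (k, \<alpha> h v) (h, v) \<in> set_cmp gpd B2 B1" unfolding set_cmp_def by auto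
    then have "ginv gpd (cmp gpd (k, \<alpha> h v) (h, v)) \<in> ginv gpd ` set_cmp gpd B2 B1" by (rule imageI)
    then show "(g, x) \<in> ginv gpd ` set_cmp gpd B2 B1" using * by simp
  qed
  moreover have "(g, x) \<in> unit_space gpd - (src gpd ` B1 \<union> src gpd ` B2 \<union> rng gpd ` B2) \<longleftrightarrow>
    g = \<one> \<and> x \<in> topspace X \<and> x \<notin> bdom B1 \<and> x \<notin> bdom B2 \<and> x \<notin> bran B2"
    unfolding gpd_unit_space src_image rng_image by auto
  ultimately show ?thesis unfolding gamma_def by (simp only: Un_iff disj_assoc)
qed

lemma gamma_open:
  assumes adm: "gamma_admissible gpd B1 B2"
  shows "openin (Arr gpd) (gamma gpd B1 B2)"
proof -
  note A = admissibleD[OF adm] and iff = gamma_iff[OF adm]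
  have sub: "B1 \<subseteq> carrier G \<times> topspace X" "B2 \<subseteq> carrier G \<times> topspace X" using bisection_subset A by auto
  show ?thesis unfolding openin_gpd
  proof (intro conjI allI impI)
    show "gamma gpd B1 B2 \<subseteq> carrier G \<times> topspace X"
    proof (rule subrelI)
      fix g x assume "(g, x) \<in> gamma gpd B1 B2"
      then show "(g, x) \<in> carrier G \<times> topspace X"
        unfolding iff using sub by (auto intro!: act_in)
    qed
    fix g x assume "(g, x) \<in> gamma gpd B1 B2"
    then consider "(g, x) \<in> B1" | "(g, x) \<in> B2"
      | h k v where "(h, v) \<in> B1" "(k, \<alpha> h v) \<in> B2" "g = inv (k \<otimes> h)" "x = \<alpha> (k \<otimes> h) v"
      | "g = \<one>" "x \<in> topspace X" "x \<notin> bdom B1" "x \<notin> bdom B2" "x \<notin> bran B2" unfolding iff by metis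
    then show "\<exists>U. openin X U \<and> x \<in> U \<and> {g} \<times> U \<subseteq> gamma gpd B1 B2"
    proof cases
      case 1
      obtain U where "openin X U" "x \<in> U" "\<And>u. u \<in> U \<Longrightarrow> (g, u) \<in> B1" using bisection_open[OF A(1) 1] by metis
      then show ?thesis by (intro exI[of _ U]) (auto simp: iff)
    next
      case 2
      obtain U where "openin X U" "x \<in> U" "\<And>u. u \<in> U \<Longrightarrow> (g, u) \<in> B2" using bisection_open[OF A(2) 2] by metis
      then show ?thesis by (intro exI[of _ U]) (auto simp: iff)
    next
      case 3
      have G: "h \<in> carrier G" "k \<in> carrier G" "v \<in> topspace X" using sub 3 by auto
      obtain U1 where U1: "openin X U1" "v \<in> U1" "\<And>u. u \<in> U1 \<Longrightarrow> (h, u) \<in> B1"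
        using bisection_open[OF A(1) 3(1)] by metis
      obtain U2 where U2: "openin X U2" "\<alpha> h v \<in> U2" "\<And>u. u \<in> U2 \<Longrightarrow> (k, u) \<in> B2"
        using bisection_open[OF A(2) 3(2)] by metis
      let ?U = "U1 \<inter> {u \<in> topspace X. \<alpha> h u \<in> U2}"
      have "openin X ?U" using act_preimage_open[OF G(1) U2(1)] U1(1) by blast
      then have "openin X (\<alpha> (k \<otimes> h) ` ?U)" using act_image_open G by simp
      moreover have "x \<in> \<alpha> (k \<otimes> h) ` ?U" unfolding 3(4) using G U1 U2 by (intro imageI) simp
      moreover have "{g} \<times> \<alpha> (k \<otimes> h) ` ?U \<subseteq> gamma gpd B1 B2"
      proof (rule subrelI)
        fix g' y assume "(g', y) \<in> {g} \<times> \<alpha> (k \<otimes> h) ` ?U"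
        then obtain u where "g' = g" "u \<in> ?U" "y = \<alpha> (k \<otimes> h) u" by auto
        then have "(h, u) \<in> B1 \<and> (k, \<alpha> h u) \<in> B2 \<and> g' = inv (k \<otimes> h) \<and> y = \<alpha> (k \<otimes> h) u"
          using U1 U2 3 by simp
        then show "(g', y) \<in> gamma gpd B1 B2" unfolding iff by metis
      qed
      ultimately show ?thesis by (intro exI[of _ "\<alpha> (k \<otimes> h) ` ?U"]) simp
    next
      case 4
      let ?U = "topspace X - (bdom B1 \<union> bdom B2 \<union> bran B2)"
      have "closedin X (bdom B1 \<union> bdom B2 \<union> bran B2)"
        using bisection_dom_clopen[OF A(1)] bisection_dom_clopen[OF A(2)] bisection_ran_closed[OF A(2)]
        unfolding clopen_def by (intro closedin_Un) auto
      then have "openin X ?U" by blast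
      then show ?thesis using 4 by (intro exI[of _ ?U]) (auto simp: iff)
    qed
  qed
qed

text \<open>The two domains, the range of \<open>B2\<close> and the complement of these three sets
  are disjoint, and each carries one kind of arrow, so every point has exactly one arrow in
  \<open>gamma\<close>. The map read off from the arrows satisfies \<open>f (f (f x)) = x\<close>,
  which also shows that it is a bijection with inverse its square.\<close>

lemma gamma_full:
  assumes adm: "gamma_admissible gpd B1 B2"
  obtains f where "f \<in> full" "germs f = gamma gpd B1 B2"
    "\<And>h v. (h, v) \<in> B1 \<Longrightarrow> f v = \<alpha> h v" "\<And>h v. (h, v) \<in> B2 \<Longrightarrow> f v = \<alpha> h v"
    "\<And>v. v \<in> bdom B1 \<Longrightarrow> f (f (f v)) = v"
    "\<And>x. x \<notin> bdom B1 \<union> bdom B2 \<union> bran B2 \<Longrightarrow> f x = x"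
proof -
  note A = admissibleD[OF adm] and iff = gamma_iff[OF adm]
  have sub: "B1 \<subseteq> carrier G \<times> topspace X" "B2 \<subseteq> carrier G \<times> topspace X" using bisection_subset A by auto
  let ?\<gamma> = "gamma gpd B1 B2"
  have op: "openin (Arr gpd) ?\<gamma>" by (rule gamma_open[OF adm])
  have \<gamma>sub: "?\<gamma> \<subseteq> carrier G \<times> topspace X" using openin_subset[OF op] by simp
  define Third where "Third g x \<longleftrightarrow> (\<exists>h k v. (h, v) \<in> B1 \<and> (k, \<alpha> h v) \<in> B2 \<and> g = inv (k \<otimes> h) \<and> x = \<alpha> (k \<otimes> h) v)" for g x
  have act2: "\<alpha> (k \<otimes> h) v = \<alpha> k (\<alpha> h v)" if "(h, v) \<in> B1" "(k, \<alpha> h v) \<in> B2" for h k v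
    using that sub act_mult by blast
  have third_ran: "x \<in> bran B2" if "Third g x" for g x
    using that branI[of _ _ B2] act2 unfolding Third_def by metis
  have third_unique: "g = g'" if t: "Third g x" "Third g' x" for g g' x
  proof -
    obtain h k v where 1: "(h, v) \<in> B1" "(k, \<alpha> h v) \<in> B2" "g = inv (k \<otimes> h)" "x = \<alpha> (k \<otimes> h) v"
      using t(1) unfolding Third_def by metis
    obtain h' k' v' where 2: "(h', v') \<in> B1" "(k', \<alpha> h' v') \<in> B2" "g' = inv (k' \<otimes> h')" "x = \<alpha> (k' \<otimes> h') v'"
      using t(2) unfolding Third_def by metis
    have "\<alpha> k (\<alpha> h v) = \<alpha> k' (\<alpha> h' v')" using 1 2 act2 by metis
    then have "k = k'" "\<alpha> h v = \<alpha> h' v'" using bisection_ran_unique[OF A(2) 1(2) 2(2)] by auto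
    moreover have "h = h'" using bisection_ran_unique[OF A(1) 1(1) 2(1)] \<open>\<alpha> h v = \<alpha> h' v'\<close> by auto
    ultimately show ?thesis using 1 2 by simp
  qed
  have third_ex: "\<exists>g. Third g x" if xr: "x \<in> bran B2" for x
  proof -
    obtain k y where k: "(k, y) \<in> B2" "x = \<alpha> k y" using branE[OF xr] by metis
    then have "y \<in> bran B1" using A(3) bdomI by auto
    then obtain h v where "(h, v) \<in> B1" "y = \<alpha> h v" by (metis branE)
    then show ?thesis unfolding Third_def using k act2 by metis
  qed
  have iff': "(g, x) \<in> ?\<gamma> \<longleftrightarrow> (g, x) \<in> B1 \<or> (g, x) \<in> B2 \<or> Third g x \<or>
    (g = \<one> \<and> x \<in> topspace X \<and> x \<notin> bdom B1 \<and> x \<notin> bdom B2 \<and> x \<notin> bran B2)" for g x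
    unfolding Third_def by (rule iff)
  have fn: "g = h" if gh: "(g, x) \<in> ?\<gamma>" "(h, x) \<in> ?\<gamma>" for g h x
  proof -
    consider "x \<in> bdom B1" | "x \<in> bdom B2" | "x \<in> bran B2" | "x \<notin> bdom B1" "x \<notin> bdom B2" "x \<notin> bran B2" by blast
    then show ?thesis
    proof cases
      case 1
      then have "x \<notin> bdom B2" "x \<notin> bran B2" using A by auto
      then have "(g, x) \<in> B1" "(h, x) \<in> B1" using gh 1 iff' third_ran bdomI by metis+
      then show ?thesis by (rule bisection_dom_unique[OF A(1)])
    next
      case 2
      then have "x \<notin> bdom B1" "x \<notin> bran B2" using A by auto
      then have "(g, x) \<in> B2" "(h, x) \<in> B2" using gh 2 iff' third_ran bdomI by metis+
      then show ?thesis by (rule bisection_dom_unique[OF A(2)])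
    next
      case 3
      then have "x \<notin> bdom B1" "x \<notin> bdom B2" using A by auto
      then have "Third g x" "Third h x" using gh 3 iff' bdomI by metis+
      then show ?thesis by (rule third_unique)
    next
      case 4
      then have "g = \<one>" "h = \<one>" using gh iff' third_ran bdomI by metis+
      then show ?thesis by simp
    qed
  qed
  have ex: "\<exists>g. (g, x) \<in> ?\<gamma>" if "x \<in> topspace X" for x
  proof (cases "x \<in> bdom B1 \<or> x \<in> bdom B2 \<or> x \<in> bran B2")
    case True
    then show ?thesis using third_ex iff' by (metis bdomE)
  next
    case False
    then have "(\<one>, x) \<in> ?\<gamma>" using iff'[of \<one> x] that by simp
    then show ?thesis by blast
  qed
  define f where "f x = (if x \<in> topspace X then \<alpha> (THE g. (g, x) \<in> ?\<gamma>) x else x)" for x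
  have f: "f x = \<alpha> g x" if "(g, x) \<in> ?\<gamma>" for g x
  proof -
    have "(THE g. (g, x) \<in> ?\<gamma>) = g" using fn that by blast
    then show ?thesis using that \<gamma>sub by (auto simp: f_def)
  qed
  have out: "\<And>x. x \<notin> topspace X \<Longrightarrow> f x = x" by (simp add: f_def)
  have f1: "f v = \<alpha> h v" if "(h, v) \<in> B1" for h v using f that iff' by blast
  have f2: "f v = \<alpha> h v" if "(h, v) \<in> B2" for h v using f that iff' by blast
  have f3: "f (f (f v)) = v" if hv: "(h, v) \<in> B1" for h v
  proof -
    have "\<alpha> h v \<in> bdom B2" using A(3) branI[OF hv] by simp
    then obtain k where k: "(k, \<alpha> h v) \<in> B2" by (metis bdomE)
    have G: "h \<in> carrier G" "k \<in> carrier G" "v \<in> topspace X" using hv k sub by auto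
    have "Third (inv (k \<otimes> h)) (\<alpha> (k \<otimes> h) v)" unfolding Third_def using hv k by metis
    then have "f (\<alpha> (k \<otimes> h) v) = \<alpha> (inv (k \<otimes> h)) (\<alpha> (k \<otimes> h) v)" using f iff' by blast
    then show ?thesis using f1[OF hv] f2[OF k] act2[OF hv k] act_inv[of "k \<otimes> h" v] G by simp
  qed
  have f4: "f x = x" if "x \<notin> bdom B1 \<union> bdom B2 \<union> bran B2" for x
  proof (cases "x \<in> topspace X")
    case True
    then have "(\<one>, x) \<in> ?\<gamma>" using that iff'[of \<one> x] by simp
    then show ?thesis using f act_one True by metis
  qed (use out in simp)
  have f3': "f (f (f v)) = v" if "v \<in> bdom B1" for v using f3 bdomE[OF that] by metis
  \<comment> \<open>Points of \<open>bdom B2\<close> and \<open>bran B2\<close> are images under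
    \<open>f\<close> and its square of points of \<open>bdom B1\<close>, so the cyclic relation
    carries over from there.\<close>
  have fff: "f (f (f x)) = x" for x
  proof -
    have d2: "\<exists>v\<in>bdom B1. y = f v" if "y \<in> bdom B2" for y
    proof -
      have "y \<in> bran B1" using A(3) that by simp
      then show ?thesis using f1 bdomI branE by metis
    qed
    have r2: "\<exists>y\<in>bdom B2. x = f y" if "x \<in> bran B2" for x
      using that f2 bdomI branE by metis
    consider "x \<in> bdom B1" | "x \<in> bdom B2" | "x \<in> bran B2" | "x \<notin> bdom B1 \<union> bdom B2 \<union> bran B2" by blast
    then show ?thesis
    proof cases
      case 1 then show ?thesis by (rule f3')
    next
      case 2 then show ?thesis using d2 f3' by metis
    next
      case 3 then show ?thesis using d2 r2 f3' by metis
    next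
      case 4 then show ?thesis using f4 by simp
    qed
  qed
  have fT: "f x \<in> topspace X" if x: "x \<in> topspace X" for x
  proof -
    obtain g where g: "(g, x) \<in> ?\<gamma>" using ex[OF x] by blast
    then have "g \<in> carrier G" using \<gamma>sub by blast
    then show ?thesis using f[OF g] act_in x by simp
  qed
  have bij: "bij_betw f (topspace X) (topspace X)"
    by (rule bij_betw_byWitness[where f' = "\<lambda>x. f (f x)"]) (use fff fT in auto)
  have "f \<in> full" "germs f = ?\<gamma>"
    by (rule full_of_section[where B="?\<gamma>" and f=f]; fact op fn ex f out bij)+
  then show ?thesis using that f1 f2 f3' f4 by blast
qed

text \<open>\<open>B1\<close> and \<open>B2\<close> may carry many labels, but near \<open>v\<close>
  only the arrow \<open>h\<close> at \<open>v\<close> and the arrow \<open>k\<close> at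
  \<open>\<alpha> h v\<close> matter; the local labels for \<open>cycle_mem\<close> are then
  \<open>h\<close> and \<open>k \<otimes> h\<close>.\<close>

lemma gamma_mem:
  assumes \<Gamma>: "function_group \<Gamma>" "\<And>V a b c. disj3 V a b c \<Longrightarrow> rot V a b c \<in> \<Gamma>"
    and adm: "gamma_admissible gpd B1 B2"
  shows "\<exists>f\<in>\<Gamma>. f \<in> full \<and> germs f = gamma gpd B1 B2"
proof -
  note A = admissibleD[OF adm]
  have sub: "B1 \<subseteq> carrier G \<times> topspace X" "B2 \<subseteq> carrier G \<times> topspace X" using bisection_subset A by auto
  obtain f where f: "f \<in> full" "germs f = gamma gpd B1 B2"
    "\<And>h v. (h, v) \<in> B1 \<Longrightarrow> f v = \<alpha> h v" "\<And>h v. (h, v) \<in> B2 \<Longrightarrow> f v = \<alpha> h v"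
    "\<And>v. v \<in> bdom B1 \<Longrightarrow> f (f (f v)) = v"
    "\<And>x. x \<notin> bdom B1 \<union> bdom B2 \<union> bran B2 \<Longrightarrow> f x = x" by (rule gamma_full[OF adm]) (rule that; assumption)
  have im: "f ` bdom B = bran B" if "\<And>h v. (h, v) \<in> B \<Longrightarrow> f v = \<alpha> h v" for B
    unfolding bran_def image_image by (rule image_cong) (use that in auto)
  have i1: "f ` bdom B1 = bdom B2" using im[of B1] f(3) A(3) by simp
  have i2: "f ` bdom B2 = bran B2" using im[of B2] f(4) by simp
  have "f \<in> \<Gamma>"
  proof (rule cycle_mem[OF \<Gamma> bisection_dom_clopen[OF A(1)], of f], unfold i1 i2)
    fix v assume "v \<in> bdom B1"
    then obtain h where h: "(h, v) \<in> B1" by (metis bdomE)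
    have "\<alpha> h v \<in> bdom B2" using A(3) branI[OF h] by simp
    then obtain k where k: "(k, \<alpha> h v) \<in> B2" by (metis bdomE)
    have G: "h \<in> carrier G" "k \<in> carrier G" "v \<in> topspace X" using h k sub by auto
    obtain U1 where U1: "openin X U1" "v \<in> U1" "\<And>u. u \<in> U1 \<Longrightarrow> (h, u) \<in> B1" using bisection_open[OF A(1) h] by metis
    obtain U2 where U2: "openin X U2" "\<alpha> h v \<in> U2" "\<And>u. u \<in> U2 \<Longrightarrow> (k, u) \<in> B2" using bisection_open[OF A(2) k] by metis
    let ?U = "U1 \<inter> {u \<in> topspace X. \<alpha> h u \<in> U2}"
    have "openin X ?U" using act_preimage_open[OF G(1) U2(1)] U1(1) by blast
    moreover have "v \<in> ?U" using U1 U2 G by simp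
    moreover have "\<forall>u\<in>?U \<inter> bdom B1. f u = \<alpha> h u \<and> f (f u) = \<alpha> (k \<otimes> h) u"
    proof
      fix u assume u: "u \<in> ?U \<inter> bdom B1"
      have "f u = \<alpha> h u" using f(3)[of h u] U1(3) u by simp
      then show "f u = \<alpha> h u \<and> f (f u) = \<alpha> (k \<otimes> h) u"
        using f(4)[of k "\<alpha> h u"] U2(3) u act_mult[OF G(2,1), of u] by simp
    qed
    ultimately show "\<exists>U b c. openin X U \<and> v \<in> U \<and> b \<in> carrier G \<and> c \<in> carrier G \<and>
        (\<forall>u\<in>U \<inter> bdom B1. f u = \<alpha> b u \<and> f (f u) = \<alpha> c u)"
      using G by (intro exI[of _ ?U] exI[of _ h] exI[of _ "k \<otimes> h"] conjI m_closed)
  qed (use A f(5,6) in \<open>auto simp: Int_commute\<close>)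
  then show ?thesis using f by blast
qed

lemma bisection_times:
  assumes "g \<in> carrier G" "clopen U"
  shows "compact_open_bisection gpd ({g} \<times> U)" "bdom ({g} \<times> U) = U" "bran ({g} \<times> U) = \<alpha> g ` U"
proof -
  have U: "U \<subseteq> topspace X" by (rule clopen_subset[OF assms(2)])
  have "compactin X U" using assms(2) compact closedin_compact_space clopen_def by blast
  then have "compactin (Arr gpd) ({g} \<times> U)" using assms(1) by (simp add: compactin_Times)
  moreover have "openin (Arr gpd) ({g} \<times> U)"
    unfolding openin_gpd using assms clopen_open U by auto
  moreover have "inj_on (src gpd) ({g} \<times> U)" by (rule inj_onI) auto
  moreover have "inj_on (rng gpd) ({g} \<times> U)"
    using act_eq[OF assms(1)] U by (auto simp: inj_on_def subset_iff)
  ultimately show "compact_open_bisection gpd ({g} \<times> U)" by (simp add: compact_open_bisection_def)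
  show "bdom ({g} \<times> U) = U" by force
  show "bran ({g} \<times> U) = \<alpha> g ` U" by (force simp: bran_def)
qed

text \<open>\<open>B1\<close> and \<open>B2\<close> are slices with the single labels
  \<open>b \<otimes> inv a\<close> and \<open>c \<otimes> inv b\<close>. The last conclusion
  exhibits an arrow explicitly; through it group elements are recovered as labels.\<close>

lemma rot_gamma:
  assumes d: "disj3 V a b c"
  obtains B1 B2 where "gamma_admissible gpd B1 B2" "rot V a b c \<in> full" "germs (rot V a b c) = gamma gpd B1 B2"
    "\<And>v. v \<in> V \<Longrightarrow> (b \<otimes> inv a, \<alpha> a v) \<in> gamma gpd B1 B2"
proof -
  have G: "a \<in> carrier G" "b \<in> carrier G" "c \<in> carrier G" and V: "clopen V" "V \<subseteq> topspace X"
    using d clopen_subset unfolding disj3_def by auto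
  define B1 B2 where "B1 = {b \<otimes> inv a} \<times> \<alpha> a ` V" and "B2 = {c \<otimes> inv b} \<times> \<alpha> b ` V"
  have q: "\<alpha> (h \<otimes> inv g) ` \<alpha> g ` V = \<alpha> h ` V" if "g \<in> carrier G" "h \<in> carrier G" for g h
    using act_image_mult[of "h \<otimes> inv g" g V] that V by (simp add: m_assoc)
  have 1: "compact_open_bisection gpd B1" "bdom B1 = \<alpha> a ` V" "bran B1 = \<alpha> b ` V"
    using bisection_times[of "b \<otimes> inv a" "\<alpha> a ` V"] act_image_clopen[OF G(1) V(1)] G q by (simp_all add: B1_def)
  have 2: "compact_open_bisection gpd B2" "bdom B2 = \<alpha> b ` V" "bran B2 = \<alpha> c ` V"
    using bisection_times[of "c \<otimes> inv b" "\<alpha> b ` V"] act_image_clopen[OF G(2) V(1)] G q by (simp_all add: B2_def)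
  have dj: "\<alpha> a ` V \<inter> \<alpha> b ` V = {}" "\<alpha> b ` V \<inter> \<alpha> c ` V = {}" "\<alpha> c ` V \<inter> \<alpha> a ` V = {}"
    using d by (simp_all add: disj3_def)
  have adm: "gamma_admissible gpd B1 B2"
    unfolding gamma_admissible_def src_image rng_image 1(2,3) 2(2,3) using 1(1) 2(1) dj by blast
  obtain f where f: "f \<in> full" "germs f = gamma gpd B1 B2"
    "\<And>h v. (h, v) \<in> B1 \<Longrightarrow> f v = \<alpha> h v" "\<And>h v. (h, v) \<in> B2 \<Longrightarrow> f v = \<alpha> h v"
    "\<And>v. v \<in> bdom B1 \<Longrightarrow> f (f (f v)) = v"
    "\<And>x. x \<notin> bdom B1 \<union> bdom B2 \<union> bran B2 \<Longrightarrow> f x = x" by (rule gamma_full[OF adm]) (rule that; assumption)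
  have fa: "f (\<alpha> a v) = \<alpha> b v" and fb: "f (\<alpha> b v) = \<alpha> c v" if "v \<in> V" for v
    using f(3)[of "b \<otimes> inv a" "\<alpha> a v"] f(4)[of "c \<otimes> inv b" "\<alpha> b v"] that V G act_quotient
    by (auto simp: B1_def B2_def)
  have fc: "f (\<alpha> c v) = \<alpha> a v" if "v \<in> V" for v
    using f(5)[of "\<alpha> a v"] fa[OF that] fb[OF that] that 1(2) by simp
  have "f = rot V a b c"
  proof
    fix x show "f x = rot V a b c x"
      by (rule translate_cases[where V=V and x=x and a=a and b=b and c=c])
        (simp_all add: rot_apply[OF d] fa fb fc rot_outside f(6) 1(2) 2(2,3))
  qed
  moreover have "(b \<otimes> inv a, \<alpha> a v) \<in> gamma gpd B1 B2" if "v \<in> V" for v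
    using that unfolding gamma_def by (simp add: B1_def)
  ultimately show ?thesis using that adm f(1,2) by blast
qed

abbreviation "gammas \<equiv> {gamma gpd B1 B2 | B1 B2. gamma_admissible gpd B1 B2}"

lemma gammas_in_FG: "gammas \<subseteq> carrier FG"
proof
  fix B assume "B \<in> gammas"
  then obtain B1 B2 where B: "B = gamma gpd B1 B2" "gamma_admissible gpd B1 B2" by blast
  obtain f where "f \<in> full" "germs f = B" using gamma_full[OF B(2)] B(1) by metis
  then show "B \<in> carrier FG" using FG_carrier by blast
qed

text \<open>The alternating group is the full group with a smaller carrier. Inverses, and with them
  \<open>generate\<close>, depend on the carrier; for a subgroup they agree with those of the
  ambient group.\<close>

lemma finitely_generated_alternating_iff:
  "finitely_generated (alternating_full_group gpd) \<longleftrightarrow>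
     (\<exists>S. finite S \<and> S \<subseteq> generate FG gammas \<and> generate FG S = generate FG gammas)"
proof -
  have sg: "subgroup (generate FG gammas) FG" by (rule group.generate_is_subgroup[OF FG_group gammas_in_FG])
  show ?thesis unfolding finitely_generated_def alternating_full_group_def
    using group.generate_consistent[OF FG_group _ sg] by (auto cong: conj_cong)
qed

section \<open>From generators of the alternating group to generators of the acting group\<close>

theorem group_fg_if_alternating_fg:
  assumes "finitely_generated (alternating_full_group gpd)" and nonempty: "topspace X \<noteq> {}"
  shows "finitely_generated G"
proof -
  obtain S where S: "finite S" "S \<subseteq> generate FG gammas" "generate FG S = generate FG gammas"
    using assms(1) finitely_generated_alternating_iff by blast
  have SF: "S \<subseteq> carrier FG" using S(2) group.generate_incl[OF FG_group gammas_in_FG] by blast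
  \<comment> \<open>All labels of the generators. Each generator contributes finitely many, as its
    set of labels is a compact subset of a discrete space.\<close>
  define D where "D = (\<Union>B\<in>S. fst ` B)"
  have "finite (fst ` B)" "fst ` B \<subseteq> carrier G" if BS: "B \<in> S" for B
  proof -
    obtain f where f: "f \<in> full" "B = germs f" using SF BS FG_carrier by blast
    have "compactin (discrete_topology (carrier G)) (fst ` germs f)"
      by (rule image_compactin[OF germs_compact[OF f(1)]]) (simp add: continuous_map_fst)
    then show "finite (fst ` B)" "fst ` B \<subseteq> carrier G" using f by (simp_all add: compactin_discrete_topology)
  qed
  then have D: "finite D" "D \<subseteq> carrier G" using S(1) by (auto simp: D_def)
  have HD: "subgroup (generate G D) G" by (rule generate_is_subgroup[OF D(2)])
  \<comment> \<open>Composing germs multiplies labels and inverting germs inverts them, so no label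
    leaves the subgroup generated by \<open>D\<close>.\<close>
  have labels: "\<exists>f\<in>full. B = germs f \<and> (\<forall>(g, x)\<in>germs f. g \<in> generate G D)" if "B \<in> generate FG S" for B
    using that
  proof induction
    case one
    have "id \<in> full" by (rule function_group_id[OF function_group_full])
    moreover have "\<forall>(g, x)\<in>germs id. g \<in> generate G D"
      unfolding germs_id gpd_unit_space using generate.one by auto
    ultimately show ?case using FG_one by blast
  next
    case (incl B)
    then obtain f where "f \<in> full" "B = germs f" using SF FG_carrier by blast
    moreover have "\<forall>(g, x)\<in>B. g \<in> generate G D" using incl by (force simp: D_def intro: generate.incl)
    ultimately show ?case by blast
  next
    case (inv B)
    then obtain f where f: "f \<in> full" "B = germs f" using SF FG_carrier by blast
    obtain h where h: "h \<in> full" "f \<circ> h = id" "h \<circ> f = id"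
      using function_group_full f(1) unfolding function_group_def by blast
    have "g \<in> generate G D" if gy: "(g, y) \<in> germs h" for g y
    proof -
      have y: "y \<in> topspace X" using gy by (elim germsE)
      have gG: "g \<in> carrier G" using gy by (elim germsE)
      obtain k where k: "(k, h y) \<in> germs f" using full_germ[OF f(1) full_in[OF h(1) y]] by blast
      then have kD: "k \<in> D" using inv f(2) by (force simp: D_def)
      have "(k \<otimes> g, y) \<in> germs id" using germs_comp[OF k gy] h(2) by simp
      then have "k \<otimes> g = \<one>" unfolding germs_id gpd_unit_space by simp
      then have "g = inv k" using gG kD D(2) by (metis inv_equality inv_inv inv_closed subsetD)
      then show ?thesis using generate.inv[OF kD] by simp
    qed
    moreover have "inv\<^bsub>FG\<^esub> B = germs h" using FG_inv[OF f(1) h(1,3)] f(2) by simp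
    ultimately show ?case using h(1) by blast
  next
    case (eng B C)
    then obtain f h where f: "f \<in> full" "B = germs f" "\<forall>(g, x)\<in>germs f. g \<in> generate G D"
      and h: "h \<in> full" "C = germs h" "\<forall>(g, x)\<in>germs h. g \<in> generate G D" by metis
    have "g \<in> generate G D" if gx: "(g, x) \<in> germs (f \<circ> h)" for g x
    proof -
      have x: "x \<in> topspace X" using gx by (elim germsE)
      obtain k where k: "(k, x) \<in> germs h" using full_germ[OF h(1) x] by blast
      obtain m where m: "(m, h x) \<in> germs f" using full_germ[OF f(1) full_in[OF h(1) x]] by blast
      have "g = m \<otimes> k" using germs_unique[OF gx germs_comp[OF m k]] .
      then show ?thesis using k m f(3) h(3) by (auto intro: generate.eng)
    qed
    moreover have "f \<circ> h \<in> full" by (rule function_group_comp[OF function_group_full f(1) h(1)])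
    ultimately show ?case using FG_mult[OF f(1) h(1)] f(2) h(2) by blast
  qed
  \<comment> \<open>By effectiveness a nontrivial \<open>g\<close> moves some point. Near it
    \<open>\<one>\<close>, \<open>g\<close> and a third label \<open>k\<close> from the infinite
    orbit have disjoint translates, and the resulting 3-cycle has an arrow labelled
    \<open>g\<close>.\<close>
  have "g \<in> generate G D" if g: "g \<in> carrier G" "topspace X \<noteq> {}" "g \<noteq> \<one>" for g
  proof -
    have "\<exists>x\<in>topspace X. \<alpha> g x \<noteq> x" using effective[OF g(1) openin_topspace g(2)] g(3) by blast
    then obtain x where x: "x \<in> topspace X" "\<alpha> g x \<noteq> x" by blast
    obtain k where k: "k \<in> carrier G" "\<alpha> k x \<notin> {x, \<alpha> g x}" using orbit_avoid[OF x(1), of "{x, \<alpha> g x}"] by auto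
    let ?L = "{\<one>, g, k}"
    obtain V where V: "clopen V" "x \<in> V" "V \<subseteq> topspace X"
      "\<And>a b. \<lbrakk>a \<in> ?L; b \<in> ?L; \<alpha> a x \<noteq> \<alpha> b x\<rbrakk> \<Longrightarrow> \<alpha> a ` V \<inter> \<alpha> b ` V = {}"
      by (rule separating_nbhd[of ?L x "topspace X"]) (use g k x in auto)
    have ne: "\<alpha> \<one> x \<noteq> \<alpha> g x" "\<alpha> g x \<noteq> \<alpha> k x" "\<alpha> k x \<noteq> \<alpha> \<one> x" using x k act_one[OF x(1)] by auto
    have d: "disj3 V \<one> g k" unfolding disj3_def using V(1,4) g(1) k(1) ne by simp
    obtain B1 B2 where B: "gamma_admissible gpd B1 B2"
      "\<And>v. v \<in> V \<Longrightarrow> (g \<otimes> inv \<one>, \<alpha> \<one> v) \<in> gamma gpd B1 B2" using rot_gamma[OF d] by metis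
    have gx: "(g, x) \<in> gamma gpd B1 B2" using B(2)[OF V(2)] act_one[OF x(1)] g(1) by simp
    have "gamma gpd B1 B2 \<in> generate FG S" using S(3) B(1) by (auto intro: generate.incl)
    then obtain f where "gamma gpd B1 B2 = germs f" "\<forall>(g, x)\<in>germs f. g \<in> generate G D" using labels by metis
    then show ?thesis using gx by auto
  qed
  then have "generate G D = carrier G"
    using generate_incl[OF D(2)] generate.one nonempty by (metis subsetI subset_antisym)
  then show ?thesis unfolding finitely_generated_def using D by blast
qed

section \<open>From generators of the acting group to generators of the alternating group\<close>

theorem alternating_fg_if_group_fg:
  assumes fg: "finitely_generated G"
    and \<E>: "finite \<E>" "\<And>E. E \<in> \<E> \<Longrightarrow> clopen E"
      "\<And>x y. \<lbrakk>x \<in> topspace X; y \<in> topspace X; x \<noteq> y\<rbrakk> \<Longrightarrow> \<exists>g\<in>carrier G. \<exists>E\<in>\<E>. \<alpha> g x \<in> E \<and> \<alpha> g y \<notin> E"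
  shows "finitely_generated (alternating_full_group gpd)"
proof -
  obtain S where S: "finite S" "S \<subseteq> carrier G" "generate G S = carrier G"
    using fg unfolding finitely_generated_def by blast
  let ?AG = "generate FG gammas"
  have sg: "subgroup ?AG FG" by (rule group.generate_is_subgroup[OF FG_group gammas_in_FG])
  \<comment> \<open>The alternating group as a group of functions; \<open>rot_gamma\<close> places
    all 3-cycles in it, and the finite set \<open>F\<close> is drawn from it.\<close>
  let ?A = "{f \<in> full. germs f \<in> ?AG}"
  have rot_A: "rot V a b c \<in> ?A" if d: "disj3 V a b c" for V a b c
  proof -
    obtain B1 B2 where "gamma_admissible gpd B1 B2" "rot V a b c \<in> full" "germs (rot V a b c) = gamma gpd B1 B2"
      using rot_gamma[OF d] by metis
    then show ?thesis by (auto intro: generate.incl)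
  qed
  obtain F where F: "finite F" "F \<subseteq> ?A"
    "\<And>\<Gamma> V a b c. function_group \<Gamma> \<Longrightarrow> F \<subseteq> \<Gamma> \<Longrightarrow> disj3 V a b c \<Longrightarrow> rot V a b c \<in> \<Gamma>"
    by (rule rot_finitely_generated[OF function_group_germs_subgroup[OF sg] rot_A S \<E>]) (assumption | (rule that; assumption))+
  have FA: "germs ` F \<subseteq> ?AG" using F(2) by blast
  have FC: "germs ` F \<subseteq> carrier FG" using F(2) FG_carrier by blast
  have sgF: "subgroup (generate FG (germs ` F)) FG" by (rule group.generate_is_subgroup[OF FG_group FC])
  \<comment> \<open>The subgroup generated by \<open>F\<close>, seen as functions: it contains all
    3-cycles by the choice of \<open>F\<close>, hence every \<open>gamma\<close> by
    \<open>gamma_mem\<close>.\<close>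
  let ?\<Gamma> = "{f \<in> full. germs f \<in> generate FG (germs ` F)}"
  have \<Gamma>: "function_group ?\<Gamma>" by (rule function_group_germs_subgroup[OF sgF])
  have "F \<subseteq> ?\<Gamma>" using F(2) by (auto intro: generate.incl)
  then have rots: "rot V a b c \<in> ?\<Gamma>" if "disj3 V a b c" for V a b c using F(3)[OF \<Gamma>] that by blast
  have "gammas \<subseteq> generate FG (germs ` F)"
  proof
    fix B assume "B \<in> gammas"
    then obtain B1 B2 where B: "B = gamma gpd B1 B2" "gamma_admissible gpd B1 B2" by blast
    then show "B \<in> generate FG (germs ` F)" using gamma_mem[OF \<Gamma> rots B(2)] by auto
  qed
  then have "?AG \<subseteq> generate FG (germs ` F)" by (rule group.generate_subgroup_incl[OF FG_group _ sgF])
  moreover have "generate FG (germs ` F) \<subseteq> ?AG" by (rule group.generate_subgroup_incl[OF FG_group FA sg])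
  ultimately have "generate FG (germs ` F) = ?AG" by blast
  then show ?thesis unfolding finitely_generated_alternating_iff using F(1) FA by blast
qed

end

section \<open>Actions on the Cantor set\<close>

text \<open>A basic open set of the product restricts finitely many coordinates in a discrete space,
  so it is closed as well as open; its preimage under the homeomorphism is the required
  neighbourhood.\<close>

lemma cantor_zero_dimensional:
  assumes "cantor_space X" shows "zero_dimensional X"
  unfolding zero_dimensional_def
proof (intro allI impI)
  fix U x assume U: "openin X U \<and> x \<in> U"
  let ?C = "product_topology (\<lambda>_::nat. discrete_topology (UNIV :: bool set)) UNIV"
  obtain f where f: "homeomorphic_map X ?C f" using assms unfolding cantor_space_def homeomorphic_space by blast
  have inj: "inj_on f (topspace X)" and cont: "continuous_map X ?C f"
    using f homeomorphic_imp_injective_map homeomorphic_imp_continuous_map by blast+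
  have UT: "U \<subseteq> topspace X" using U openin_subset by blast
  have "openin ?C (f ` U)" using U f homeomorphic_map_openness_eq by blast
  then obtain S where S: "f x \<in> Pi\<^sub>E UNIV S" "Pi\<^sub>E UNIV S \<subseteq> f ` U" "finite {i. S i \<noteq> UNIV}"
    unfolding openin_product_topology_alt using U by fastforce
  let ?K = "{y \<in> topspace X. f y \<in> Pi\<^sub>E UNIV S}"
  have "openin ?C (Pi\<^sub>E UNIV S)" using S(3) by (subst openin_PiE_gen) auto
  moreover have "closedin ?C (Pi\<^sub>E UNIV S)" by (simp add: closedin_product_topology)
  ultimately have "openin X ?K" "closedin X ?K"
    using openin_continuous_map_preimage[OF cont] closedin_continuous_map_preimage[OF cont] by auto
  moreover have "x \<in> ?K" using U UT S(1) by blast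
  moreover have "?K \<subseteq> U"
  proof
    fix y assume y: "y \<in> ?K"
    then obtain u where "u \<in> U" "f y = f u" using S(2) by blast
    then show "y \<in> U" using inj_onD[OF inj, of y u] y UT by auto
  qed
  ultimately show "\<exists>K. openin X K \<and> closedin X K \<and> x \<in> K \<and> K \<subseteq> U" by blast
qed

lemma cantor_compact:
  assumes "cantor_space X" shows "compact_space X"
  using homeomorphic_compact_space[OF assms[unfolded cantor_space_def]]
  by (simp add: compact_space_product_topology compact_space_discrete_topology)

lemma cantor_infinite:
  assumes "cantor_space X" shows "infinite (topspace X)"
proof
  assume fin: "finite (topspace X)"
  let ?C = "product_topology (\<lambda>_::nat. discrete_topology (UNIV :: bool set)) UNIV"
  obtain f where f: "homeomorphic_map X ?C f" using assms unfolding cantor_space_def homeomorphic_space by blast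
  have "topspace ?C = UNIV" by auto
  then have "f ` topspace X = UNIV" using homeomorphic_imp_surjective_map[OF f] by simp
  then have "finite (UNIV :: (nat \<Rightarrow> bool) set)" using fin by (metis finite_imageI)
  then have "finite (UNIV :: nat set)" by (rule finite_fun_UNIVD1) simp
  then show False by simp
qed

text \<open>A finite orbit would be closed in a Hausdorff space and dense by minimality, so the
  space would be finite. A nonempty open set fixed pointwise by \<open>g\<close> contains a point
  with trivial stabiliser, which forces \<open>g\<close> to be the unit. The Hausdorff property is
  taken from the metric in the expansivity assumption.\<close>

lemma cantor_actionI:
  assumes G: "group G" and X: "cantor_space X" and act: "action_by_homeomorphisms G X \<alpha>"
    and exp: "expansive_action G X \<alpha>" and min: "minimal_action G X \<alpha>"
    and free: "essentially_free_action G X \<alpha>"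
  shows "cantor_action G X \<alpha>"
proof -
  interpret group G by (rule G)
  interpret group_action G "topspace X" \<alpha> using act by (simp add: action_by_homeomorphisms_def)
  have haus: "Hausdorff_space X"
    using exp unfolding expansive_action_def by (metis Metric_space.Hausdorff_space_mtopology)
  show ?thesis
  proof (unfold_locales)
    show "\<alpha> \<one>\<^bsub>G\<^esub> x = x" if "x \<in> topspace X" for x using id_eq_one that by (metis restrict_apply')
    show "\<alpha> (g \<otimes>\<^bsub>G\<^esub> h) x = \<alpha> g (\<alpha> h x)" if "g \<in> carrier G" "h \<in> carrier G" "x \<in> topspace X" for g h x
      using composition_rule that by blast
    show "homeomorphic_map X X (\<alpha> g)" if "g \<in> carrier G" for g
      using act that by (simp add: action_by_homeomorphisms_def)
    show "infinite (orbit G \<alpha> x)" if x: "x \<in> topspace X" for x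
    proof
      assume fin: "finite (orbit G \<alpha> x)"
      have "orbit G \<alpha> x \<subseteq> topspace X" using element_image x by (auto simp: orbit_def)
      then have "closedin X (orbit G \<alpha> x)" using fin haus closedin_Hausdorff_finite by blast
      then have "orbit G \<alpha> x = topspace X" using min x closure_of_closedin[of X "orbit G \<alpha> x"] unfolding minimal_action_def by blast
      then show False using fin cantor_infinite[OF X] by simp
    qed
    fix g U assume g: "g \<in> carrier G" and U: "openin X U" "U \<noteq> {}" "\<And>u. u \<in> U \<Longrightarrow> \<alpha> g u = u"
    obtain u where u: "u \<in> U" using U(2) by blast
    then have "u \<in> X closure_of {x \<in> topspace X. stabilizer G \<alpha> x = {\<one>\<^bsub>G\<^esub>}}"
      using free openin_subset[OF U(1)] unfolding essentially_free_action_def by blast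
    then obtain x where "x \<in> U" "stabilizer G \<alpha> x = {\<one>\<^bsub>G\<^esub>}" using U(1) u unfolding in_closure_of by blast
    then show "g = \<one>\<^bsub>G\<^esub>" using U(3) g by (auto simp: stabilizer_def)
  qed (fact cantor_compact[OF X] haus cantor_zero_dimensional[OF X])+
qed

text \<open>In a clopen partition into pieces of diameter at most \<open>\<epsilon>\<close>, points
  more than \<open>\<epsilon>\<close> apart lie in different pieces. The metric condition thus
  becomes the combinatorial one used by \<open>finite_scale\<close>: the translates of finitely many
  clopen sets separate points.\<close>

lemma (in cantor_action) expansive_separating:
  assumes "expansive_action G X \<alpha>"
  obtains \<E> where "finite \<E>" "\<And>E. E \<in> \<E> \<Longrightarrow> clopen E"
    "\<And>x y. \<lbrakk>x \<in> topspace X; y \<in> topspace X; x \<noteq> y\<rbrakk> \<Longrightarrow> \<exists>g\<in>carrier G. \<exists>E\<in>\<E>. \<alpha> g x \<in> E \<and> \<alpha> g y \<notin> E"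
proof -
  obtain d \<epsilon> where d: "Metric_space (topspace X) d" "Metric_space.mtopology (topspace X) d = X" "\<epsilon> > 0"
    "\<forall>x\<in>topspace X. \<forall>y\<in>topspace X. x \<noteq> y \<longrightarrow> (\<exists>g\<in>carrier G. d (\<alpha> g x) (\<alpha> g y) > \<epsilon>)"
    using assms unfolding expansive_action_def by metis
  interpret M: Metric_space "topspace X" d by (rule d(1))
  let ?N = "\<lambda>W. \<forall>x\<in>W. \<forall>y\<in>W. d x y \<le> \<epsilon>"
  obtain \<E> where \<E>: "finite \<E>" "\<Union>\<E> = topspace X" "pairwise disjnt \<E>" "\<And>E. E \<in> \<E> \<Longrightarrow> clopen E \<and> ?N E"
  proof (rule clopen_partition[of ?N])
    fix x assume x: "x \<in> topspace X"
    \<comment> \<open>Half of \<open>\<epsilon>\<close> as radius, since two points of the ball are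
      compared through its centre.\<close>
    have N: "?N (M.mball x (\<epsilon> / 2))"
    proof (intro ballI)
      fix y z assume "y \<in> M.mball x (\<epsilon> / 2)" "z \<in> M.mball x (\<epsilon> / 2)"
      then show "d y z \<le> \<epsilon>" using M.triangle[of y x z] M.commute[of x y] by simp
    qed
    have "\<forall>W. clopen W \<and> W \<subseteq> M.mball x (\<epsilon> / 2) \<longrightarrow> ?N W" using N by (meson subsetD)
    moreover have "openin X (M.mball x (\<epsilon> / 2))" using M.openin_mball[of x "\<epsilon> / 2"] d(2) by simp
    moreover have "x \<in> M.mball x (\<epsilon> / 2)" using x d(3) M.centre_in_mball_iff[of x "\<epsilon> / 2"] by simp
    ultimately show "\<exists>U. openin X U \<and> x \<in> U \<and> (\<forall>W. clopen W \<and> W \<subseteq> U \<longrightarrow> ?N W)"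
      by (intro exI[of _ "M.mball x (\<epsilon> / 2)"] conjI)
  qed auto
  show ?thesis
  proof (rule that[OF \<E>(1)])
    show "clopen E" if "E \<in> \<E>" for E using \<E>(4) that by blast
    fix x y assume xy: "x \<in> topspace X" "y \<in> topspace X" "x \<noteq> y"
    then obtain g where g: "g \<in> carrier G" "d (\<alpha> g x) (\<alpha> g y) > \<epsilon>" using d(4) by blast
    obtain E where E: "E \<in> \<E>" "\<alpha> g x \<in> E" using act_in[OF g(1) xy(1)] \<E>(2) by blast
    have "\<alpha> g y \<notin> E" using \<E>(4)[OF E(1)] E(2) g(2) by (meson not_le)
    then show "\<exists>g\<in>carrier G. \<exists>E\<in>\<E>. \<alpha> g x \<in> E \<and> \<alpha> g y \<notin> E" using g(1) E by blast
  qed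
qed

theorem corollary2p18:
  fixes G :: "('g, 'b) monoid_scheme"
    and X :: "'x topology"
    and \<alpha> :: "'g \<Rightarrow> 'x \<Rightarrow> 'x"
  assumes "group G" and "countable (carrier G)"
    and "cantor_space X"
    and "action_by_homeomorphisms G X \<alpha>"
    and "expansive_action G X \<alpha>"
    and "minimal_action G X \<alpha>"
    and "essentially_free_action G X \<alpha>"
  shows "finitely_generated G \<longleftrightarrow>
         finitely_generated (alternating_full_group (transformation_groupoid G X \<alpha>))"
proof
  interpret cantor_action G X \<alpha> by (rule cantor_actionI[OF assms(1,3-7)])
  show "finitely_generated (alternating_full_group (transformation_groupoid G X \<alpha>))" if fg: "finitely_generated G"
  proof (rule expansive_separating[OF assms(5)])
    fix \<E> assume "finite \<E>" "\<And>E. E \<in> \<E> \<Longrightarrow> clopen E"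
      "\<And>x y. \<lbrakk>x \<in> topspace X; y \<in> topspace X; x \<noteq> y\<rbrakk> \<Longrightarrow> \<exists>g\<in>carrier G. \<exists>E\<in>\<E>. \<alpha> g x \<in> E \<and> \<alpha> g y \<notin> E"
    then show ?thesis by (rule alternating_fg_if_group_fg[OF fg])
  qed
  show "finitely_generated G" if "finitely_generated (alternating_full_group (transformation_groupoid G X \<alpha>))"
    by (rule group_fg_if_alternating_fg[OF that]) (use cantor_infinite[OF assms(3)] in \<open>metis finite.emptyI\<close>)
qed

end
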